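(* Let $\mathcal G$ be a connected, compact, finite quantum graph of total length $L$ with Dirichlet or Neumann conditions at the vertices of degree one and natural conditions at all other vertices. Denote by $D$ the set of Dirichlet vertices, by $N$ the set of Neumann vertices of degree one, and by $\beta:=E-V+1$ the first Betti number, where $E$ and $V$ are the numbers of edges and vertices. If $\mathcal G$ is not a cycle, then for all $k\in\mathbb N$ (i.e. $k\ge1$) $$\lambda_k(\mathcal G)\ \le\ \left(k-2+\beta+|D|+\frac{|N|+\beta}{2}\right)^2\frac{\pi^2}{L^2}.$$
   Context: A quantum graph here is a connected metric graph with finitely many edges of finite length (each edge $e$ identified with $[0,\ell_e]$), joined at finitely many vertices (loops and multiple edges allowed), without vertices of degree two (these can be suppressed by merging the two incident edges; the only exception is the cycle graph), equipped with the Laplacian $-u''$ on each edge. $L$ is the sum of the edge lengths. Natural conditions at a vertex mean continuity of $u$ and vanishing of the sum of the derivatives of $u$ (directed into the edges) over all incident edge ends; at a vertex of degree one this is the Neumann condition $u'=0$. The Dirichlet condition at a degree-one vertex is $u=0$. The eigenvalues are numbered, with multiplicity, starting from $1$: $0\le\lambda_1(\mathcal G)<\lambda_2(\mathcal G)\le\lambda_3(\mathcal G)\le\dots$, whether or not there are Dirichlet vertices. *)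

theory Defs
  imports
    "HOL-Analysis.Analysis"
    "HOL-Library.Function_Algebras"
    "Graph_Theory.Graph_Theory"
begin

text \<open>
  The underlying multigraph is a finite \<^type>\<open>pre_digraph\<close> (loops and multiple arcs
  allowed). The direction of an arc \<open>e\<close> only records the identification of the edge with the
  interval from \<open>0\<close> (at the tail) to \<open>l e\<close> (at the head).
\<close>

text \<open>Both ends of a loop contribute to the degree.\<close>

definition deg :: "('v, 'e) pre_digraph \<Rightarrow> 'v \<Rightarrow> nat" where
  "deg G v = out_degree G v + in_degree G v"

definition betti :: "('v, 'e) pre_digraph \<Rightarrow> int" where
  "betti G = int (card (arcs G)) - int (card (verts G)) + 1"

definition total_length :: "('v, 'e) pre_digraph \<Rightarrow> ('e \<Rightarrow> real) \<Rightarrow> real" where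
  "total_length G l = (\<Sum>e\<in>arcs G. l e)"

text \<open>
  Suppressing all but one of the vertices of such a graph leaves a single loop.
\<close>

definition cycle_graph :: "('v, 'e) pre_digraph \<Rightarrow> bool" where
  "cycle_graph G \<longleftrightarrow> Digraph_Component.connected G \<and> (\<forall>v\<in>verts G. deg G v = 2)"

text \<open>
  \<open>D\<close> is the set of Dirichlet vertices. The graph consisting of a single vertex and no edges
  (total length zero, no functions) is excluded.
\<close>

locale quantum_graph = fin_digraph G
  for G :: "('v, 'e) pre_digraph" (structure) +
  fixes l :: "'e \<Rightarrow> real" and D :: "'v set"
  assumes connected: "Digraph_Component.connected G"
    and arcs_nonempty: "arcs G \<noteq> {}"
    and length_pos: "e \<in> arcs G \<Longrightarrow> 0 < l e"
    and deg_neq_2: "\<not> cycle_graph G \<Longrightarrow> v \<in> verts G \<Longrightarrow> deg G v \<noteq> 2"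
    and Dirichlet: "D \<subseteq> {v \<in> verts G. deg G v = 1}"

definition Neumann_vertices :: "('v, 'e) pre_digraph \<Rightarrow> 'v set \<Rightarrow> 'v set" where
  "Neumann_vertices G D = {v \<in> verts G. deg G v = 1} - D"

text \<open>
  A function on the metric graph is a family \<open>u\<close> of functions on the edges, with derivatives
  \<open>u'\<close>. The derivative directed into the edge is \<open>u' e 0\<close> at the tail and \<open>- u' e (l e)\<close> at the
  head.
\<close>

definition natural_condition ::
  "('v, 'e) pre_digraph \<Rightarrow> ('e \<Rightarrow> real) \<Rightarrow> 'v \<Rightarrow> ('e \<Rightarrow> real \<Rightarrow> real) \<Rightarrow> ('e \<Rightarrow> real \<Rightarrow> real) \<Rightarrow> bool"
where
  "natural_condition G l v u u' \<longleftrightarrow>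
     (\<exists>c. (\<forall>e\<in>out_arcs G v. u e 0 = c) \<and> (\<forall>e\<in>in_arcs G v. u e (l e) = c)) \<and>
     (\<Sum>e\<in>out_arcs G v. u' e 0) + (\<Sum>e\<in>in_arcs G v. - u' e (l e)) = 0"

definition Dirichlet_condition ::
  "('v, 'e) pre_digraph \<Rightarrow> ('e \<Rightarrow> real) \<Rightarrow> 'v \<Rightarrow> ('e \<Rightarrow> real \<Rightarrow> real) \<Rightarrow> bool"
where
  "Dirichlet_condition G l v u \<longleftrightarrow>
     (\<forall>e\<in>out_arcs G v. u e 0 = 0) \<and> (\<forall>e\<in>in_arcs G v. u e (l e) = 0)"

text \<open>
  Functions are made to vanish off the graph, so that functions equal on all the edges are equal.
\<close>

definition eigenspace ::
  "('v, 'e) pre_digraph \<Rightarrow> ('e \<Rightarrow> real) \<Rightarrow> 'v set \<Rightarrow> real \<Rightarrow> ('e \<Rightarrow> real \<Rightarrow> real) set"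
where
  "eigenspace G l D \<mu> =
     {u. (\<forall>e x. \<not> (e \<in> arcs G \<and> x \<in> {0..l e}) \<longrightarrow> u e x = 0) \<and>
         (\<exists>u'. (\<forall>e\<in>arcs G. \<forall>x\<in>{0..l e}.
                  (u e has_real_derivative u' e x) (at x within {0..l e}) \<and>
                  (u' e has_real_derivative - \<mu> * u e x) (at x within {0..l e})) \<and>
               (\<forall>v\<in>verts G - D. natural_condition G l v u u') \<and>
               (\<forall>v\<in>D. Dirichlet_condition G l v u))}"

definition edge_scale :: "real \<Rightarrow> ('e \<Rightarrow> real \<Rightarrow> real) \<Rightarrow> 'e \<Rightarrow> real \<Rightarrow> real" where
  "edge_scale c u = (\<lambda>e x. c * u e x)"

interpretation edge_fun: vector_space "edge_scale :: real \<Rightarrow> ('e \<Rightarrow> real \<Rightarrow> real) \<Rightarrow> _"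
  by unfold_locales (auto simp: edge_scale_def fun_eq_iff algebra_simps)

lemma subspace_eigenspace: "edge_fun.subspace (eigenspace G l D \<mu>)"
proof (rule edge_fun.subspaceI)
  show "0 \<in> eigenspace G l D \<mu>"
    by (auto simp: eigenspace_def natural_condition_def Dirichlet_condition_def zero_fun_def
        intro!: exI[of _ "\<lambda>_ _. 0"])
next
  fix u w assume u: "u \<in> eigenspace G l D \<mu>" and w: "w \<in> eigenspace G l D \<mu>"
  from u obtain u' where u':
    "\<And>e x. e \<in> arcs G \<Longrightarrow> x \<in> {0..l e} \<Longrightarrow> (u e has_real_derivative u' e x) (at x within {0..l e})"
    "\<And>e x. e \<in> arcs G \<Longrightarrow> x \<in> {0..l e} \<Longrightarrow>
       (u' e has_real_derivative - \<mu> * u e x) (at x within {0..l e})"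
    "\<And>v. v \<in> verts G - D \<Longrightarrow> natural_condition G l v u u'"
    "\<And>v. v \<in> D \<Longrightarrow> Dirichlet_condition G l v u"
    unfolding eigenspace_def by blast
  from w obtain w' where w':
    "\<And>e x. e \<in> arcs G \<Longrightarrow> x \<in> {0..l e} \<Longrightarrow> (w e has_real_derivative w' e x) (at x within {0..l e})"
    "\<And>e x. e \<in> arcs G \<Longrightarrow> x \<in> {0..l e} \<Longrightarrow>
       (w' e has_real_derivative - \<mu> * w e x) (at x within {0..l e})"
    "\<And>v. v \<in> verts G - D \<Longrightarrow> natural_condition G l v w w'"
    "\<And>v. v \<in> D \<Longrightarrow> Dirichlet_condition G l v w"
    unfolding eigenspace_def by blast
  have plus: "(u + w) e = (\<lambda>x. u e x + w e x)" for e
    by (simp add: fun_eq_iff)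
  have "natural_condition G l v (u + w) (\<lambda>e x. u' e x + w' e x)" if v: "v \<in> verts G - D" for v
  proof -
    obtain c d where
      "\<forall>e\<in>out_arcs G v. u e 0 = c" "\<forall>e\<in>in_arcs G v. u e (l e) = c"
      "\<forall>e\<in>out_arcs G v. w e 0 = d" "\<forall>e\<in>in_arcs G v. w e (l e) = d"
      using u'(3)[OF v] w'(3)[OF v] unfolding natural_condition_def by blast
    then have "\<exists>c. (\<forall>e\<in>out_arcs G v. (u + w) e 0 = c) \<and> (\<forall>e\<in>in_arcs G v. (u + w) e (l e) = c)"
      unfolding plus by (intro exI[of _ "c + d"]) simp
    moreover have "(\<Sum>e\<in>out_arcs G v. u' e 0 + w' e 0) +
          (\<Sum>e\<in>in_arcs G v. - (u' e (l e) + w' e (l e))) =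
        ((\<Sum>e\<in>out_arcs G v. u' e 0) + (\<Sum>e\<in>in_arcs G v. - u' e (l e))) +
        ((\<Sum>e\<in>out_arcs G v. w' e 0) + (\<Sum>e\<in>in_arcs G v. - w' e (l e)))"
      by (simp only: sum.distrib minus_add_distrib add_ac)
    ultimately show ?thesis
      using u'(3)[OF v] w'(3)[OF v] unfolding natural_condition_def by (simp only: add_0_left simp_thms)
  qed
  moreover have "((u + w) e has_real_derivative u' e x + w' e x) (at x within {0..l e})"
    if "e \<in> arcs G" "x \<in> {0..l e}" for e x
    unfolding plus by (intro DERIV_add u'(1) w'(1) that)
  moreover have "((\<lambda>x. u' e x + w' e x) has_real_derivative - \<mu> * (u + w) e x) (at x within {0..l e})"
    if "e \<in> arcs G" "x \<in> {0..l e}" for e x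
    unfolding plus distrib_left by (intro DERIV_add u'(2) w'(2) that)
  moreover have "\<forall>v\<in>D. Dirichlet_condition G l v (u + w)"
    using u'(4) w'(4) by (simp add: Dirichlet_condition_def)
  moreover have "\<forall>e x. \<not> (e \<in> arcs G \<and> x \<in> {0..l e}) \<longrightarrow> (u + w) e x = 0"
    using u w by (simp add: eigenspace_def)
  ultimately show "u + w \<in> eigenspace G l D \<mu>"
    unfolding eigenspace_def
    by (intro CollectI conjI exI[of _ "\<lambda>e x. u' e x + w' e x"] ballI) simp_all
next
  fix c u assume u: "u \<in> eigenspace G l D \<mu>"
  then obtain u' where u':
    "\<And>e x. e \<in> arcs G \<Longrightarrow> x \<in> {0..l e} \<Longrightarrow> (u e has_real_derivative u' e x) (at x within {0..l e})"
    "\<And>e x. e \<in> arcs G \<Longrightarrow> x \<in> {0..l e} \<Longrightarrow>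
       (u' e has_real_derivative - \<mu> * u e x) (at x within {0..l e})"
    "\<And>v. v \<in> verts G - D \<Longrightarrow> natural_condition G l v u u'"
    "\<And>v. v \<in> D \<Longrightarrow> Dirichlet_condition G l v u"
    unfolding eigenspace_def by blast
  have scale: "edge_scale c u e = (\<lambda>x. c * u e x)" for e
    by (simp add: edge_scale_def)
  have "natural_condition G l v (edge_scale c u) (\<lambda>e x. c * u' e x)" if v: "v \<in> verts G - D" for v
  proof -
    obtain d where
      "\<forall>e\<in>out_arcs G v. u e 0 = d" "\<forall>e\<in>in_arcs G v. u e (l e) = d"
      using u'(3)[OF v] unfolding natural_condition_def by blast
    then have "\<exists>d. (\<forall>e\<in>out_arcs G v. edge_scale c u e 0 = d) \<and>
        (\<forall>e\<in>in_arcs G v. edge_scale c u e (l e) = d)"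
      unfolding scale by (intro exI[of _ "c * d"]) simp
    moreover have "(\<Sum>e\<in>out_arcs G v. c * u' e 0) + (\<Sum>e\<in>in_arcs G v. - (c * u' e (l e))) =
        c * ((\<Sum>e\<in>out_arcs G v. u' e 0) + (\<Sum>e\<in>in_arcs G v. - u' e (l e)))"
      by (simp only: distrib_left sum_distrib_left mult_minus_right)
    ultimately show ?thesis
      using u'(3)[OF v] unfolding natural_condition_def by simp
  qed
  moreover have "(edge_scale c u e has_real_derivative c * u' e x) (at x within {0..l e})"
    if "e \<in> arcs G" "x \<in> {0..l e}" for e x
    unfolding scale by (intro DERIV_cmult u'(1) that)
  moreover have "((\<lambda>x. c * u' e x) has_real_derivative - \<mu> * edge_scale c u e x) (at x within {0..l e})"
    if "e \<in> arcs G" "x \<in> {0..l e}" for e x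
    unfolding scale mult.left_commute[of "- \<mu>"] by (intro DERIV_cmult u'(2) that)
  moreover have "\<forall>v\<in>D. Dirichlet_condition G l v (edge_scale c u)"
    using u'(4) by (simp add: Dirichlet_condition_def scale)
  moreover have "\<forall>e x. \<not> (e \<in> arcs G \<and> x \<in> {0..l e}) \<longrightarrow> edge_scale c u e x = 0"
    using u by (simp add: eigenspace_def scale)
  ultimately show "edge_scale c u \<in> eigenspace G l D \<mu>"
    unfolding eigenspace_def
    by (intro CollectI conjI exI[of _ "\<lambda>e x. c * u' e x"] ballI) simp_all
qed

definition is_eigenvalue ::
  "('v, 'e) pre_digraph \<Rightarrow> ('e \<Rightarrow> real) \<Rightarrow> 'v set \<Rightarrow> real \<Rightarrow> bool" where
  "is_eigenvalue G l D \<mu> \<longleftrightarrow> (\<exists>u\<in>eigenspace G l D \<mu>. u \<noteq> 0)"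

definition multiplicity ::
  "('v, 'e) pre_digraph \<Rightarrow> ('e \<Rightarrow> real) \<Rightarrow> 'v set \<Rightarrow> real \<Rightarrow> nat" where
  "multiplicity G l D \<mu> = edge_fun.dim (eigenspace G l D \<mu>)"

text \<open>The number of eigenvalues up to \<open>t\<close>, counted with multiplicity.\<close>

definition eigenvalue_count ::
  "('v, 'e) pre_digraph \<Rightarrow> ('e \<Rightarrow> real) \<Rightarrow> 'v set \<Rightarrow> real \<Rightarrow> nat" where
  "eigenvalue_count G l D t = (\<Sum>\<mu> | is_eigenvalue G l D \<mu> \<and> \<mu> \<le> t. multiplicity G l D \<mu>)"

text \<open>
  For \<open>k \<ge> 1\<close> this is the \<open>k\<close>-th entry of the nondecreasing list of eigenvalues, repeated
  according to multiplicity and numbered from \<open>1\<close>. The value is extended real so that it would be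
  \<open>\<infinity>\<close> if the list had fewer than \<open>k\<close> entries; a finite upper bound thus includes the existence of
  the eigenvalue.
\<close>

definition eigenvalue ::
  "('v, 'e) pre_digraph \<Rightarrow> ('e \<Rightarrow> real) \<Rightarrow> 'v set \<Rightarrow> nat \<Rightarrow> ereal" where
  "eigenvalue G l D k = Inf (ereal ` {\<mu>. is_eigenvalue G l D \<mu> \<and> k \<le> eigenvalue_count G l D \<mu>})"

end

theory Submission
  imports Defs
begin

text \<open>
  The proof counts nonpositive directions of quadratic forms on finite-dimensional spaces.

  Fix a frequency \<open>K > 0\<close> and subdivide every edge into \<open>m\<close> links of length \<open>h\<close> with \<open>K h < \<pi>\<close>. For
  \<open>0 \<le> w \<le> K\<close> and values \<open>x\<close> at the nodes, the grid form \<open>Q w x\<close> is the minimum of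
  \<open>\<integral> u'\<^sup>2 - w\<^sup>2 \<integral> u\<^sup>2\<close> over the functions \<open>u\<close> with these values; it is attained by the function that
  solves \<open>u'' = - w\<^sup>2 u\<close> on every link. Its kernel consists of the node values of the
  eigenfunctions for \<open>w\<^sup>2\<close>, it is nonnegative for \<open>w = 0\<close>, and it decreases strictly in \<open>w\<close>. As \<open>w\<close>
  grows, the number of nonpositive directions can therefore change only where the kernel is nontrivial,
  and then by the dimension of the kernel at most (\<open>spectral_flow\<close>). So there are at least \<open>dim W\<close>
  eigenvalues up to \<open>K\<^sup>2\<close>, with multiplicity, for every space \<open>W\<close> on which \<open>Q K \<le> 0\<close>. This replaces
  the min-max principle, and the existence of the eigenvalues is part of the result.

  A large space \<open>W\<close> comes from Gaussian elimination of the links, with the Pruefer angle as a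
  potential (\<open>network_index\<close>). A boundary condition at a node is recorded by an angle \<open>\<phi>\<close>, meaning
  \<open>u' = K cot \<phi> u\<close> for the derivative directed out of the network: \<open>\<pi>/2\<close> is the Neumann and \<open>\<pi>\<close> the Dirichlet
  condition. Removing a link with \<open>\<theta> = K h\<close> at a leaf with angle \<open>\<phi>\<close> leaves the angle \<open>\<phi> - \<theta>\<close> at the
  other end, or \<open>\<phi> - \<theta> + \<pi>\<close> if that is not positive, and in the second case one nonpositive
  direction is gained (\<open>eliminate_end\<close>). Several angles at one node act as a single angle that is not
  larger than their sum (\<open>merge_angles\<close>). If there is no leaf, a link that is not a bridge is cut at a
  node where enough other ends remain: the new Neumann end costs \<open>\<pi>/2\<close> and the lost continuity
  condition costs one dimension, that is \<open>\<pi>\<close>. Hence every independent cycle costs \<open>3\<pi>/2\<close>, and the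
  number \<open>n\<close> of nonpositive directions satisfies
  \<open>n \<pi> \<ge> K L - \<pi> |D| - \<pi> |N| / 2 + \<pi> - 3 \<pi> \<beta> / 2\<close>.
  If \<open>K L / \<pi>\<close> exceeds the number that is squared in the theorem, the right-hand side exceeds
  \<open>(k - 1) \<pi>\<close>, so that \<open>n \<ge> k\<close>. Then \<open>K\<close> tends to its lower limit.
\<close>

section \<open>Finite-dimensional subspaces and the inertia of a form\<close>

text \<open>
  With the pointwise structure, functions on nodes and functions on edges are covered by the same
  linear algebra; on the latter the scalar multiplication is \<open>edge_scale\<close>.
\<close>

instantiation "fun" :: (type, real_vector) real_vector
begin

definition scaleR_fun :: "real \<Rightarrow> ('a \<Rightarrow> 'b) \<Rightarrow> 'a \<Rightarrow> 'b" where
  "scaleR_fun c f = (\<lambda>x. c *\<^sub>R f x)"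

instance
  by standard (auto simp: scaleR_fun_def fun_eq_iff scaleR_add_right scaleR_add_left)

end

lemma scaleR_fun_apply [simp]: "(c *\<^sub>R f) x = c *\<^sub>R f x"
  by (simp add: scaleR_fun_def)

lemma sum_fun_apply: "(\<Sum>i\<in>I. f i) x = (\<Sum>i\<in>I. f i x)" for f :: "'i \<Rightarrow> 'a \<Rightarrow> 'b::comm_monoid_add"
  by (induction I rule: infinite_finite_induct) auto

text \<open>
  The spaces in question are subspaces of function spaces over arbitrary types, which belong to no
  class of finite-dimensional spaces.
\<close>

definition fin_dim :: "'a::real_vector set \<Rightarrow> bool" where
  "fin_dim V \<longleftrightarrow> (\<exists>B. finite B \<and> V \<subseteq> span B)"

lemma fin_dim_mono: "fin_dim V \<Longrightarrow> W \<subseteq> V \<Longrightarrow> fin_dim W"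
  unfolding fin_dim_def by blast

lemma fin_dim_span_finite: "finite S \<Longrightarrow> fin_dim (span S)"
  unfolding fin_dim_def by blast

lemma independent_fin_dim:
  assumes "fin_dim V" "S \<subseteq> V" "independent S"
  shows "finite S" "card S \<le> dim V"
proof -
  obtain T where T: "finite T" "V \<subseteq> span T" using assms(1) by (auto simp: fin_dim_def)
  obtain B where B: "B \<subseteq> V" "independent B" "V \<subseteq> span B" "card B = dim V"
    using basis_exists by blast
  have "finite B" using independent_span_bound[OF T(1) B(2)] B(1) T(2) by blast
  then have "finite S \<and> card S \<le> card B"
    using independent_span_bound[of B S] assms B(3) by blast
  with B(4) show "finite S" "card S \<le> dim V" by auto
qed

lemma fin_dim_basis:
  assumes "fin_dim V"
  obtains B where "finite B" "B \<subseteq> V" "independent B" "V \<subseteq> span B" "card B = dim V"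
proof -
  obtain B where "B \<subseteq> V" "independent B" "V \<subseteq> span B" "card B = dim V"
    using basis_exists by blast
  with that independent_fin_dim[OF assms] show ?thesis by blast
qed

lemma independent_Un_span:
  assumes "independent S" "independent T" "finite S" "finite T"
    and inter: "\<And>x. x \<in> span S \<Longrightarrow> x \<in> span T \<Longrightarrow> x = 0"
  shows "independent (S \<union> T)" "S \<inter> T = {}"
proof -
  show disj: "S \<inter> T = {}"
    using inter span_base assms(1) dependent_zero by blast
  show "independent (S \<union> T)"
  proof (rule independent_if_scalars_zero)
    show "finite (S \<union> T)" using assms by simp
  next
    fix f x assume 0: "(\<Sum>x\<in>S \<union> T. f x *\<^sub>R x) = 0" and x: "x \<in> S \<union> T"
    have eq: "(\<Sum>x\<in>S. f x *\<^sub>R x) = - (\<Sum>x\<in>T. f x *\<^sub>R x)"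
      using 0 assms disj by (simp add: sum.union_disjoint add_eq_0_iff2)
    have "(\<Sum>x\<in>S. f x *\<^sub>R x) \<in> span S" "(\<Sum>x\<in>T. f x *\<^sub>R x) \<in> span T"
      by (rule span_sum, rule span_scale, erule span_base)+
    moreover from this(2) have "(\<Sum>x\<in>S. f x *\<^sub>R x) \<in> span T"
      unfolding eq by (rule span_neg)
    ultimately have "(\<Sum>x\<in>S. f x *\<^sub>R x) = 0" by (intro inter)
    with eq have "(\<Sum>x\<in>S. f x *\<^sub>R x) = 0" "(\<Sum>x\<in>T. f x *\<^sub>R x) = 0" by simp_all
    then show "f x = 0"
      using x independentD[OF assms(1,3) subset_refl, of f x]
        independentD[OF assms(2,4) subset_refl, of f x] by auto
  qed
qed

lemma card_add_le_dim:
  assumes "fin_dim V" "subspace V" "S \<subseteq> V" "T \<subseteq> V" "independent S" "independent T"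
    and inter: "\<And>x. x \<in> span S \<Longrightarrow> x \<in> span T \<Longrightarrow> x = 0"
  shows "card S + card T \<le> dim V"
proof -
  have fin: "finite S" "finite T" using independent_fin_dim assms by blast+
  note I = independent_Un_span[OF assms(5,6) fin inter]
  have "card (S \<union> T) \<le> dim V" using independent_fin_dim(2)[OF assms(1) _ I(1)] assms by blast
  then show ?thesis using card_Un_disjoint[OF fin I(2)] by simp
qed

lemma sylvester_independent:
  assumes "bilinear B" "finite S" "\<And>p. p \<in> S \<Longrightarrow> B p p \<noteq> (0::real)"
    "\<And>p q. p \<in> S \<Longrightarrow> q \<in> S \<Longrightarrow> p \<noteq> q \<Longrightarrow> B p q = 0"
  shows "independent S"
proof (rule independent_if_scalars_zero[OF assms(2)])
  fix f x assume 0: "(\<Sum>x\<in>S. f x *\<^sub>R x) = 0" and x: "x \<in> S"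
  interpret l: linear "\<lambda>z. B z x" using assms(1) by (simp add: bilinear_def)
  have "0 = B (\<Sum>z\<in>S. f z *\<^sub>R z) x" using 0 by (simp add: l.zero)
  also have "\<dots> = (\<Sum>z\<in>S. f z * B z x)" by (simp add: l.sum l.scale)
  also have "\<dots> = (\<Sum>z\<in>S. if z = x then f x * B x x else 0)"
    by (rule sum.cong) (use assms(4) x in auto)
  also have "\<dots> = f x * B x x" using assms(2) x by simp
  finally show "f x = 0" using assms(3)[OF x] by simp
qed

definition form_kernel :: "('a \<Rightarrow> 'a \<Rightarrow> real) \<Rightarrow> 'a set \<Rightarrow> 'a set" where
  "form_kernel B V = {x \<in> V. \<forall>y\<in>V. B x y = 0}"

text \<open>
  Sylvester's law of inertia, in the form of an orthonormal system of maximal size. By maximality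
  the form vanishes on the orthogonal complement of the system in \<open>V\<close>, so that this complement is the
  kernel.
\<close>

lemma sylvester:
  fixes B :: "'a::real_vector \<Rightarrow> 'a \<Rightarrow> real"
  assumes bil: "bilinear B" and sym: "\<And>x y. B x y = B y x" and V: "subspace V" "fin_dim V"
  obtains P N where "finite P" "finite N" "P \<subseteq> V" "N \<subseteq> V"
    "\<And>p. p \<in> P \<Longrightarrow> B p p = 1" "\<And>p. p \<in> N \<Longrightarrow> B p p = - 1"
    "\<And>p q. p \<in> P \<union> N \<Longrightarrow> q \<in> P \<union> N \<Longrightarrow> p \<noteq> q \<Longrightarrow> B p q = 0"
    "independent P" "independent N"
    "dim V \<le> card P + card N + dim (form_kernel B V)"
proof -
  define ortho where "ortho S \<longleftrightarrow> S \<subseteq> V \<and> finite S \<and> (\<forall>p\<in>S. \<bar>B p p\<bar> = 1) \<and>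
    (\<forall>p\<in>S. \<forall>q\<in>S. p \<noteq> q \<longrightarrow> B p q = 0)" for S
  have ind: "independent S" if "ortho S" for S
  proof (rule sylvester_independent[OF bil])
    show "B p p \<noteq> 0" if "p \<in> S" for p
      using that \<open>ortho S\<close> unfolding ortho_def by fastforce
  qed (use that in \<open>simp_all add: ortho_def\<close>)
  have "ortho {}" by (simp add: ortho_def)
  moreover have "card S \<le> dim V" if "ortho S" for S
    using independent_fin_dim(2)[OF V(2) _ ind[OF that]] that by (simp add: ortho_def)
  ultimately have "\<exists>S. ortho S \<and> (\<forall>T. ortho T \<longrightarrow> card T \<le> card S)"
    by (intro ex_has_greatest_nat[of ortho "{}" card "Suc (dim V)"]) (simp_all add: less_Suc_eq_le)
  then obtain S where S: "ortho S" and max: "\<And>T. ortho T \<Longrightarrow> card T \<le> card S"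
    by blast
  have finS: "finite S" and SV: "S \<subseteq> V" using S by (auto simp: ortho_def)
  define V0 where "V0 = {x \<in> V. \<forall>p\<in>S. B x p = 0}"
  interpret l: linear "\<lambda>x. B x y" for y using bil by (simp add: bilinear_def)
  interpret r: linear "\<lambda>y. B x y" for x using bil by (simp add: bilinear_def)
  have iso: "B x x = 0" if x: "x \<in> V0" for x
  proof (rule ccontr)
    assume nz: "B x x \<noteq> 0"
    \<comment> \<open>Normalised, \<open>x\<close> would extend the maximal system.\<close>
    define c where "c = 1 / sqrt \<bar>B x x\<bar>"
    have "c * c = 1 / \<bar>B x x\<bar>" by (simp add: c_def)
    then have "\<bar>B (c *\<^sub>R x) (c *\<^sub>R x)\<bar> = 1"
      using nz unfolding l.scale r.scale real_scaleR_def by (simp add: abs_mult mult.assoc[symmetric])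
    moreover have B0: "B (c *\<^sub>R x) p = 0" "B p (c *\<^sub>R x) = 0" if "p \<in> S" for p
    proof -
      have "B x p = 0" "B p x = 0" using x that sym[of p x] by (auto simp: V0_def)
      then show "B (c *\<^sub>R x) p = 0" "B p (c *\<^sub>R x) = 0"
        by (simp_all only: l.scale r.scale scaleR_zero_right)
    qed
    moreover have "c *\<^sub>R x \<in> V" using x V(1) by (simp add: V0_def subspace_scale)
    ultimately have "ortho (insert (c *\<^sub>R x) S)" "c *\<^sub>R x \<notin> S"
      using S by (auto simp: ortho_def)
    then show False using max finS by fastforce
  qed
  have null: "B x y = 0" if "x \<in> V0" "y \<in> V0" for x y
  proof -
    have "x + y \<in> V0" using that V(1) unfolding V0_def
      by (simp add: l.add subspace_add)
    from iso[OF this] iso[OF that(1)] iso[OF that(2)] sym[of x y] show ?thesis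
      unfolding l.add r.add by linarith
  qed
  have SS: "(\<Sum>p\<in>S. g p * B p q) = g q * B q q" if "q \<in> S" for g q
  proof -
    have "(\<Sum>p\<in>S. g p * B p q) = (\<Sum>p\<in>S. if p = q then g q * B q q else 0)"
      by (rule sum.cong) (use S that in \<open>auto simp: ortho_def\<close>)
    then show ?thesis using finS that by simp
  qed
  define res where "res x = x - (\<Sum>p\<in>S. (B x p * B p p) *\<^sub>R p)" for x
  have res: "res x \<in> V0" if "x \<in> V" for x
  proof -
    have "B (res x) q = 0" if "q \<in> S" for q
    proof -
      have "B (res x) q = B x q - (\<Sum>p\<in>S. (B x p * B p p) * B p q)"
        by (simp only: res_def l.diff l.sum l.scale real_scaleR_def)
      also have "\<dots> = B x q - B x q * (B q q * B q q)"
        unfolding SS[OF that, of "\<lambda>p. B x p * B p p"] by (simp only: mult.assoc)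
      also have "B q q * B q q = 1"
      proof -
        have "\<bar>B q q\<bar> = 1" using S that unfolding ortho_def by blast
        then show ?thesis by (metis abs_mult_self_eq mult_1)
      qed
      finally show ?thesis by simp
    qed
    moreover have "res x \<in> V" unfolding res_def using that V(1) SV
      by (intro subspace_diff subspace_sum subspace_scale) auto
    ultimately show ?thesis by (simp add: V0_def)
  qed
  have ker: "V0 \<subseteq> form_kernel B V"
  proof
    fix x assume x: "x \<in> V0"
    have "B x y = 0" if y: "y \<in> V" for y
    proof -
      have "B x y = B x (res y) + (\<Sum>p\<in>S. (B y p * B p p) * B x p)"
        by (simp only: res_def r.diff r.sum r.scale real_scaleR_def diff_add_cancel)
      then show ?thesis using null[OF x res[OF y]] x by (simp add: V0_def)
    qed
    with x show "x \<in> form_kernel B V" by (simp add: V0_def form_kernel_def)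
  qed
  have kV: "fin_dim (form_kernel B V)"
    using V(2) by (rule fin_dim_mono) (auto simp: form_kernel_def)
  obtain K where K: "finite K" "form_kernel B V \<subseteq> span K" "card K = dim (form_kernel B V)"
    using fin_dim_basis[OF kV] by metis
  have "V \<subseteq> span (S \<union> K)"
  proof
    fix x assume x: "x \<in> V"
    have "res x \<in> span (S \<union> K)"
      using res[OF x] ker K(2) span_mono[of K "S \<union> K"] by blast
    moreover have "(\<Sum>p\<in>S. (B x p * B p p) *\<^sub>R p) \<in> span (S \<union> K)"
      by (rule span_sum, rule span_scale, rule span_base) simp
    moreover have "x = res x + (\<Sum>p\<in>S. (B x p * B p p) *\<^sub>R p)" by (simp add: res_def)
    ultimately show "x \<in> span (S \<union> K)" by (metis span_add)
  qed
  then have "dim V \<le> card (S \<union> K)" using finS K(1) by (intro dim_le_card) auto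
  also have "\<dots> \<le> card S + card K" by (rule card_Un_le)
  finally have dimV: "dim V \<le> card S + dim (form_kernel B V)" using K(3) by simp
  define P where "P = {p \<in> S. B p p = 1}"
  define N where "N = {p \<in> S. B p p = - 1}"
  have "S = P \<union> N" "P \<inter> N = {}"
    using S by (auto simp: P_def N_def ortho_def abs_eq_iff)
  then have "card S = card P + card N" using finS by (simp add: card_Un_disjoint)
  with dimV have dimV: "dim V \<le> card P + card N + dim (form_kernel B V)" by simp
  have ind_PN: "independent P" "independent N"
    by (rule independent_mono[OF ind[OF S]]; auto simp: P_def N_def)+
  have fin_PN: "finite P" "finite N" "P \<subseteq> V" "N \<subseteq> V"
    using finS SV by (auto simp: P_def N_def)
  have diag: "B p p = 1" if "p \<in> P" for p using that by (simp add: P_def)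
  have diag': "B p p = - 1" if "p \<in> N" for p using that by (simp add: N_def)
  have off: "B p q = 0" if "p \<in> P \<union> N" "q \<in> P \<union> N" "p \<noteq> q" for p q
    using S that unfolding \<open>S = P \<union> N\<close>[symmetric] ortho_def by blast
  show ?thesis
    using that[OF fin_PN diag diag' off ind_PN dimV] .
qed

lemma ortho_form_span:
  assumes "bilinear B" "finite P"
  shows "B (\<Sum>p\<in>P. c p *\<^sub>R p) (\<Sum>p\<in>P. c p *\<^sub>R p) = (\<Sum>p\<in>P. \<Sum>q\<in>P. c p * c q * (B p q :: real))"
proof -
  interpret l: linear "\<lambda>x. B x y" for y using assms by (simp add: bilinear_def)
  interpret r: linear "\<lambda>y. B x y" for x using assms by (simp add: bilinear_def)
  show ?thesis
    unfolding l.sum l.scale unfolding r.sum r.scale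
    by (simp only: real_scaleR_def sum_distrib_left mult.assoc)
qed

text \<open>
  Diagonal dominance: by \<open>2 \<bar>c d\<bar> \<le> c\<^sup>2 + d\<^sup>2\<close> the deviation of the Gram matrix from the unit matrix is
  absorbed by the sum of the squares of the coefficients.
\<close>

lemma positive_on_ortho_span:
  assumes "bilinear B" "finite P" and small: "\<And>p q. p \<in> P \<Longrightarrow> q \<in> P \<Longrightarrow>
     \<bar>B p q - (if p = q then 1 else 0)\<bar> * real (card P) < (1::real)"
    and x: "x \<in> span P" "x \<noteq> 0"
  shows "B x x > 0"
proof -
  obtain c where c: "x = (\<Sum>p\<in>P. c p *\<^sub>R p)"
    using x(1) unfolding span_finite[OF assms(2)] by (rule imageE)
  have "P \<noteq> {}" using x by auto
  then have n0: "real (card P) > 0" using assms(2) by (simp add: card_gt_0_iff)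
  obtain a where a: "a \<in> P" "c a \<noteq> 0"
    using x(2) c by (metis (no_types, lifting) scaleR_eq_0_iff sum.neutral)
  define M where "M = Max ((\<lambda>(p,q). \<bar>B p q - (if p = q then 1 else 0)\<bar>) ` (P \<times> P))"
  have Mub: "\<bar>B p q - (if p = q then 1 else 0)\<bar> \<le> M" if "p \<in> P" "q \<in> P" for p q
    unfolding M_def using that assms(2) by (intro Max_ge) force+
  have "M \<in> (\<lambda>(p,q). \<bar>B p q - (if p = q then 1 else 0)\<bar>) ` (P \<times> P)"
    unfolding M_def using a assms(2) by (intro Max_in) auto
  then have Mn: "M * real (card P) < 1" using small by auto
  have split: "B x x = (\<Sum>p\<in>P. (c p)\<^sup>2) + (\<Sum>p\<in>P. \<Sum>q\<in>P. c p * c q * (B p q - (if p = q then 1 else 0)))"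
  proof -
    have "B x x = (\<Sum>p\<in>P. \<Sum>q\<in>P. c p * c q * B p q)"
      unfolding c using ortho_form_span[OF assms(1,2)] .
    also have "\<dots> = (\<Sum>p\<in>P. \<Sum>q\<in>P. (if p = q then c p * c p else 0) +
        c p * c q * (B p q - (if p = q then 1 else 0)))"
      by (intro sum.cong) (auto simp: algebra_simps)
    also have "\<dots> = (\<Sum>p\<in>P. c p * c p) + (\<Sum>p\<in>P. \<Sum>q\<in>P. c p * c q * (B p q - (if p = q then 1 else 0)))"
      using assms(2) by (simp add: sum.distrib)
    finally show ?thesis by (simp add: power2_eq_square)
  qed
  have "\<bar>\<Sum>p\<in>P. \<Sum>q\<in>P. c p * c q * (B p q - (if p = q then 1 else 0))\<bar>
      \<le> (\<Sum>p\<in>P. \<Sum>q\<in>P. ((c p)\<^sup>2 / 2 + (c q)\<^sup>2 / 2) * M)"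
  proof (rule order_trans[OF sum_abs sum_mono], rule order_trans[OF sum_abs sum_mono])
    fix p q assume pq: "p \<in> P" "q \<in> P"
    have "0 \<le> (\<bar>c p\<bar> - \<bar>c q\<bar>)\<^sup>2" by simp
    then have "\<bar>c p * c q\<bar> \<le> (c p)\<^sup>2 / 2 + (c q)\<^sup>2 / 2"
      by (simp add: power2_diff abs_mult)
    then show "\<bar>c p * c q * (B p q - (if p = q then 1 else 0))\<bar> \<le> ((c p)\<^sup>2 / 2 + (c q)\<^sup>2 / 2) * M"
      unfolding abs_mult[of "c p * c q"] using Mub[OF pq] by (intro mult_mono) auto
  qed
  also have "\<dots> = (\<Sum>p\<in>P. \<Sum>q\<in>P. (c p)\<^sup>2 / 2 + (c q)\<^sup>2 / 2) * M"
    by (simp only: sum_distrib_right)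
  also have "\<dots> = (M * real (card P)) * (\<Sum>p\<in>P. (c p)\<^sup>2)"
    by (simp add: sum.distrib sum_divide_distrib[symmetric] flip: sum_distrib_left)
  also have "\<dots> < 1 * (\<Sum>p\<in>P. (c p)\<^sup>2)"
  proof (rule mult_strict_right_mono[OF Mn])
    show "0 < (\<Sum>p\<in>P. (c p)\<^sup>2)" using a assms(2) by (intro sum_pos2[of _ a]) auto
  qed
  finally show ?thesis using split by linarith
qed

text \<open>
  Positive definiteness on a finite-dimensional space is an open condition. An orthonormal basis
  for the limit form reduces it to finitely many entries, so that no norm on the space is needed.
\<close>

lemma positive_definite_eventually:
  fixes B :: "'b \<Rightarrow> 'a::real_vector \<Rightarrow> 'a \<Rightarrow> real"
  assumes W: "subspace W" "fin_dim W"
    and bil: "bilinear B0" "\<And>t. bilinear (B t)" and sym: "\<And>x y. B0 x y = B0 y x"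
    and pos: "\<And>x. x \<in> W \<Longrightarrow> x \<noteq> 0 \<Longrightarrow> B0 x x > 0"
    and lim: "\<And>x y. x \<in> W \<Longrightarrow> y \<in> W \<Longrightarrow> ((\<lambda>t. B t x y) \<longlongrightarrow> B0 x y) F"
  shows "eventually (\<lambda>t. \<forall>x\<in>W. x \<noteq> 0 \<longrightarrow> B t x x > 0) F"
proof -
  obtain P N where PN: "finite P" "finite N" "P \<subseteq> W" "N \<subseteq> W"
    "\<And>p. p \<in> P \<Longrightarrow> B0 p p = 1" "\<And>p. p \<in> N \<Longrightarrow> B0 p p = - 1"
    "\<And>p q. p \<in> P \<union> N \<Longrightarrow> q \<in> P \<union> N \<Longrightarrow> p \<noteq> q \<Longrightarrow> B0 p q = 0"
    "independent P" "independent N"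
    "dim W \<le> card P + card N + dim (form_kernel B0 W)"
    using sylvester[OF bil(1) sym W] by blast
  have "N = {}"
  proof (rule ccontr)
    assume "N \<noteq> {}"
    then obtain p where p: "p \<in> N" by blast
    then have "p \<noteq> 0" using PN(9) dependent_zero by blast
    moreover have "p \<in> W" using p PN(4) by blast
    ultimately show False using pos[of p] PN(6)[OF p] by simp
  qed
  have "form_kernel B0 W \<subseteq> {0}"
  proof
    fix x assume "x \<in> form_kernel B0 W"
    then have "x \<in> W" "B0 x x = 0" by (auto simp: form_kernel_def)
    with pos[of x] show "x \<in> {0}" by fastforce
  qed
  then have "dim (form_kernel B0 W) = 0"
    using dim_le_card[of "form_kernel B0 W" "{}"] by simp
  with PN(10) \<open>N = {}\<close> have cP: "dim W \<le> card P" by simp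
  have WP: "W \<subseteq> span P"
  proof
    fix x assume x: "x \<in> W"
    show "x \<in> span P"
    proof (rule ccontr)
      assume nx: "x \<notin> span P"
      then have "independent (insert x P)" using PN(8) by (rule independent_insertI)
      then have "card (insert x P) \<le> dim W"
        using independent_fin_dim(2)[OF W(2)] x PN(3) by blast
      moreover have "x \<notin> P" using nx span_base by blast
      ultimately show False using cP PN(1) by simp
    qed
  qed
  have "eventually (\<lambda>t. \<forall>p\<in>P. \<forall>q\<in>P. \<bar>B t p q - (if p = q then 1 else 0)\<bar> * real (card P) < 1) F"
  proof (intro eventually_ball_finite PN(1) ballI)
    fix p q assume pq: "p \<in> P" "q \<in> P"
    have B0: "B0 p q = (if p = q then 1 else 0)" using PN pq by auto
    have "((\<lambda>t. \<bar>B t p q - (if p = q then 1 else 0)\<bar> * real (card P)) \<longlongrightarrow>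
        \<bar>B0 p q - (if p = q then 1 else 0)\<bar> * real (card P)) F"
      by (rule tendsto_mult[OF tendsto_rabs[OF tendsto_diff[OF lim tendsto_const]] tendsto_const])
        (use pq PN(3) in blast)+
    then show "eventually (\<lambda>t. \<bar>B t p q - (if p = q then 1 else 0)\<bar> * real (card P) < 1) F"
      unfolding B0 by (rule order_tendstoD) simp
  qed
  then show ?thesis
  proof eventually_elim
    case (elim t)
    show ?case
    proof (intro ballI impI)
      fix x assume "x \<in> W" "x \<noteq> 0"
      then show "B t x x > 0"
        using positive_on_ortho_span[OF bil(2)[of t] PN(1), of x] elim WP by blast
    qed
  qed
qed

section \<open>Spectral flow of a decreasing family of forms\<close>

lemma bilinear_uminus:
  "bilinear B \<Longrightarrow> bilinear (\<lambda>x y. - B x y)"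
  for B :: "'a::real_vector \<Rightarrow> 'b::real_vector \<Rightarrow> real"
  unfolding bilinear_def by (auto intro: linear_compose_neg)

text \<open>
  Let \<open>Fc t\<close> be the sum of the dimensions of the kernels up to \<open>t\<close>. The claim propagated from \<open>0\<close> to
  \<open>K\<close> is that the form at \<open>t\<close> is positive definite on some space of codimension at most \<open>Fc t\<close>. It
  survives small increases of \<open>t\<close> by openness. For a step to \<open>s\<close> from the left, take an inertia basis at \<open>s\<close>:
  its negative part is still negative a little earlier, so it meets a positive space there only in \<open>0\<close>
  and has at most \<open>Fc t\<close> elements for some \<open>t < s\<close>; the null part accounts for the kernel at \<open>s\<close>. At \<open>K\<close>
  the positive space and \<open>W\<close> meet only in \<open>0\<close>.

  Finiteness: nonzero kernel vectors for different \<open>t\<close> are linearly independent, as the form at a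
  later \<open>t\<close> is negative on the span of the earlier ones.
\<close>

lemma spectral_flow:
  fixes B :: "real \<Rightarrow> 'a::real_vector \<Rightarrow> 'a \<Rightarrow> real"
  assumes V: "subspace V" "fin_dim V" and K: "0 \<le> K"
    and bil: "\<And>t. bilinear (B t)" and sym: "\<And>t x y. B t x y = B t y x"
    and cont: "\<And>x y. x \<in> V \<Longrightarrow> y \<in> V \<Longrightarrow> continuous_on {0..K} (\<lambda>t. B t x y)"
    and dec: "\<And>x s t. x \<in> V \<Longrightarrow> x \<noteq> 0 \<Longrightarrow> 0 \<le> s \<Longrightarrow> s < t \<Longrightarrow> t \<le> K \<Longrightarrow> B t x x < B s x x"
    and nonneg: "\<And>x. x \<in> V \<Longrightarrow> 0 \<le> B 0 x x"
    and W: "subspace W" "W \<subseteq> V" "\<And>x. x \<in> W \<Longrightarrow> B K x x \<le> 0"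
  shows "finite {t \<in> {0..K}. form_kernel (B t) V \<noteq> {0}}"
    and "dim W \<le> (\<Sum>t | t \<in> {0..K} \<and> form_kernel (B t) V \<noteq> {0}. dim (form_kernel (B t) V))"
proof -
  define M where "M = {t \<in> {0..K}. form_kernel (B t) V \<noteq> {0}}"
  have zker: "0 \<in> form_kernel (B t) V" for t
    using bilinear_lzero[OF bil] subspace_0[OF V(1)] by (auto simp: form_kernel_def)
  have le: "B t x x \<le> B s x x" if "x \<in> V" "0 \<le> s" "s \<le> t" "t \<le> K" for x s t
    using dec[of x s t] that bilinear_lzero[OF bil] by (cases "x = 0"; cases "s = t") fastforce+
  have spanV: "span S \<subseteq> V" if "S \<subseteq> V" for S
    using that V(1) by (rule span_minimal)
  \<comment> \<open>Kernel vectors, one for each element of \<open>F\<close>: the form at any later \<open>t\<close> is nonpositive on their span.\<close>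
  have ex: "F \<subseteq> M \<longrightarrow> (\<exists>S. finite S \<and> S \<subseteq> V \<and> independent S \<and> card S = card F \<and>
      (\<forall>t\<in>{0..K}. (\<forall>s\<in>F. s \<le> t) \<longrightarrow> (\<forall>x\<in>span S. B t x x \<le> 0)))" if "finite F" for F
    using that
  proof (induction F rule: finite_linorder_max_induct)
    case empty
    show ?case using bilinear_lzero[OF bil] independent_empty
      by (intro impI exI[of _ "{}"]) auto
  next
    case (insert b F)
    show ?case
    proof
      assume FM: "insert b F \<subseteq> M"
      then obtain S where S: "finite S" "S \<subseteq> V" "independent S" "card S = card F"
        and neg: "\<And>t x. t \<in> {0..K} \<Longrightarrow> (\<forall>s\<in>F. s \<le> t) \<Longrightarrow> x \<in> span S \<Longrightarrow> B t x x \<le> 0"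
        using insert.IH by auto
      have b: "b \<in> {0..K}" using FM by (auto simp: M_def)
      obtain z where z: "z \<in> form_kernel (B b) V" "z \<noteq> 0"
        using FM zker[of b] by (auto simp: M_def)
      have zV: "z \<in> V" and z0: "\<And>y. y \<in> V \<Longrightarrow> B b z y = 0" "\<And>y. y \<in> V \<Longrightarrow> B b y z = 0"
        using z sym[of b] by (auto simp: form_kernel_def)
      have strict: "B b y y < 0" if y: "y \<in> span S" "y \<noteq> 0" for y
      proof -
        have "F \<noteq> {}"
        proof
          assume "F = {}"
          then have "S = {}" using S(1,4) by simp
          then show False using y by simp
        qed
        then have m: "Max F \<in> F" using insert.hyps(1) by simp
        then have "Max F \<in> {0..K}" "Max F < b" using FM insert.hyps(2) by (auto simp: M_def)
        moreover have "B (Max F) y y \<le> 0"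
          using neg[of "Max F" y] y(1) calculation(1) insert.hyps(1) by simp
        moreover have "B b y y < B (Max F) y y"
          using dec[of y "Max F" b] y spanV[OF S(2)] calculation(1,2) b by auto
        ultimately show ?thesis by linarith
      qed
      have nz: "z \<notin> span S" using strict[of z] z0(1)[OF zV] z(2) by auto
      have negb: "B t x x \<le> 0" if t: "t \<in> {0..K}" "\<forall>s\<in>insert b F. s \<le> t" and x: "x \<in> span (insert z S)" for t x
      proof -
        obtain k where k: "x - k *\<^sub>R z \<in> span S" using x by (auto simp: span_insert)
        define y where "y = x - k *\<^sub>R z"
        have xy: "x = y + k *\<^sub>R z" by (simp add: y_def)
        have yV: "y \<in> V" using k spanV[OF S(2)] by (auto simp: y_def)
        have xV: "x \<in> V" using yV zV V(1) by (simp add: xy subspace_add subspace_scale)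
        have "B b x x = B b y y"
          unfolding xy bilinear_ladd[OF bil] bilinear_radd[OF bil] bilinear_lmul[OF bil] bilinear_rmul[OF bil]
          using z0[OF yV] z0[OF zV] by simp
        also have "\<dots> \<le> 0" using strict[of y] k bilinear_lzero[OF bil]
          by (cases "y = 0") (auto simp: y_def[symmetric])
        finally show ?thesis using le[OF xV, of b t] b t by auto
      qed
      have "z \<notin> S" using nz span_base by blast
      moreover have "b \<notin> F" using insert.hyps(2) by blast
      ultimately have cards: "card (insert z S) = card (insert b F)"
        using S(1,4) insert.hyps(1) by simp
      show "\<exists>S. finite S \<and> S \<subseteq> V \<and> independent S \<and> card S = card (insert b F) \<and>
          (\<forall>t\<in>{0..K}. (\<forall>s\<in>insert b F. s \<le> t) \<longrightarrow> (\<forall>x\<in>span S. B t x x \<le> 0))"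
        using S(1,2) zV independent_insertI[OF nz S(3)] cards negb
        by (intro exI[of _ "insert z S"] conjI ballI impI) (blast | simp)+
    qed
  qed
  have finM: "finite M"
  proof (rule ccontr)
    assume "infinite M"
    then obtain F where "finite F" "card F = Suc (dim V)" "F \<subseteq> M"
      using infinite_arbitrarily_large by blast
    with ex[of F] obtain S where "S \<subseteq> V" "independent S" "card S = Suc (dim V)" by metis
    from independent_fin_dim(2)[OF V(2) this(1,2)] this(3) show False by simp
  qed
  define Fc where "Fc t = (\<Sum>s\<in>{s\<in>M. s \<le> t}. dim (form_kernel (B s) V))" for t
  have Fc_mono: "Fc s \<le> Fc t" if "s \<le> t" for s t
    unfolding Fc_def using finM that by (intro sum_mono2) auto
  have Fc_jump: "Fc t + dim (form_kernel (B s) V) \<le> Fc s" if "t < s" "s \<in> {0..K}" for s t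
  proof (cases "s \<in> M")
    case True
    have "Fc t + dim (form_kernel (B s) V) = (\<Sum>r\<in>insert s {r\<in>M. r \<le> t}. dim (form_kernel (B r) V))"
      unfolding Fc_def using finM that by (subst sum.insert) auto
    also have "\<dots> \<le> Fc s" unfolding Fc_def using finM that True by (intro sum_mono2) auto
    finally show ?thesis .
  next
    case False
    then have "dim (form_kernel (B s) V) = 0" using that dim_le_card[of "{0}" "{}"] by (auto simp: M_def)
    then show ?thesis using Fc_mono[of t s] that by simp
  qed
  have Fc_0: "dim (form_kernel (B 0) V) \<le> Fc 0"
    using Fc_jump[of "-1" 0] K by (simp add: Fc_def)
  \<comment> \<open>Codimension at most \<open>Fc t\<close>, stated as a lower bound on the number of basis vectors.\<close>
  define claim where "claim t \<longleftrightarrow> (\<exists>S. S \<subseteq> V \<and> independent S \<and> dim V \<le> card S + Fc t \<and>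
     (\<forall>x\<in>span S. x \<noteq> 0 \<longrightarrow> B t x x > 0))" for t
  have tend: "((\<lambda>t. B t x y) \<longlongrightarrow> B s x y) (at s within T)"
    if "x \<in> V" "y \<in> V" "s \<in> {0..K}" "T \<subseteq> {0..K}" for x y s T
    using cont[OF that(1,2)] that(3,4) unfolding continuous_on_def by (blast intro: tendsto_within_subset)
  have step: "claim s" if s: "s \<in> {0..K}" and prev: "\<And>t. 0 \<le> t \<Longrightarrow> t < s \<Longrightarrow> claim t" for s
  proof -
    obtain P N where PN: "finite P" "finite N" "P \<subseteq> V" "N \<subseteq> V"
      "\<And>p. p \<in> P \<Longrightarrow> B s p p = 1" "\<And>p. p \<in> N \<Longrightarrow> B s p p = - 1"
      "\<And>p q. p \<in> P \<union> N \<Longrightarrow> q \<in> P \<union> N \<Longrightarrow> p \<noteq> q \<Longrightarrow> B s p q = 0"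
      "independent P" "independent N"
      "dim V \<le> card P + card N + dim (form_kernel (B s) V)"
      using sylvester[OF bil sym V] by blast
    have posP: "B s x x > 0" if "x \<in> span P" "x \<noteq> 0" for x
      using PN(5,7) by (intro positive_on_ortho_span[OF bil PN(1) _ that]) auto
    have posN: "- B s x x > 0" if "x \<in> span N" "x \<noteq> 0" for x
      using PN(6,7) by (intro positive_on_ortho_span[OF bilinear_uminus[OF bil] PN(2) _ that]) auto
    \<comment> \<open>The negative part persists a little to the left of \<open>s\<close>, where the claim bounds its size.\<close>
    have "card N + dim (form_kernel (B s) V) \<le> Fc s"
    proof (cases "s = 0")
      case True
      have "N = {}" using PN(4,6) nonneg unfolding True by force
      then show ?thesis using Fc_0 True by simp
    next
      case False
      then have s0: "s > 0" using s by simp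
      have "eventually (\<lambda>t. \<forall>x\<in>span N. x \<noteq> 0 \<longrightarrow> - B t x x > 0) (at s within {0..<s})"
      proof (rule positive_definite_eventually[where ?B0.0 = "\<lambda>x y. - B s x y" and B = "\<lambda>t x y. - B t x y"])
        show "((\<lambda>t. - B t x y) \<longlongrightarrow> - B s x y) (at s within {0..<s})"
          if "x \<in> span N" "y \<in> span N" for x y
          using that spanV[OF PN(4)] s by (intro tendsto_minus tend) auto
        show "- B s x y = - B s y x" for x y using sym[of s x y] by simp
      qed (use posN PN(2) in \<open>auto intro: fin_dim_span_finite bilinear_uminus[OF bil]\<close>)
      then have "eventually (\<lambda>t. t \<in> {0..<s} \<and> (\<forall>x\<in>span N. x \<noteq> 0 \<longrightarrow> - B t x x > 0)) (at s within {0..<s})"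
        unfolding eventually_at_filter by eventually_elim auto
      moreover have "at s within {0..<s} \<noteq> bot"
        using s0 unfolding at_within_eq_bot_iff by (simp add: closure_atLeastLessThan)
      ultimately have "\<exists>t. t \<in> {0..<s} \<and> (\<forall>x\<in>span N. x \<noteq> 0 \<longrightarrow> - B t x x > 0)"
        using eventually_happens' by blast
      then obtain t where t: "0 \<le> t" "t < s" "\<And>x. x\<in>span N \<Longrightarrow> x \<noteq> 0 \<Longrightarrow> B t x x < 0"
        by auto
      obtain S where S: "S \<subseteq> V" "independent S" "dim V \<le> card S + Fc t"
          "\<forall>x\<in>span S. x \<noteq> 0 \<longrightarrow> B t x x > 0"
        using prev[OF t(1,2)] by (auto simp: claim_def)
      have "card S + card N \<le> dim V"
      proof (rule card_add_le_dim[OF V(2,1) S(1) PN(4) S(2) PN(9)])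
        show "x = 0" if "x \<in> span S" "x \<in> span N" for x
          using S(4) t(3)[of x] that by (meson less_asym)
      qed
      then show ?thesis using S(3) Fc_jump[OF t(2) s] by linarith
    qed
    then show ?thesis unfolding claim_def using PN posP by (intro exI[of _ P]) auto
  qed
  have right: "\<exists>d>0. \<forall>t. s < t \<and> t < s + d \<and> t \<le> K \<longrightarrow> claim t" if s: "0 \<le> s" "s < K" "claim s" for s
  proof -
    obtain S where S: "S \<subseteq> V" "independent S" "dim V \<le> card S + Fc s"
          "\<forall>x\<in>span S. x \<noteq> 0 \<longrightarrow> B s x x > 0"
      using s by (auto simp: claim_def)
    have "eventually (\<lambda>t. \<forall>x\<in>span S. x \<noteq> 0 \<longrightarrow> B t x x > 0) (at s within {s..K})"
    proof (rule positive_definite_eventually[where ?B0.0 = "B s" and B = B])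
      show "((\<lambda>t. B t x y) \<longlongrightarrow> B s x y) (at s within {s..K})"
        if "x \<in> span S" "y \<in> span S" for x y
        using that spanV[OF S(1)] s by (intro tend) auto
    qed (use S sym bil independent_fin_dim[OF V(2) S(1,2)] in \<open>auto intro: fin_dim_span_finite\<close>)
    then obtain d where "d > 0" and d: "\<forall>t\<in>{s..K}. t \<noteq> s \<and> dist t s < d \<longrightarrow>
        (\<forall>x\<in>span S. x \<noteq> 0 \<longrightarrow> B t x x > 0)"
      unfolding eventually_at by (elim exE conjE)
    have "claim t" if "s < t" "t < s + d" "t \<le> K" for t
    proof -
      have "\<forall>x\<in>span S. x \<noteq> 0 \<longrightarrow> B t x x > 0"
        using d[rule_format, of t] that s by (simp add: dist_real_def)
      moreover have "dim V \<le> card S + Fc t" using S(3) Fc_mono[of s t] that by simp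
      ultimately show ?thesis unfolding claim_def using S(1,2) by blast
    qed
    with \<open>d > 0\<close> show ?thesis by blast
  qed
  have "claim K"
  proof (rule ccontr)
    assume nK: "\<not> claim K"
    define A where "A = {t \<in> {0..K}. \<not> claim t}"
    have A: "A \<noteq> {}" "bdd_below A" using nK K by (auto simp: A_def intro!: bdd_belowI[of _ 0])
    define s where "s = Inf A"
    have s: "0 \<le> s" "s \<le> K" unfolding s_def
      using A nK K by (auto simp: A_def intro!: cInf_greatest cInf_lower)
    have "claim t" if "0 \<le> t" "t < s" for t
      using cInf_lower[OF _ A(2), of t] that s by (force simp: A_def s_def)
    then have cs: "claim s" using step[of s] s by simp
    then have "s < K" using nK s by (cases "s = K") auto
    from right[OF s(1) this cs] obtain d where d: "d > 0" "\<And>t. s < t \<Longrightarrow> t < s + d \<Longrightarrow> t \<le> K \<Longrightarrow> claim t"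
      by blast
    have "s + d \<le> Inf A"
    proof (rule cInf_greatest[OF A(1)])
      fix a assume a: "a \<in> A"
      then have "s \<le> a" using A(2) by (auto simp: s_def intro: cInf_lower)
      moreover have "a \<noteq> s" using a cs by (auto simp: A_def)
      ultimately show "s + d \<le> a" using d(2)[of a] a by (force simp: A_def)
    qed
    with d(1) show False by (simp add: s_def)
  qed
  then obtain S where S: "S \<subseteq> V" "independent S" "dim V \<le> card S + Fc K"
      "\<forall>x\<in>span S. x \<noteq> 0 \<longrightarrow> B K x x > 0"
    by (auto simp: claim_def)
  obtain BW where BW: "finite BW" "BW \<subseteq> W" "independent BW" "W \<subseteq> span BW" "card BW = dim W"
    by (rule fin_dim_basis[OF fin_dim_mono[OF V(2) W(2)]])
  have "span BW \<subseteq> W" using BW(2) W(1) by (rule span_minimal)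
  then have "card S + card BW \<le> dim V"
  proof (intro card_add_le_dim[OF V(2,1) S(1) _ S(2) BW(3)])
    show "x = 0" if "x \<in> span S" "x \<in> span BW" for x
      using S(4) W(3)[of x] that \<open>span BW \<subseteq> W\<close> by (meson not_less subsetD)
  qed (use BW(2) W(2) in blast)
  then have "dim W \<le> Fc K" using S(3) BW(5) by simp
  moreover have "{s \<in> M. s \<le> K} = M" by (auto simp: M_def)
  ultimately show "dim W \<le> (\<Sum>t | t \<in> {0..K} \<and> form_kernel (B t) V \<noteq> {0}. dim (form_kernel (B t) V))"
    by (simp add: Fc_def M_def)
  show "finite {t \<in> {0..K}. form_kernel (B t) V \<noteq> {0}}" using finM by (simp add: M_def)
qed

section \<open>Angles and the elimination of one end of a link\<close>

lemma cot_diff_strict: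
  assumes "0 < x" "x < y" "y < pi"
  shows "cot y < cot x"
proof -
  have s: "sin x > 0" "sin y > 0" "sin (y - x) > 0" using assms by (auto intro: sin_gt_zero)
  have "cot x - cot y = sin (y - x) / (sin x * sin y)"
    using s by (simp add: cot_def sin_diff field_simps)
  also have "\<dots> > 0" using s by simp
  finally show ?thesis by simp
qed

lemma cot_add_nonneg:
  assumes "0 < x" "0 < y" "x + y \<le> pi"
  shows "0 \<le> cot x + cot y"
proof -
  have s: "sin x > 0" "sin y > 0" "sin (x + y) \<ge> 0" using assms by (auto intro: sin_gt_zero sin_ge_zero)
  have "cot x + cot y = sin (x + y) / (sin x * sin y)"
    using s by (simp add: cot_def sin_add field_simps)
  also have "\<dots> \<ge> 0" using s by simp
  finally show ?thesis .
qed

lemma cot_surj: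
  obtains \<phi> where "0 < \<phi>" "\<phi> < pi" "cot \<phi> = y"
proof (rule that)
  show "0 < pi / 2 - arctan y" "pi / 2 - arctan y < pi"
    using arctan_ubound[of y] arctan_lbound[of y] by simp_all
  show "cot (pi / 2 - arctan y) = y"
    using tan_cot[of "arctan y"] tan_arctan[of y] by (simp add: cot_def tan_def sin_diff cos_diff)
qed

text \<open>
  If \<open>a + b < \<pi>\<close>, then \<open>cot a + cot b - cot (a + b)\<close> is a sum of squares over a positive number.
\<close>

lemma merge_two:
  assumes "0 < a" "a < pi" "0 < b" "b < pi"
  obtains \<phi> where "0 < \<phi>" "\<phi> < pi" "\<phi> \<le> a + b" "cot \<phi> = cot a + cot b"
proof -
  obtain \<phi> where \<phi>: "0 < \<phi>" "\<phi> < pi" "cot \<phi> = cot a + cot b" by (rule cot_surj)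
  have "\<phi> \<le> a + b"
  proof (cases "a + b < pi")
    case True
    have s: "sin a > 0" "sin b > 0" "sin (a + b) > 0" using assms True by (auto intro: sin_gt_zero)
    have "cot a + cot b - cot (a + b) = ((sin (a + b))\<^sup>2 - cos (a + b) * (sin a * sin b)) / (sin a * sin b * sin (a + b))"
    proof -
      have "cot a + cot b = sin (a + b) / (sin a * sin b)"
        using s by (simp add: cot_def sin_add field_simps)
      then show ?thesis using s by (simp add: cot_def power2_eq_square field_simps)
    qed
    also have "(sin (a + b))\<^sup>2 - cos (a + b) * (sin a * sin b) =
        (sin a * cos b)\<^sup>2 + (cos a * sin b)\<^sup>2 + (sin a * sin b) * (cos a * cos b) + (sin a * sin b)\<^sup>2"
      by (simp add: sin_add cos_add power2_eq_square algebra_simps)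
    also have "\<dots> = ((sin a * cos b + cos a * sin b)\<^sup>2 + (sin a * cos b)\<^sup>2 + (cos a * sin b)\<^sup>2) / 2 + (sin a * sin b)\<^sup>2"
      by (simp add: power2_eq_square algebra_simps)
    also have "\<dots> / (sin a * sin b * sin (a + b)) > 0"
      using s by (intro divide_pos_pos add_nonneg_pos) auto
    finally have "cot (a + b) < cot \<phi>" using \<phi>(3) by simp
    then show ?thesis using cot_diff_strict[of "a + b" \<phi>] \<phi> assms by (cases "\<phi> \<le> a + b") auto
  qed (use \<phi> in simp)
  with \<phi> that show ?thesis by blast
qed

text \<open>
  A list of angles at a node stands for several boundary conditions that act on the same value
  together. The angle \<open>\<pi>\<close> is the Dirichlet condition, for which the derivative is arbitrary.
\<close>

definition valid_angles :: "real list \<Rightarrow> bool" where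
  "valid_angles fs \<longleftrightarrow> (\<forall>\<phi>\<in>set fs. 0 < \<phi> \<and> \<phi> \<le> pi)"

text \<open>
  The angle \<open>\<pi>\<close> contributes nothing, as \<open>cot pi = 0\<close> by division by zero. It
  always comes with the requirement that the value at the node vanishes.
\<close>

definition cot_sum :: "real list \<Rightarrow> real" where
  "cot_sum fs = sum_list (map cot fs)"

lemma valid_angles_sum_nonneg: "valid_angles fs \<Longrightarrow> 0 \<le> sum_list fs"
  unfolding valid_angles_def by (intro sum_list_nonneg) auto

lemma merge_angles_open:
  assumes "fs \<noteq> []" "valid_angles fs" "pi \<notin> set fs"
  shows "\<exists>\<phi>. 0 < \<phi> \<and> \<phi> < pi \<and> \<phi> \<le> sum_list fs \<and> cot \<phi> = cot_sum fs"
  using assms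
proof (induction fs rule: list_nonempty_induct)
  case (single x)
  then show ?case by (intro exI[of _ x]) (auto simp: valid_angles_def cot_sum_def)
next
  case (cons x xs)
  then obtain \<phi> where \<phi>: "0 < \<phi>" "\<phi> < pi" "\<phi> \<le> sum_list xs" "cot \<phi> = cot_sum xs"
    by (auto simp: valid_angles_def)
  have x: "0 < x" "x < pi" using cons.prems by (auto simp: valid_angles_def less_le)
  obtain \<psi> where "0 < \<psi>" "\<psi> < pi" "\<psi> \<le> x + \<phi>" "cot \<psi> = cot x + cot \<phi>"
    by (rule merge_two[OF x \<phi>(1,2)])
  with \<phi> show ?case by (intro exI[of _ \<psi>]) (auto simp: cot_sum_def)
qed

lemma merge_angles:
  assumes "fs \<noteq> []" "valid_angles fs"
  obtains \<phi> where "0 < \<phi>" "\<phi> \<le> pi" "\<phi> \<le> sum_list fs"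
    "pi \<in> set fs \<longrightarrow> \<phi> = pi" "pi \<notin> set fs \<longrightarrow> \<phi> < pi \<and> cot \<phi> = cot_sum fs"
proof (cases "pi \<in> set fs")
  case True
  then have "pi \<le> sum_list fs"
    using assms(2) by (intro member_le_sum_list) (auto simp: valid_angles_def)
  with True that[of pi] show ?thesis by auto
next
  case False
  obtain \<phi> where "0 < \<phi>" "\<phi> < pi" "\<phi> \<le> sum_list fs" "cot \<phi> = cot_sum fs"
    using merge_angles_open[OF assms False] by blast
  with that[of \<phi>] False show ?thesis by simp
qed

text \<open>
  With at least two angles and a sum below \<open>\<pi>\<close>, a single node is itself a nonpositive
  direction. This is the end of the elimination; one angle alone would have to be at most \<open>\<pi>/2\<close>.
\<close>

lemma cot_sum_nonneg:
  assumes "length fs \<ge> 2" "valid_angles fs" "sum_list fs < pi"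
  shows "pi \<notin> set fs" "0 \<le> cot_sum fs"
proof -
  show pi: "pi \<notin> set fs"
  proof
    assume "pi \<in> set fs"
    then have "pi \<le> sum_list fs"
      using assms(2) by (intro member_le_sum_list) (auto simp: valid_angles_def)
    with assms(3) show False by simp
  qed
  obtain x xs where fs: "fs = x # xs" "xs \<noteq> []"
    using assms(1) by (cases fs; cases "tl fs") auto
  obtain \<phi> where "0 < \<phi>" "\<phi> < pi" "\<phi> \<le> sum_list xs" "cot \<phi> = cot_sum xs"
    using merge_angles_open[of xs] fs assms(2) pi by (auto simp: valid_angles_def)
  moreover have "0 < x" using assms(2) fs by (auto simp: valid_angles_def)
  ultimately show "0 \<le> cot_sum fs"
    using cot_add_nonneg[of x \<phi>] assms(3) fs by (auto simp: cot_sum_def)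
qed

text \<open>
  The minimum of \<open>\<integral> u'\<^sup>2 - K\<^sup>2 \<integral> u\<^sup>2\<close> over a link of length \<open>h\<close> with end values \<open>a\<close>, \<open>b\<close>, divided by
  \<open>K\<close>, where \<open>\<theta> = K h\<close>.
\<close>

definition link_form :: "real \<Rightarrow> real \<Rightarrow> real \<Rightarrow> real" where
  "link_form \<theta> a b = cot \<theta> * (a\<^sup>2 + b\<^sup>2) - 2 * a * b / sin \<theta>"

lemma link_form_commute: "link_form \<theta> a b = link_form \<theta> b a"
  by (simp add: link_form_def algebra_simps)

text \<open>
  As a form in the value \<open>y\<close> at the end with angle \<open>\<phi>\<close>, the left-hand side has the leading coefficient
  \<open>cot \<theta> - cot \<phi>\<close>. If \<open>\<theta> < \<phi>\<close> this is positive, and inserting the minimising value of \<open>y\<close>, a multiple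
  \<open>\<rho> b\<close> of the other value, leaves \<open>- cot (\<phi> - \<theta>) b\<^sup>2\<close>. If \<open>\<phi> < \<theta>\<close> it is negative, and a free
  summand \<open>t\<close> may be added to \<open>\<rho> b\<close>: this is the direction counted by \<open>\<delta> = 1\<close>. If \<open>\<phi> = \<theta>\<close> the form is
  linear in \<open>y\<close>, and \<open>y\<close> is free once \<open>b = 0\<close>, which is the angle \<open>\<psi> = \<pi>\<close>. For \<open>\<phi> = \<pi>\<close>
  the value \<open>y\<close> is \<open>0\<close>. In all cases \<open>\<psi> = \<phi> - \<theta> + \<delta> \<pi>\<close>.
\<close>

lemma eliminate_end:
  assumes \<theta>: "0 < \<theta>" "\<theta> < pi" and \<phi>: "0 < \<phi>" "\<phi> \<le> pi"
  obtains \<psi> \<rho> :: real and \<delta> :: nat where "0 < \<psi>" "\<psi> \<le> pi" "\<delta> \<le> 1" "\<psi> = \<phi> - \<theta> + real \<delta> * pi"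
    "\<forall>b t. (\<psi> = pi \<longrightarrow> b = 0) \<longrightarrow> (\<delta> = 0 \<longrightarrow> t = 0) \<longrightarrow>
       (\<phi> = pi \<longrightarrow> \<rho> * b + t = 0) \<and>
       link_form \<theta> (\<rho> * b + t) b - cot \<phi> * (\<rho> * b + t)\<^sup>2 \<le> - cot \<psi> * b\<^sup>2"
proof -
  have s\<theta>: "sin \<theta> > 0" using \<theta> by (rule sin_gt_zero)
  consider "\<phi> = pi" | "\<phi> = \<theta>" | "\<phi> < pi" "\<phi> \<noteq> \<theta>" using \<phi> by fastforce
  then show ?thesis
  proof cases
    case 1
    show ?thesis
      using \<theta> 1 by (intro that[of "pi - \<theta>" 0 0]) (auto simp: link_form_def cot_def sin_diff cos_diff)
  next
    case 2
    show ?thesis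
      using \<theta> 2 by (intro that[of pi 1 0]) (auto simp: link_form_def)
  next
    case 3
    define A where "A = cot \<theta> - cot \<phi>"
    define \<delta> :: nat where "\<delta> = (if \<theta> < \<phi> then 0 else 1)"
    define \<psi> where "\<psi> = \<phi> - \<theta> + real \<delta> * pi"
    define \<rho> where "\<rho> = 1 / (A * sin \<theta>)"
    have s\<phi>: "sin \<phi> > 0" using \<phi> 3 by (intro sin_gt_zero) auto
    have cs: "cot \<psi> = cot (\<phi> - \<theta>)" by (simp add: \<psi>_def \<delta>_def cot_def sin_add cos_add)
    have sd: "sin (\<phi> - \<theta>) \<noteq> 0"
    proof (cases "\<theta> < \<phi>")
      case True
      then have "0 < sin (\<phi> - \<theta>)" using \<phi> \<theta> by (intro sin_gt_zero) auto
      then show ?thesis by simp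
    next
      case False
      then have "0 < sin (\<theta> - \<phi>)" using \<phi> \<theta> 3 by (intro sin_gt_zero) auto
      then show ?thesis using sin_minus[of "\<phi> - \<theta>"] by simp
    qed
    have A: "A = sin (\<phi> - \<theta>) / (sin \<theta> * sin \<phi>)"
      using s\<theta> s\<phi> by (simp add: A_def cot_def sin_diff field_simps)
    then have A0: "A \<noteq> 0" using sd s\<theta> s\<phi> by simp
    have key: "cot \<theta> - 1 / (A * (sin \<theta>)\<^sup>2) = - cot (\<phi> - \<theta>)"
    proof -
      have "cos \<theta> * sin (\<phi> - \<theta>) - sin \<phi> = - cos (\<phi> - \<theta>) * sin \<theta>"
        using sin_add[of "\<phi> - \<theta>" \<theta>] by simp
      then have "(cos \<theta> * sin (\<phi> - \<theta>) - sin \<phi>) / (sin \<theta> * sin (\<phi> - \<theta>)) = - cot (\<phi> - \<theta>)"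
        unfolding cot_def using s\<theta> sd by simp
      moreover have "cot \<theta> - 1 / (A * (sin \<theta>)\<^sup>2) = (cos \<theta> * sin (\<phi> - \<theta>) - sin \<phi>) / (sin \<theta> * sin (\<phi> - \<theta>))"
        using s\<theta> s\<phi> sd unfolding A by (simp add: cot_def field_simps power2_eq_square)
      ultimately show ?thesis by simp
    qed
    have form: "link_form \<theta> (\<rho> * b + t) b - cot \<phi> * (\<rho> * b + t)\<^sup>2 = - cot \<psi> * b\<^sup>2 + A * t\<^sup>2" for b t
    proof -
      have "link_form \<theta> (\<rho> * b + t) b - cot \<phi> * (\<rho> * b + t)\<^sup>2 =
          A * (\<rho> * b + t)\<^sup>2 - 2 * (\<rho> * b + t) * b / sin \<theta> + cot \<theta> * b\<^sup>2"
        by (simp add: link_form_def A_def algebra_simps)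
      also have "\<dots> = A * t\<^sup>2 + (cot \<theta> - 1 / (A * (sin \<theta>)\<^sup>2)) * b\<^sup>2"
        using A0 s\<theta> by (simp add: \<rho>_def power2_eq_square field_simps)
      finally show ?thesis unfolding key cs by simp
    qed
    have "A < 0" if "\<delta> \<noteq> 0"
    proof -
      have "\<phi> < \<theta>" using that 3 by (auto simp: \<delta>_def split: if_splits)
      then show ?thesis using cot_diff_strict[of \<phi> \<theta>] \<phi> \<theta> by (simp add: A_def)
    qed
    then have "A * t\<^sup>2 \<le> 0" if "\<delta> = 0 \<Longrightarrow> t = 0" for t
      using that by (cases "\<delta> = 0") (auto simp: mult_nonpos_nonneg)
    then show ?thesis
      using that[of \<psi> \<delta> \<rho>] form \<phi> \<theta> 3 by (auto simp: \<psi>_def \<delta>_def)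
  qed
qed

section \<open>Cuts and bridges in multigraphs\<close>

text \<open>
  The degree of a node, both ends of a loop being counted.
\<close>

definition incidences :: "('k \<Rightarrow> 'p) \<Rightarrow> ('k \<Rightarrow> 'p) \<Rightarrow> 'k set \<Rightarrow> 'p \<Rightarrow> nat" where
  "incidences s t A v = card {e \<in> A. s e = v} + card {e \<in> A. t e = v}"

text \<open>
  Connectedness by cuts: every proper nonempty set of nodes is crossed by a link. In this form the
  removal of a leaf or of a link needs no paths.
\<close>

definition linked :: "('k \<Rightarrow> 'p) \<Rightarrow> ('k \<Rightarrow> 'p) \<Rightarrow> 'p set \<Rightarrow> 'k set \<Rightarrow> bool" where
  "linked s t P A \<longleftrightarrow> P \<noteq> {} \<and>
     (\<forall>S. S \<subseteq> P \<longrightarrow> S \<noteq> {} \<longrightarrow> S \<noteq> P \<longrightarrow> (\<exists>e\<in>A. (s e \<in> S) \<noteq> (t e \<in> S)))"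

lemma linked_cut:
  "linked s t P A \<Longrightarrow> S \<subseteq> P \<Longrightarrow> S \<noteq> {} \<Longrightarrow> S \<noteq> P \<Longrightarrow> \<exists>e\<in>A. (s e \<in> S) \<noteq> (t e \<in> S)"
  unfolding linked_def by blast

lemma linked_mono: "linked s t P A \<Longrightarrow> A \<subseteq> A' \<Longrightarrow> linked s t P A'"
  unfolding linked_def by blast

lemma leaf_link:
  assumes "finite A" "incidences s t A a = 1"
  obtains e b where "e \<in> A" "b \<noteq> a" "s e = a \<and> t e = b \<or> s e = b \<and> t e = a"
    "\<And>g. g \<in> A \<Longrightarrow> g \<noteq> e \<Longrightarrow> s g \<noteq> a \<and> t g \<noteq> a"
proof -
  have fin: "finite {e \<in> A. s e = a}" "finite {e \<in> A. t e = a}" using assms(1) by auto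
  consider "card {e \<in> A. s e = a} = 1" "card {e \<in> A. t e = a} = 0"
    | "card {e \<in> A. s e = a} = 0" "card {e \<in> A. t e = a} = 1"
    using assms(2) unfolding incidences_def by linarith
  then show ?thesis
  proof cases
    case 1
    then obtain e where e: "{e \<in> A. s e = a} = {e}" by (auto simp: card_1_singleton_iff)
    moreover have "{e \<in> A. t e = a} = {}" using 1 fin by auto
    ultimately show ?thesis by (intro that[of e "t e"]) auto
  next
    case 2
    then obtain e where e: "{e \<in> A. t e = a} = {e}" by (auto simp: card_1_singleton_iff)
    moreover have "{e \<in> A. s e = a} = {}" using 2 fin by auto
    ultimately show ?thesis by (intro that[of e "s e"]) auto
  qed
qed

lemma linked_remove_leaf:
  assumes L: "linked s t P A" and ab: "a \<in> P" "b \<in> P" "b \<noteq> a"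
    and e: "s e = a \<and> t e = b \<or> s e = b \<and> t e = a"
    and other: "\<And>g. g \<in> A \<Longrightarrow> g \<noteq> e \<Longrightarrow> s g \<noteq> a \<and> t g \<noteq> a"
  shows "linked s t (P - {a}) (A - {e})"
  unfolding linked_def
proof (intro conjI allI impI)
  show "P - {a} \<noteq> {}" using ab by blast
next
  fix S assume S: "S \<subseteq> P - {a}" "S \<noteq> {}" "S \<noteq> P - {a}"
  show "\<exists>e\<in>A - {e}. (s e \<in> S) \<noteq> (t e \<in> S)"
  proof (cases "b \<in> S")
    case True
    have "insert a S \<subseteq> P" "insert a S \<noteq> P" using S ab by blast+
    then obtain g where g: "g \<in> A" "(s g \<in> insert a S) \<noteq> (t g \<in> insert a S)"
      using linked_cut[OF L, of "insert a S"] by blast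
    then have "g \<noteq> e" using e True by auto
    then show ?thesis using g other[OF g(1)] by auto
  next
    case False
    have "S \<subseteq> P" "S \<noteq> P" using S ab by blast+
    then obtain g where g: "g \<in> A" "(s g \<in> S) \<noteq> (t g \<in> S)"
      using linked_cut[OF L] S by blast
    then have "g \<noteq> e" using e False S by auto
    then show ?thesis using g by auto
  qed
qed

lemma linked_add_leaf:
  assumes L: "linked s t P A" and ab: "a \<notin> P" "b \<in> P" and A: "\<And>g. g \<in> A \<Longrightarrow> s g \<in> P \<and> t g \<in> P"
    and e: "s e = a \<and> t e = b \<or> s e = b \<and> t e = a"
  shows "linked s t (insert a P) (insert e A)"
  unfolding linked_def
proof (intro conjI allI impI)
  fix S assume S: "S \<subseteq> insert a P" "S \<noteq> {}" "S \<noteq> insert a P"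
  show "\<exists>e\<in>insert e A. (s e \<in> S) \<noteq> (t e \<in> S)"
  proof (cases "S \<inter> P = {} \<or> S \<inter> P = P")
    case True
    then have "(a \<in> S) \<noteq> (b \<in> S)" using S ab by blast
    then show ?thesis using e by auto
  next
    case False
    then obtain g where "g \<in> A" "(s g \<in> S \<inter> P) \<noteq> (t g \<in> S \<inter> P)"
      using linked_cut[OF L, of "S \<inter> P"] by blast
    then show ?thesis using A by blast
  qed
qed simp

text \<open>
  Grow a connected set of nodes by one crossing link at a time.
\<close>

lemma linked_spanning_tree:
  assumes "finite P" and L: "linked s t P A" and A: "\<And>g. g \<in> A \<Longrightarrow> s g \<in> P \<and> t g \<in> P"
  obtains T where "T \<subseteq> A" "finite T" "linked s t P T" "card T < card P"
proof -
  have "\<exists>S T. S \<subseteq> P \<and> card S = Suc n \<and> T \<subseteq> A \<and> finite T \<and> linked s t S T \<and> card T < Suc n \<and>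
     (\<forall>g\<in>T. s g \<in> S \<and> t g \<in> S)" if "Suc n \<le> card P" for n
    using that
  proof (induction n)
    case 0
    obtain p where "p \<in> P" using L by (auto simp: linked_def)
    then show ?case by (intro exI[of _ "{p}"] exI[of _ "{}"]) (auto simp: linked_def)
  next
    case (Suc n)
    then obtain S T where ST: "S \<subseteq> P" "card S = Suc n" "T \<subseteq> A" "finite T" "linked s t S T" "card T < Suc n"
      "\<And>g. g \<in> T \<Longrightarrow> s g \<in> S \<and> t g \<in> S" by auto
    have "S \<noteq> P" "S \<noteq> {}" using ST Suc.prems by auto
    then obtain e where e: "e \<in> A" "(s e \<in> S) \<noteq> (t e \<in> S)" using linked_cut[OF L ST(1)] by blast
    define a where "a = (if s e \<in> S then t e else s e)"
    define b where "b = (if s e \<in> S then s e else t e)"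
    have ab: "a \<notin> S" "b \<in> S" "s e = a \<and> t e = b \<or> s e = b \<and> t e = a" "a \<in> P"
      using e A[OF e(1)] by (auto simp: a_def b_def)
    have "linked s t (insert a S) (insert e T)"
      using ST(5) ab(1,2) ST(7) ab(3) by (rule linked_add_leaf)
    moreover have "e \<notin> T" using ST(7)[of e] ab(1,3) by auto
    moreover have "finite S" using ST(1) assms(1) finite_subset by blast
    ultimately show ?case using ST ab e(1)
      by (intro exI[of _ "insert a S"] exI[of _ "insert e T"]) auto
  qed
  from this[of "card P - 1"] obtain S T where "S \<subseteq> P" "card S = card P" "T \<subseteq> A" "finite T" "linked s t S T" "card T < card P"
    using L assms(1) by (auto simp: linked_def card_gt_0_iff Suc_pred)
  moreover then have "S = P" using assms(1) card_subset_eq by blast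
  ultimately show ?thesis using that by blast
qed

lemma sum_incidences:
  assumes "finite P" "finite A" and A: "\<And>g. g \<in> A \<Longrightarrow> s g \<in> P \<and> t g \<in> P"
  shows "(\<Sum>v\<in>P. incidences s t A v) = 2 * card A"
proof -
  have "(\<Sum>v\<in>P. card {e \<in> A. f e = v}) = card A" if "\<And>g. g \<in> A \<Longrightarrow> f g \<in> P" for f
    using sum.group[OF assms(2,1), of f "\<lambda>_. 1::nat"] that by (auto simp: image_subset_iff)
  from this[of s] this[of t] A show ?thesis by (simp add: incidences_def sum.distrib)
qed

text \<open>
  If all degrees are at least two, there are at least as many links as nodes, more than a
  spanning tree uses.
\<close>

lemma ex_non_bridge:
  assumes "finite P" "finite A" "linked s t P A" and A: "\<And>g. g \<in> A \<Longrightarrow> s g \<in> P \<and> t g \<in> P"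
    and deg: "\<And>v. v \<in> P \<Longrightarrow> incidences s t A v \<ge> 2"
  obtains e where "e \<in> A" "linked s t P (A - {e})"
proof -
  obtain T where T: "T \<subseteq> A" "finite T" "linked s t P T" "card T < card P"
    using linked_spanning_tree[OF assms(1,3) A] by blast
  have "2 * card P \<le> (\<Sum>v\<in>P. incidences s t A v)"
    using sum_bounded_below[of P 2 "incidences s t A"] deg by (simp add: mult.commute)
  then have "card P \<le> card A" using sum_incidences[OF assms(1,2) A] by simp
  then have "T \<noteq> A" using T by auto
  then obtain e where "e \<in> A" "T \<subseteq> A - {e}" using T by blast
  then show ?thesis using that linked_mono[OF T(3)] by blast
qed

text \<open>
  On a cycle through a node of degree two, both links at the node are traversed. In terms of cuts: if
  \<open>f\<close> is the only link that crosses \<open>S\<close>, then moving \<open>v\<close> to the other side gives a set that \<open>f\<close> does not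
  cross, and the link of \<open>A - {e}\<close> that crosses this set is away from \<open>v\<close>, hence crosses \<open>S\<close> as well.
\<close>

lemma non_bridge_degree_two:
  assumes "finite A" and A: "\<And>g. g \<in> A \<Longrightarrow> s g \<in> P \<and> t g \<in> P" and L: "linked s t P (A - {e})"
    and ef: "e \<in> A" "f \<in> A" "e \<noteq> f" and v: "v \<in> P" "s e = v \<or> t e = v" "s f = v \<or> t f = v"
    and deg: "incidences s t A v \<le> 2"
  shows "linked s t P (A - {f})"
proof -
  define X where "X = {g \<in> A. s g = v}"
  define Y where "Y = {g \<in> A. t g = v}"
  have fin: "finite X" "finite Y" using assms(1) by (auto simp: X_def Y_def)
  have le: "card (X \<union> Y) + card (X \<inter> Y) \<le> 2"
    using deg card_Un_Int[OF fin] by (simp add: incidences_def X_def Y_def)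
  have sub: "{e, f} \<subseteq> X \<union> Y" using ef v by (auto simp: X_def Y_def)
  have "card {e, f} \<le> card (X \<union> Y)" using sub fin by (intro card_mono) auto
  then have "card {e, f} = card (X \<union> Y)" "card (X \<inter> Y) = 0" using le ef(3) by auto
  then have XY: "X \<union> Y = {e, f}" "X \<inter> Y = {}"
    using card_subset_eq[OF _ sub] fin by auto
  then have only: "s g \<noteq> v \<and> t g \<noteq> v" if "g \<in> A" "g \<noteq> e" "g \<noteq> f" for g
    using that by (auto simp: X_def Y_def)
  have simple: "\<not> (s e = v \<and> t e = v)" "\<not> (s f = v \<and> t f = v)"
    using XY(2) ef by (auto simp: X_def Y_def)
  show ?thesis unfolding linked_def
  proof (intro conjI allI impI)
    show "P \<noteq> {}" using v by blast
  next
    fix S assume S: "S \<subseteq> P" "S \<noteq> {}" "S \<noteq> P"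
    obtain g where g: "g \<in> A" "g \<noteq> e" "(s g \<in> S) \<noteq> (t g \<in> S)"
      using linked_cut[OF L S] by blast
    show "\<exists>g\<in>A - {f}. (s g \<in> S) \<noteq> (t g \<in> S)"
    proof (cases "g = f \<and> \<not> ((s e \<in> S) \<noteq> (t e \<in> S))")
      case False
      then show ?thesis using g ef by blast
    next
      case True
      \<comment> \<open>\<open>S\<close> with \<open>v\<close> moved to the other side.\<close>
      define S' where "S' = (if v \<in> S then S - {v} else insert v S)"
      have S': "S' \<subseteq> P" "\<And>w. w \<noteq> v \<Longrightarrow> w \<in> S' \<longleftrightarrow> w \<in> S" "v \<in> S' \<longleftrightarrow> v \<notin> S"
        using S v by (auto simp: S'_def)
      have e': "(s e \<in> S') \<noteq> (t e \<in> S')" using True v simple S' by metis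
      have f': "\<not> ((s f \<in> S') \<noteq> (t f \<in> S'))" using True g v simple S' by metis
      have "S' \<noteq> {}" "S' \<noteq> P" using e' A[OF ef(1)] by auto
      then obtain h where h: "h \<in> A" "h \<noteq> e" "(s h \<in> S') \<noteq> (t h \<in> S')"
        using linked_cut[OF L S'(1)] by blast
      moreover have "h \<noteq> f" using h f' by blast
      ultimately show ?thesis using only[of h] S'(2) by (metis Diff_iff singletonD)
    qed
  qed
qed

text \<open>
  If all nodes on non-bridges had degree two and carried no further condition, then by the preceding
  fact their links would lead only to nodes of the same kind, so that these would be all the nodes. The
  number \<open>n v\<close> stands for the number of angles at \<open>v\<close>.
\<close>

lemma ex_cut_point:
  assumes fin: "finite P" "finite A" and L: "linked s t P A"
    and A: "\<And>g. g \<in> A \<Longrightarrow> s g \<in> P \<and> t g \<in> P"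
    and deg: "\<And>v. v \<in> P \<Longrightarrow> incidences s t A v \<ge> 2"
    and big: "v0 \<in> P" "incidences s t A v0 + n v0 \<ge> 3"
  obtains e v where "e \<in> A" "linked s t P (A - {e})" "s e = v \<or> t e = v"
    "v \<in> P" "incidences s t A v + n v \<ge> 3"
proof -
  define X where "X = {v \<in> P. \<exists>e\<in>A. linked s t P (A - {e}) \<and> (s e = v \<or> t e = v)}"
  have "\<exists>v\<in>X. incidences s t A v + n v \<ge> 3"
  proof (rule ccontr)
    assume "\<not> (\<exists>v\<in>X. incidences s t A v + n v \<ge> 3)"
    then have small: "incidences s t A v + n v < 3" if "v \<in> X" for v using that by force
    obtain e where "e \<in> A" "linked s t P (A - {e})" by (rule ex_non_bridge[OF fin L A deg])
    then have "X \<noteq> {}" using A by (auto simp: X_def)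
    moreover have "X \<noteq> P" using small[of v0] big by auto
    moreover have "X \<subseteq> P" by (auto simp: X_def)
    ultimately obtain f where f: "f \<in> A" "(s f \<in> X) \<noteq> (t f \<in> X)"
      using linked_cut[OF L, of X] by blast
    then obtain v where v: "v \<in> X" "s f = v \<or> t f = v" by blast
    then obtain e where e: "e \<in> A" "linked s t P (A - {e})" "s e = v \<or> t e = v"
      unfolding X_def by blast
    have "linked s t P (A - {f})"
    proof (cases "e = f")
      case False
      then show ?thesis
        using non_bridge_degree_two[OF fin(2) A e(2,1) f(1) False _ e(3) v(2)]
          subsetD[OF \<open>X \<subseteq> P\<close> v(1)] small[OF v(1)] by simp
    qed (use e in simp)
    then have "s f \<in> X" "t f \<in> X" using f(1) A[OF f(1)] unfolding X_def by blast+
    then show False using f by blast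
  qed
  then show ?thesis using that unfolding X_def by blast
qed

section \<open>Nonpositive directions of a network\<close>

definition supported :: "'p set \<Rightarrow> ('p \<Rightarrow> real) set" where
  "supported P = {x. \<forall>v. v \<notin> P \<longrightarrow> x v = 0}"

lemma subspace_supported: "subspace (supported P)"
  by (auto simp: supported_def subspace_def)

lemma fin_dim_supported:
  assumes "finite P"
  shows "fin_dim (supported P)"
proof -
  define b where "b v = (\<lambda>w. if w = v then 1 else 0 :: real)" for v :: 'a
  have "x \<in> span (b ` P)" if x: "x \<in> supported P" for x
  proof -
    have "(\<Sum>v\<in>P. x v *\<^sub>R b v) w = (\<Sum>v\<in>P. if w = v then x v else 0)" for w
      unfolding sum_fun_apply by (intro sum.cong) (auto simp: b_def)
    then have "x = (\<Sum>v\<in>P. x v *\<^sub>R b v)"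
      using x assms by (auto simp: supported_def fun_eq_iff)
    also have "\<dots> \<in> span (b ` P)"
      by (rule span_sum, rule span_scale, rule span_base) simp
    finally show ?thesis .
  qed
  then show ?thesis using assms unfolding fin_dim_def by blast
qed

definition admissible :: "'p set \<Rightarrow> ('p \<Rightarrow> real list) \<Rightarrow> ('p \<Rightarrow> real) set" where
  "admissible P fr = {x \<in> supported P. \<forall>v\<in>P. pi \<in> set (fr v) \<longrightarrow> x v = 0}"

lemma fin_dim_admissible: "finite P \<Longrightarrow> fin_dim (admissible P fr)"
  by (rule fin_dim_mono[OF fin_dim_supported]) (auto simp: admissible_def)

text \<open>
  An angle \<open>\<phi>\<close> at \<open>v\<close> adds the boundary term \<open>- cot \<phi> (x v)\<^sup>2\<close>, whose natural boundary condition is the one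
  that \<open>\<phi>\<close> stands for.
\<close>

definition network_form :: "('k \<Rightarrow> 'p) \<Rightarrow> ('k \<Rightarrow> 'p) \<Rightarrow> ('k \<Rightarrow> real) \<Rightarrow> 'p set \<Rightarrow> 'k set \<Rightarrow>
    ('p \<Rightarrow> real list) \<Rightarrow> ('p \<Rightarrow> real) \<Rightarrow> real" where
  "network_form s t \<theta> P A fr x =
     (\<Sum>e\<in>A. link_form (\<theta> e) (x (s e)) (x (t e))) - (\<Sum>v\<in>P. cot_sum (fr v) * (x v)\<^sup>2)"

lemma network_form_front:
  assumes "finite P" "w \<in> P"
  shows "network_form s t \<theta> P A (fr(w := \<psi> # fr w)) x = network_form s t \<theta> P A fr x - cot \<psi> * (x w)\<^sup>2"
proof -
  have "(\<Sum>v\<in>P. cot_sum ((fr(w := \<psi> # fr w)) v) * (x v)\<^sup>2) =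
      (\<Sum>v\<in>P. cot_sum (fr v) * (x v)\<^sup>2 + (if v = w then cot \<psi> * (x w)\<^sup>2 else 0))"
    by (intro sum.cong) (auto simp: cot_sum_def algebra_simps)
  then show ?thesis using assms by (simp add: network_form_def sum.distrib)
qed

definition index_ge :: "('k \<Rightarrow> 'p) \<Rightarrow> ('k \<Rightarrow> 'p) \<Rightarrow> ('k \<Rightarrow> real) \<Rightarrow> 'p set \<Rightarrow> 'k set \<Rightarrow>
    ('p \<Rightarrow> real list) \<Rightarrow> nat \<Rightarrow> bool" where
  "index_ge s t \<theta> P A fr n \<longleftrightarrow> (\<exists>W. subspace W \<and> W \<subseteq> admissible P fr \<and>
     (\<forall>x\<in>W. network_form s t \<theta> P A fr x \<le> 0) \<and> n \<le> dim W)"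

lemma linear_fun_upd_zero: "linear (\<lambda>x::'p \<Rightarrow> real. x(a := 0))"
  by (rule linearI) (auto simp: fun_eq_iff)

lemma linear_fun_upd_scaled: "linear (\<lambda>x::'p \<Rightarrow> real. x(a := r * x b))"
  by (rule linearI) (auto simp: fun_eq_iff algebra_simps)

text \<open>
  The leaf \<open>a\<close> and its link \<open>e\<close> are replaced by one more angle at the neighbour \<open>b\<close>. A nonpositive space of
  the smaller network is extended to \<open>a\<close> by \<open>x a = \<rho> x b\<close>, or with \<open>x a\<close> free if \<open>\<delta> = 1\<close>.
\<close>

lemma index_leaf:
  assumes fin: "finite P" "finite A" and ab: "a \<in> P" "b \<in> P" "b \<noteq> a"
    and e: "e \<in> A" "s e = a \<and> t e = b \<or> s e = b \<and> t e = a"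
    and other: "\<And>g. g \<in> A \<Longrightarrow> g \<noteq> e \<Longrightarrow> s g \<noteq> a \<and> t g \<noteq> a"
    and \<theta>: "0 < \<theta> e" "\<theta> e < pi" and fr: "fr a \<noteq> []" "valid_angles (fr a)"
  obtains \<psi> \<delta> where "0 < \<psi>" "\<psi> \<le> pi" "\<delta> \<le> 1" "\<psi> \<le> sum_list (fr a) - \<theta> e + real \<delta> * pi"
    "\<forall>n. index_ge s t \<theta> (P - {a}) (A - {e}) (fr(b := \<psi> # fr b)) n \<longrightarrow> index_ge s t \<theta> P A fr (n + \<delta>)"
proof -
  obtain \<phi> where \<phi>: "0 < \<phi>" "\<phi> \<le> pi" "\<phi> \<le> sum_list (fr a)"
    "pi \<in> set (fr a) \<longrightarrow> \<phi> = pi" "pi \<notin> set (fr a) \<longrightarrow> \<phi> < pi \<and> cot \<phi> = cot_sum (fr a)"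
    by (rule merge_angles[OF fr])
  obtain \<psi> \<rho> :: real and \<delta> :: nat where
    \<psi>: "0 < \<psi>" "\<psi> \<le> pi" "\<delta> \<le> 1" "\<psi> = \<phi> - \<theta> e + real \<delta> * pi" and
    key: "\<forall>b t. (\<psi> = pi \<longrightarrow> b = 0) \<longrightarrow> (\<delta> = 0 \<longrightarrow> t = 0) \<longrightarrow>
       (\<phi> = pi \<longrightarrow> \<rho> * b + t = 0) \<and>
       link_form (\<theta> e) (\<rho> * b + t) b - cot \<phi> * (\<rho> * b + t)\<^sup>2 \<le> - cot \<psi> * b\<^sup>2"
    by (rule eliminate_end[OF \<theta> \<phi>(1,2)])
  define fr' where "fr' = fr(b := \<psi> # fr b)"
  have "index_ge s t \<theta> P A fr (n + \<delta>)"
    if idx: "index_ge s t \<theta> (P - {a}) (A - {e}) fr' n" for n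
  proof -
    obtain W' where W': "subspace W'" "W' \<subseteq> admissible (P - {a}) fr'"
      "\<And>x. x \<in> W' \<Longrightarrow> network_form s t \<theta> (P - {a}) (A - {e}) fr' x \<le> 0" "n \<le> dim W'"
      using idx by (auto simp: index_ge_def)
    have W'0: "x a = 0" if "x \<in> W'" for x
      using that W'(2) by (auto simp: admissible_def supported_def)
    have ext: "x \<in> admissible P fr \<and> network_form s t \<theta> P A fr x \<le> 0"
      if x': "x' \<in> W'" and r: "\<delta> = 0 \<Longrightarrow> r = 0" and x: "x = x'(a := \<rho> * x' b + r)" for x x' r
    proof -
      have adm: "x' \<in> admissible (P - {a}) fr'" using W'(2) x' by blast
      have "x' b = 0" if "\<psi> = pi" using adm that ab by (auto simp: admissible_def fr'_def)
      then have k: "\<phi> = pi \<longrightarrow> \<rho> * x' b + r = 0"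
        "link_form (\<theta> e) (\<rho> * x' b + r) (x' b) - cot \<phi> * (\<rho> * x' b + r)\<^sup>2 \<le> - cot \<psi> * (x' b)\<^sup>2"
        using key[rule_format, of "x' b" r] r by auto
      have xb: "x b = x' b" and xa: "x a = \<rho> * x' b + r" using ab by (auto simp: x)
      have "x \<in> admissible P fr"
        unfolding admissible_def supported_def
      proof (intro CollectI conjI allI ballI impI)
        fix v assume "v \<notin> P" then show "x v = 0"
          using adm ab by (auto simp: x admissible_def supported_def)
      next
        fix v assume v: "v \<in> P" "pi \<in> set (fr v)"
        show "x v = 0"
        proof (cases "v = a")
          case True
          then show ?thesis using k(1) \<phi>(4) v xa by simp
        next
          case False
          have "pi \<in> set (fr' v)" using v by (cases "v = b") (simp_all add: fr'_def)
          then show ?thesis using adm v False by (auto simp: x admissible_def)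
        qed
      qed
      moreover have "network_form s t \<theta> P A fr x \<le> 0"
      proof -
        have ca: "cot_sum (fr a) * (x a)\<^sup>2 = cot \<phi> * (x a)\<^sup>2"
          using \<phi>(4,5) k(1) xa by (cases "pi \<in> set (fr a)") auto
        have lf: "link_form (\<theta> e) (x (s e)) (x (t e)) = link_form (\<theta> e) (x a) (x b)"
          using e(2) link_form_commute by auto
        have "(\<Sum>g\<in>A. link_form (\<theta> g) (x (s g)) (x (t g))) =
            link_form (\<theta> e) (x a) (x b) + (\<Sum>g\<in>A - {e}. link_form (\<theta> g) (x (s g)) (x (t g)))"
          unfolding lf[symmetric] using e(1) fin(2) by (rule sum.remove[rotated])
        also have "(\<Sum>g\<in>A - {e}. link_form (\<theta> g) (x (s g)) (x (t g))) =
            (\<Sum>g\<in>A - {e}. link_form (\<theta> g) (x' (s g)) (x' (t g)))"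
          using other by (intro sum.cong) (auto simp: x)
        moreover have "(\<Sum>v\<in>P. cot_sum (fr v) * (x v)\<^sup>2) =
            cot_sum (fr a) * (x a)\<^sup>2 + (\<Sum>v\<in>P - {a}. cot_sum (fr v) * (x v)\<^sup>2)"
          using ab(1) fin(1) by (rule sum.remove[rotated])
        moreover have "(\<Sum>v\<in>P - {a}. cot_sum (fr v) * (x v)\<^sup>2) = (\<Sum>v\<in>P - {a}. cot_sum (fr v) * (x' v)\<^sup>2)"
          by (intro sum.cong) (auto simp: x)
        ultimately have "network_form s t \<theta> P A fr x = link_form (\<theta> e) (x a) (x b) - cot \<phi> * (x a)\<^sup>2 +
            network_form s t \<theta> (P - {a}) (A - {e}) fr x'"
          using ca by (simp add: network_form_def)
        also have "network_form s t \<theta> (P - {a}) (A - {e}) fr x' =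
            network_form s t \<theta> (P - {a}) (A - {e}) fr' x' + cot \<psi> * (x' b)\<^sup>2"
          unfolding fr'_def using fin(1) ab by (subst network_form_front) auto
        finally show ?thesis using W'(3)[OF x'] k(2) unfolding xa xb by simp
      qed
      ultimately show ?thesis by blast
    qed
    have finW': "fin_dim W'" using fin_dim_mono[OF fin_dim_admissible W'(2)] fin(1) by simp
    obtain BW where BW: "finite BW" "BW \<subseteq> W'" "independent BW" "W' \<subseteq> span BW" "card BW = dim W'"
      by (rule fin_dim_basis[OF finW'])
    have spanBW: "span BW \<subseteq> W'" using BW(2) W'(1) by (rule span_minimal)
    show ?thesis
    proof (cases "\<delta> = 0")
      case True
      define f where "f = (\<lambda>x::'a \<Rightarrow> real. x(a := \<rho> * x b))"
      have lin: "linear f" unfolding f_def by (rule linear_fun_upd_scaled)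
      have sub: "f ` W' \<subseteq> admissible P fr" "\<And>x. x \<in> f ` W' \<Longrightarrow> network_form s t \<theta> P A fr x \<le> 0"
        using ext[where r = 0] by (auto simp: f_def)
      have "inj_on f W'"
      proof (rule inj_onI)
        fix x y assume xy: "x \<in> W'" "y \<in> W'" "f x = f y"
        have "x v = y v" for v
          using fun_cong[OF xy(3), of v] W'0[OF xy(1)] W'0[OF xy(2)] by (cases "v = a") (auto simp: f_def)
        then show "x = y" by blast
      qed
      then have inj: "inj_on f (span BW)" using spanBW inj_on_subset by blast
      have ind: "independent (f ` BW)" using lin BW(3) inj by (rule linear_independent_injective_image)
      have "card (f ` BW) = card BW"
        using inj span_superset[of BW] by (intro card_image) (blast intro: inj_on_subset)
      moreover have "card (f ` BW) \<le> dim (f ` W')"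
        using independent_fin_dim(2)[OF fin_dim_mono[OF fin_dim_admissible[OF fin(1)] sub(1)] _ ind] BW(2) by blast
      ultimately have "n + \<delta> \<le> dim (f ` W')" using BW(5) W'(4) True by simp
      moreover have "subspace (f ` W')" using lin W'(1) by (rule linear_subspace_image)
      ultimately show ?thesis unfolding index_ge_def using sub by blast
    next
      case False
      then have \<delta>: "\<delta> = 1" using \<psi>(3) by simp
      define W where "W = (\<lambda>x. x(a := 0)) -` W'"
      have sub: "x \<in> admissible P fr \<and> network_form s t \<theta> P A fr x \<le> 0" if "x \<in> W" for x
        using ext[of "x(a := 0)" "x a - \<rho> * x b" x] that \<delta> ab by (auto simp: W_def)
      have subW: "subspace W" unfolding W_def using linear_fun_upd_zero W'(1) by (rule linear_subspace_vimage)
      define d where "d = (\<lambda>v. if v = a then 1 else 0 :: real)"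
      have "d(a := 0) = 0" by (auto simp: d_def)
      then have dW: "d \<in> W" using subspace_0[OF W'(1)] by (simp add: W_def)
      have "x(a := 0) = x" if "x \<in> W'" for x using W'0[OF that] by auto
      then have "W' \<subseteq> W" by (auto simp: W_def)
      moreover have "d \<notin> span BW" using spanBW W'0[of d] by (auto simp: d_def)
      moreover have "fin_dim W" using sub by (intro fin_dim_mono[OF fin_dim_admissible[OF fin(1)]]) blast
      ultimately have "card (insert d BW) \<le> dim W"
        using independent_fin_dim(2)[of W "insert d BW"] independent_insertI[OF _ BW(3)] dW BW(2) by blast
      moreover have "d \<notin> BW" using \<open>d \<notin> span BW\<close> span_base by blast
      ultimately have "n + \<delta> \<le> dim W" using BW(1,5) W'(4) \<delta> by simp
      then show ?thesis unfolding index_ge_def using sub subW by blast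
    qed
  qed
  then show ?thesis using that[of \<psi> \<delta>] \<psi> \<phi>(3) by (simp add: fr'_def)
qed

lemma dim_hyperplane_ge:
  assumes "subspace W" "fin_dim W" "linear (f :: 'a::real_vector \<Rightarrow> real)"
  shows "dim W \<le> dim {x \<in> W. f x = 0} + 1"
proof (cases "\<forall>x\<in>W. f x = 0")
  case True
  then have "{x \<in> W. f x = 0} = W" by blast
  then show ?thesis by simp
next
  case False
  then obtain z where z: "z \<in> W" "f z \<noteq> 0" by blast
  interpret linear f by fact
  have fd: "fin_dim {x \<in> W. f x = 0}" using assms(2) by (rule fin_dim_mono) auto
  obtain B where B: "finite B" "B \<subseteq> {x \<in> W. f x = 0}" "independent B"
    "{x \<in> W. f x = 0} \<subseteq> span B" "card B = dim {x \<in> W. f x = 0}"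
    by (rule fin_dim_basis[OF fd])
  have "W \<subseteq> span (insert z B)"
  proof
    fix x assume x: "x \<in> W"
    have "x - (f x / f z) *\<^sub>R z \<in> {x \<in> W. f x = 0}"
      using x z assms(1) by (auto simp: diff scale subspace_diff subspace_scale)
    then show "x \<in> span (insert z B)" using B(4) unfolding span_insert by blast
  qed
  then have "dim W \<le> card (insert z B)" using B(1) by (intro dim_le_card) auto
  also have "\<dots> \<le> card B + 1" using B(1) by (simp add: card_insert_if)
  finally show ?thesis using B(5) by simp
qed

text \<open>
  Cutting \<open>e\<close> at \<open>v\<close> leaves a loose end with the Neumann angle \<open>\<pi>/2\<close>, from which \<open>e\<close> is eliminated
  towards \<open>w\<close>. The value at the loose end has to be \<open>x v\<close>. If it is free, that is \<open>\<delta> = 1\<close>, this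
  just uses up the freedom; otherwise it is one linear condition.
\<close>

lemma index_cut:
  assumes fin: "finite P" "finite A" and vw: "v \<in> P" "w \<in> P"
    and e: "e \<in> A" "s e = v \<and> t e = w \<or> s e = w \<and> t e = v"
    and \<theta>: "0 < \<theta> e" "\<theta> e < pi"
  obtains \<psi> \<delta> where "0 < \<psi>" "\<psi> \<le> pi" "\<delta> \<le> 1" "\<psi> = pi / 2 - \<theta> e + real \<delta> * pi"
    "\<forall>n. index_ge s t \<theta> P (A - {e}) (fr(w := \<psi> # fr w)) n \<longrightarrow> index_ge s t \<theta> P A fr (n + \<delta> - 1)"
proof -
  obtain \<psi> \<rho> :: real and \<delta> :: nat where
    \<psi>: "0 < \<psi>" "\<psi> \<le> pi" "\<delta> \<le> 1" "\<psi> = pi / 2 - \<theta> e + real \<delta> * pi" and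
    key: "\<forall>b t. (\<psi> = pi \<longrightarrow> b = 0) \<longrightarrow> (\<delta> = 0 \<longrightarrow> t = 0) \<longrightarrow>
       (pi / 2 = pi \<longrightarrow> \<rho> * b + t = 0) \<and>
       link_form (\<theta> e) (\<rho> * b + t) b - cot (pi / 2) * (\<rho> * b + t)\<^sup>2 \<le> - cot \<psi> * b\<^sup>2"
    by (rule eliminate_end[OF \<theta>, of "pi / 2"]) simp_all
  have cot2: "cot (pi / 2 :: real) = 0" by (simp add: cot_def)
  define fr' where "fr' = fr(w := \<psi> # fr w)"
  have "index_ge s t \<theta> P A fr (n + \<delta> - 1)"
    if idx: "index_ge s t \<theta> P (A - {e}) fr' n" for n
  proof -
    obtain W' where W': "subspace W'" "W' \<subseteq> admissible P fr'"
      "\<And>x. x \<in> W' \<Longrightarrow> network_form s t \<theta> P (A - {e}) fr' x \<le> 0" "n \<le> dim W'"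
      using idx by (auto simp: index_ge_def)
    have "pi \<in> set (fr' u)" if "pi \<in> set (fr u)" for u
      using that by (cases "u = w") (simp_all add: fr'_def)
    then have "admissible P fr' \<subseteq> admissible P fr" unfolding admissible_def by blast
    then have adm: "W' \<subseteq> admissible P fr" using W'(2) by (rule order_trans[rotated])
    have neg: "network_form s t \<theta> P A fr x \<le> 0" if x: "x \<in> W'" and r: "\<delta> = 0 \<Longrightarrow> x v = \<rho> * x w" for x
    proof -
      have "x w = 0" if "\<psi> = pi" using x that W'(2) vw by (auto simp: admissible_def fr'_def)
      then have k: "link_form (\<theta> e) (x v) (x w) \<le> - cot \<psi> * (x w)\<^sup>2"
        using key[rule_format, of "x w" "x v - \<rho> * x w"] r by (simp add: cot2)
      have lf: "link_form (\<theta> e) (x (s e)) (x (t e)) = link_form (\<theta> e) (x v) (x w)"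
        using e(2) link_form_commute by auto
      have "(\<Sum>g\<in>A. link_form (\<theta> g) (x (s g)) (x (t g))) =
          link_form (\<theta> e) (x v) (x w) + (\<Sum>g\<in>A - {e}. link_form (\<theta> g) (x (s g)) (x (t g)))"
        unfolding lf[symmetric] using e(1) fin(2) by (rule sum.remove[rotated])
      then have "network_form s t \<theta> P A fr x = link_form (\<theta> e) (x v) (x w) + network_form s t \<theta> P (A - {e}) fr x"
        by (simp add: network_form_def)
      also have "network_form s t \<theta> P (A - {e}) fr x = network_form s t \<theta> P (A - {e}) fr' x + cot \<psi> * (x w)\<^sup>2"
        unfolding fr'_def by (subst network_form_front[OF fin(1) vw(2)]) simp
      finally show ?thesis using W'(3)[OF x] k by simp
    qed
    show ?thesis
    proof (cases "\<delta> = 0")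
      case True
      define f where "f = (\<lambda>x::'a \<Rightarrow> real. x v - \<rho> * x w)"
      have lin: "linear f" unfolding f_def by (rule linearI) (auto simp: algebra_simps)
      have fd: "fin_dim W'" using fin_dim_mono[OF fin_dim_admissible[OF fin(1)] adm] .
      define W where "W = {x \<in> W'. f x = 0}"
      have "dim W' \<le> dim W + 1" unfolding W_def using W'(1) fd lin by (rule dim_hyperplane_ge)
      moreover have "subspace W"
        using W'(1) lin by (auto simp: W_def subspace_def linear_0 linear_add linear_scale)
      moreover have "W \<subseteq> admissible P fr" using adm by (auto simp: W_def)
      moreover have "network_form s t \<theta> P A fr x \<le> 0" if "x \<in> W" for x
        using neg[of x] that by (auto simp: W_def f_def)
      ultimately show ?thesis unfolding index_ge_def using W'(4) True by (intro exI[of _ W]) auto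
    next
      case False
      then show ?thesis unfolding index_ge_def using W' adm neg \<psi>(3) by (intro exI[of _ W']) auto
    qed
  qed
  then show ?thesis using that[of \<psi> \<delta>] \<psi> by (simp add: fr'_def)
qed

lemma linked_no_links:
  assumes "linked s t P {}"
  obtains v where "P = {v}"
proof -
  obtain v where v: "v \<in> P" using assms by (auto simp: linked_def)
  have "P = {v}"
  proof (rule ccontr)
    assume "P \<noteq> {v}"
    then show False using linked_cut[OF assms, of "{v}"] v by auto
  qed
  then show ?thesis by (rule that)
qed

lemma incidences_remove:
  assumes "finite A" "e \<in> A"
  shows "incidences s t A v = incidences s t (A - {e}) v + (if s e = v then 1 else 0) + (if t e = v then 1 else 0)"
proof -
  have "card {g \<in> A. f g = v} = card {g \<in> A - {e}. f g = v} + (if f e = v then 1 else 0)" for f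
  proof -
    have "{g \<in> A. f g = v} = {g \<in> A - {e}. f g = v} \<union> (if f e = v then {e} else {})"
      using assms(2) by auto
    then have "card {g \<in> A. f g = v} = card ({g \<in> A - {e}. f g = v} \<union> (if f e = v then {e} else {}))"
      by simp
    also have "\<dots> = card {g \<in> A - {e}. f g = v} + card (if f e = v then {e} else {})"
      using assms(1) by (intro card_Un_disjoint) auto
    finally show ?thesis by simp
  qed
  from this[of s] this[of t] show ?thesis by (simp add: incidences_def)
qed

text \<open>
  The condition that degree and number of angles add up to at least two at every node is stable under
  both kinds of elimination, as a cut is made only where the total is at least three. It makes leaves carry an angle, so that they can be removed, and makes the
  single node that remains in the end carry two. The last assumption excludes a cycle without boundary
  conditions, which offers no place for a cut.
\<close>

lemma network_index:
  assumes "finite P" "finite A" "linked s t P A"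
    and "\<And>g. g \<in> A \<Longrightarrow> s g \<in> P \<and> t g \<in> P"
    and "\<And>g. g \<in> A \<Longrightarrow> 0 < \<theta> g \<and> \<theta> g < pi"
    and "\<And>v. v \<in> P \<Longrightarrow> valid_angles (fr v)"
    and "\<And>v. v \<in> P \<Longrightarrow> incidences s t A v + length (fr v) \<ge> 2"
    and "\<exists>v\<in>P. fr v \<noteq> [] \<or> incidences s t A v \<noteq> 2"
  shows "\<exists>n. index_ge s t \<theta> P A fr n \<and>
    (\<Sum>g\<in>A. \<theta> g) - (\<Sum>v\<in>P. sum_list (fr v)) + pi - 3 / 2 * pi * (real (card A) - real (card P) + 1) \<le> real n * pi"
  using assms
proof (induction "card A" arbitrary: P A fr)
  case 0
  then have A: "A = {}" by simp
  then obtain v where P: "P = {v}" using 0 linked_no_links[of s t P] by blast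
  have two: "length (fr v) \<ge> 2" using "0.prems"(7)[of v] by (simp add: A P incidences_def)
  have val: "valid_angles (fr v)" using 0 P by simp
  show ?case
  proof (cases "sum_list (fr v) < pi")
    case False
    have "index_ge s t \<theta> P A fr 0" unfolding index_ge_def
      by (intro exI[of _ "{0}"]) (auto simp: admissible_def supported_def A network_form_def)
    then show ?thesis using False by (intro exI[of _ 0]) (simp add: A P)
  next
    case True
    note cs = cot_sum_nonneg[OF two val True]
    have sub: "supported P \<subseteq> admissible P fr" using cs by (auto simp: admissible_def P)
    have neg: "network_form s t \<theta> P A fr x \<le> 0" for x
      using cs by (simp add: network_form_def A P)
    define d where "d = (\<lambda>w. if w = v then 1 else 0 :: real)"
    have "d \<in> supported P" by (auto simp: d_def supported_def P)
    moreover have "d \<noteq> 0" by (auto simp: d_def fun_eq_iff)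
    ultimately have "card {d} \<le> dim (supported P)"
      using independent_fin_dim(2)[OF fin_dim_supported[OF "0.prems"(1)], of "{d}"] by simp
    then have "index_ge s t \<theta> P A fr 1" unfolding index_ge_def
      using sub neg subspace_supported[of P] by (intro exI[of _ "supported P"]) auto
    moreover have "0 \<le> sum_list (fr v)" using val by (rule valid_angles_sum_nonneg)
    ultimately show ?thesis by (intro exI[of _ 1]) (simp add: A P)
  qed
next
  case (Suc m)
  note fin = Suc.prems(1,2) and L = Suc.prems(3) and ends = Suc.prems(4) and \<theta> = Suc.prems(5)
    and val = Suc.prems(6) and two = Suc.prems(7)
  show ?case
  proof (cases "\<exists>a\<in>P. incidences s t A a = 1")
    case True
    then obtain a where a: "a \<in> P" "incidences s t A a = 1" by blast
    obtain e b where e: "e \<in> A" "b \<noteq> a" "s e = a \<and> t e = b \<or> s e = b \<and> t e = a"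
      and other: "\<And>g. g \<in> A \<Longrightarrow> g \<noteq> e \<Longrightarrow> s g \<noteq> a \<and> t g \<noteq> a"
      using leaf_link[OF fin(2) a(2)] by blast
    have b: "b \<in> P" using ends[OF e(1)] e(3) by auto
    have fa: "fr a \<noteq> []" using two[OF a(1)] a(2) by auto
    have \<theta>e: "0 < \<theta> e" "\<theta> e < pi" using \<theta>[OF e(1)] by auto
    obtain \<psi> \<delta> where \<psi>: "0 < \<psi>" "\<psi> \<le> pi" "\<delta> \<le> 1" "\<psi> \<le> sum_list (fr a) - \<theta> e + real \<delta> * pi" and
      step: "\<forall>n. index_ge s t \<theta> (P - {a}) (A - {e}) (fr(b := \<psi> # fr b)) n \<longrightarrow> index_ge s t \<theta> P A fr (n + \<delta>)"
      by (rule index_leaf[where s = s and t = t and \<theta> = \<theta> and fr = fr, OF fin a(1) b e(2,1,3) other \<theta>e fa val[OF a(1)]])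
    define fr' where "fr' = fr(b := \<psi> # fr b)"
    have inc: "incidences s t A v = incidences s t (A - {e}) v + (if v = b then 1 else 0)" if "v \<noteq> a" for v
      using incidences_remove[OF fin(2) e(1), of s t v] e(2,3) that by auto
    have "\<exists>n. index_ge s t \<theta> (P - {a}) (A - {e}) fr' n \<and>
      (\<Sum>g\<in>A - {e}. \<theta> g) - (\<Sum>v\<in>P - {a}. sum_list (fr' v)) + pi -
        3 / 2 * pi * (real (card (A - {e})) - real (card (P - {a})) + 1) \<le> real n * pi"
    proof (rule Suc.hyps(1))
      show "m = card (A - {e})" using Suc.hyps(2) e(1) fin by simp
      show "linked s t (P - {a}) (A - {e})" by (rule linked_remove_leaf[OF L a(1) b e(2,3) other])
      show "s g \<in> P - {a} \<and> t g \<in> P - {a}" if "g \<in> A - {e}" for g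
        using that ends[of g] other[of g] by auto
      show "valid_angles (fr' v)" if "v \<in> P - {a}" for v
        using that val[of v] \<psi>(1,2) by (auto simp: fr'_def valid_angles_def)
      show "2 \<le> incidences s t (A - {e}) v + length (fr' v)" if "v \<in> P - {a}" for v
        using that two[of v] inc[of v] by (auto simp: fr'_def split: if_splits)
      show "\<exists>v\<in>P - {a}. fr' v \<noteq> [] \<or> incidences s t (A - {e}) v \<noteq> 2"
        using b e(2) by (intro bexI[of _ b]) (auto simp: fr'_def)
    qed (use fin \<theta> in auto)
    then obtain n where n: "index_ge s t \<theta> (P - {a}) (A - {e}) fr' n"
      "(\<Sum>g\<in>A - {e}. \<theta> g) - (\<Sum>v\<in>P - {a}. sum_list (fr' v)) + pi -
        3 / 2 * pi * (real (card (A - {e})) - real (card (P - {a})) + 1) \<le> real n * pi" by blast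
    have c: "real (card (A - {e})) - real (card (P - {a})) = real (card A) - real (card P)"
      using card_Suc_Diff1[OF fin(2) e(1)] card_Suc_Diff1[OF fin(1) a(1)] by linarith
    have "(\<Sum>g\<in>A. \<theta> g) = \<theta> e + (\<Sum>g\<in>A - {e}. \<theta> g)" using fin(2) e(1) by (rule sum.remove)
    moreover have "(\<Sum>v\<in>P. sum_list (fr v)) = sum_list (fr a) + (\<Sum>v\<in>P - {a}. sum_list (fr v))"
      using fin(1) a(1) by (rule sum.remove)
    moreover have "(\<Sum>v\<in>P - {a}. sum_list (fr' v)) = \<psi> + (\<Sum>v\<in>P - {a}. sum_list (fr v))"
    proof -
      have "(\<Sum>v\<in>P - {a}. sum_list (fr' v)) = (\<Sum>v\<in>P - {a}. sum_list (fr v) + (if v = b then \<psi> else 0))"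
        by (intro sum.cong) (auto simp: fr'_def)
      then show ?thesis using fin b e(2) by (simp add: sum.distrib)
    qed
    moreover have "real (n + \<delta>) * pi = real n * pi + real \<delta> * pi" by (simp add: algebra_simps)
    ultimately have "(\<Sum>g\<in>A. \<theta> g) - (\<Sum>v\<in>P. sum_list (fr v)) + pi -
        3 / 2 * pi * (real (card A) - real (card P) + 1) \<le> real (n + \<delta>) * pi"
      using n(2) \<psi>(4) unfolding c by linarith
    then show ?thesis using step n(1) unfolding fr'_def by blast
  next
    case False
    \<comment> \<open>There are no leaves, and an isolated node would be cut off from the links.\<close>
    have deg: "incidences s t A v \<ge> 2" if v: "v \<in> P" for v
    proof -
      have "incidences s t A v \<noteq> 0"
      proof
        assume 0: "incidences s t A v = 0"
        then have no: "s g \<noteq> v \<and> t g \<noteq> v" if "g \<in> A" for g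
          using that fin(2) by (auto simp: incidences_def)
        obtain g where g: "g \<in> A" using Suc.hyps(2) by (metis card.empty equals0I nat.distinct(1))
        show False
        proof (cases "P = {v}")
          case True
          then show False using ends[OF g] no[OF g] by simp
        next
          case False
          then show False using linked_cut[OF L, of "{v}"] v no by auto
        qed
      qed
      with False v show ?thesis by (metis One_nat_def Suc_1 Suc_leI le_neq_implies_less less_one not_less)
    qed
    obtain v0 where v0: "v0 \<in> P" "fr v0 \<noteq> [] \<or> incidences s t A v0 \<noteq> 2" using Suc.prems(8) by blast
    have "incidences s t A v0 + length (fr v0) \<ge> 3"
      using v0(2) deg[OF v0(1)] by (cases "fr v0") auto
    then obtain e v where e: "e \<in> A" "linked s t P (A - {e})" "s e = v \<or> t e = v"
      "v \<in> P" "incidences s t A v + length (fr v) \<ge> 3"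
      using ex_cut_point[where n = "\<lambda>v. length (fr v)", OF fin L ends deg v0(1)] by blast
    define w where "w = (if s e = v then t e else s e)"
    have vw: "s e = v \<and> t e = w \<or> s e = w \<and> t e = v" "w \<in> P"
      using e(3) ends[OF e(1)] by (auto simp: w_def)
    have \<theta>e: "0 < \<theta> e" "\<theta> e < pi" using \<theta>[OF e(1)] by auto
    obtain \<psi> \<delta> where \<psi>: "0 < \<psi>" "\<psi> \<le> pi" "\<delta> \<le> 1" "\<psi> = pi / 2 - \<theta> e + real \<delta> * pi" and
      step: "\<forall>n. index_ge s t \<theta> P (A - {e}) (fr(w := \<psi> # fr w)) n \<longrightarrow> index_ge s t \<theta> P A fr (n + \<delta> - 1)"
      by (rule index_cut[where s = s and t = t and \<theta> = \<theta> and fr = fr, OF fin e(4) vw(2) e(1) vw(1) \<theta>e])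
    define fr' where "fr' = fr(w := \<psi> # fr w)"
    have inc: "incidences s t A u = incidences s t (A - {e}) u + (if u = v then 1 else 0) + (if u = w then 1 else 0)" for u
      using incidences_remove[OF fin(2) e(1), of s t u] vw(1) by auto
    have "\<exists>n. index_ge s t \<theta> P (A - {e}) fr' n \<and>
      (\<Sum>g\<in>A - {e}. \<theta> g) - (\<Sum>v\<in>P. sum_list (fr' v)) + pi -
        3 / 2 * pi * (real (card (A - {e})) - real (card P) + 1) \<le> real n * pi"
    proof (rule Suc.hyps(1))
      show "m = card (A - {e})" using Suc.hyps(2) e(1) fin by simp
      show "linked s t P (A - {e})" by (rule e(2))
      show "valid_angles (fr' v)" if "v \<in> P" for v
        using that val[of v] \<psi>(1,2) by (auto simp: fr'_def valid_angles_def)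
      show "2 \<le> incidences s t (A - {e}) u + length (fr' u)" if "u \<in> P" for u
        using that two[of u] inc[of u] e(5) by (auto simp: fr'_def split: if_splits)
      show "\<exists>v\<in>P. fr' v \<noteq> [] \<or> incidences s t (A - {e}) v \<noteq> 2"
        using vw(2) by (intro bexI[of _ w]) (auto simp: fr'_def)
    qed (use fin \<theta> ends in auto)
    then obtain n where n: "index_ge s t \<theta> P (A - {e}) fr' n"
      "(\<Sum>g\<in>A - {e}. \<theta> g) - (\<Sum>v\<in>P. sum_list (fr' v)) + pi -
        3 / 2 * pi * (real (card (A - {e})) - real (card P) + 1) \<le> real n * pi" by blast
    have c: "real (card (A - {e})) = real (card A) - 1"
      using card_Suc_Diff1[OF fin(2) e(1)] by linarith
    have "(\<Sum>g\<in>A. \<theta> g) = \<theta> e + (\<Sum>g\<in>A - {e}. \<theta> g)" using fin(2) e(1) by (rule sum.remove)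
    moreover have "(\<Sum>v\<in>P. sum_list (fr' v)) = \<psi> + (\<Sum>v\<in>P. sum_list (fr v))"
    proof -
      have "(\<Sum>v\<in>P. sum_list (fr' v)) = (\<Sum>v\<in>P. sum_list (fr v) + (if v = w then \<psi> else 0))"
        by (intro sum.cong) (auto simp: fr'_def)
      then show ?thesis using fin vw(2) by (simp add: sum.distrib)
    qed
    moreover have "3 / 2 * pi * (real (card (A - {e})) - real (card P) + 1) =
        3 / 2 * pi * (real (card A) - real (card P) + 1) - 3 / 2 * pi"
      unfolding c by (simp add: field_simps)
    moreover have "(real n + real \<delta> - 1) * pi = real n * pi + real \<delta> * pi - pi"
      by (simp add: algebra_simps)
    ultimately have "(\<Sum>g\<in>A. \<theta> g) - (\<Sum>v\<in>P. sum_list (fr v)) + pi -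
        3 / 2 * pi * (real (card A) - real (card P) + 1) \<le> (real n + real \<delta> - 1) * pi"
      using n(2) \<psi>(4) by linarith
    also have "\<dots> \<le> real (n + \<delta> - 1) * pi" by (intro mult_right_mono) auto
    finally show ?thesis using step n(1) unfolding fr'_def by blast
  qed
qed

section \<open>The oscillator equation on a link\<close>

definition cosw :: "real \<Rightarrow> real \<Rightarrow> real" where
  "cosw w x = cos (w * x)"

text \<open>
  Together with \<open>cosw w\<close> this is the fundamental system of \<open>u'' = - w\<^sup>2 u\<close>, continuous at \<open>w = 0\<close>.
\<close>

definition sinw :: "real \<Rightarrow> real \<Rightarrow> real" where
  "sinw w x = (if w = 0 then x else sin (w * x) / w)"

lemma w_sinw: "w * sinw w x = sin (w * x)"
  by (simp add: sinw_def)

lemma cosw_0 [simp]: "cosw w 0 = 1" "sinw w 0 = 0"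
  by (simp_all add: cosw_def sinw_def)

lemma sinw_pos: "0 \<le> w \<Longrightarrow> 0 < h \<Longrightarrow> w * h < pi \<Longrightarrow> 0 < sinw w h"
  by (auto simp: sinw_def intro!: divide_pos_pos sin_gt_zero)

lemma cosw_add: "cosw w (x + y) = cosw w x * cosw w y - w\<^sup>2 * sinw w x * sinw w y"
  using cos_add[of "w * x" "w * y"]
  by (simp add: cosw_def w_sinw[symmetric] distrib_left power2_eq_square mult_ac)

lemma sinw_add: "sinw w (x + y) = sinw w x * cosw w y + cosw w x * sinw w y"
  by (simp add: sinw_def cosw_def distrib_left sin_add field_simps)

lemma cosw_minus: "cosw w (- x) = cosw w x" and sinw_minus: "sinw w (- x) = - sinw w x"
  by (simp_all add: sinw_def cosw_def)

lemma cosw_sinw_square: "(cosw w x)\<^sup>2 + w\<^sup>2 * (sinw w x)\<^sup>2 = 1"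
  by (simp add: power_mult_distrib[symmetric] w_sinw) (simp add: cosw_def)

lemma DERIV_cosw [derivative_intros]:
  "(f has_real_derivative d) (at x within X) \<Longrightarrow>
    ((\<lambda>x. cosw w (f x)) has_real_derivative - (w\<^sup>2 * sinw w (f x)) * d) (at x within X)"
  unfolding cosw_def power2_eq_square mult.assoc[of w w] w_sinw
  by (auto intro!: derivative_eq_intros)

lemma DERIV_sinw [derivative_intros]:
  "(f has_real_derivative d) (at x within X) \<Longrightarrow>
    ((\<lambda>x. sinw w (f x)) has_real_derivative cosw w (f x) * d) (at x within X)"
  unfolding cosw_def sinw_def by (cases "w = 0") (auto intro!: derivative_eq_intros)

lemma continuous_sinw_freq: "continuous_on UNIV (\<lambda>w. sinw w h)"
proof -
  have "isCont (\<lambda>w. sinw w h) w" for w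
  proof (cases "w = 0")
    case True
    have "((\<lambda>w. sin (w * h)) has_real_derivative h) (at 0)"
      by (auto intro!: derivative_eq_intros)
    then have "(\<lambda>w. sin (w * h) / w) \<midarrow>0\<rightarrow> h" by (simp add: DERIV_def)
    moreover have "\<forall>\<^sub>F w in at 0. sin (w * h) / w = sinw w h"
      unfolding eventually_at_filter by (auto simp: sinw_def)
    ultimately have "(\<lambda>w. sinw w h) \<midarrow>0\<rightarrow> h" by (rule Lim_transform_eventually)
    then show ?thesis using True by (simp add: isCont_def sinw_def)
  next
    case False
    have "isCont (\<lambda>w. sin (w * h) / w) w" using False by (intro continuous_intros)
    moreover have "\<forall>\<^sub>F w' in nhds w. sin (w' * h) / w' = sinw w' h"
      using t1_space_nhds[OF False] by eventually_elim (auto simp: sinw_def)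
    ultimately show ?thesis by (simp add: isCont_cong)
  qed
  then show ?thesis by (simp add: continuous_on_eq_continuous_at)
qed

text \<open>
  The polar form of the minimum of \<open>\<integral> u'\<^sup>2 - w\<^sup>2 \<integral> u\<^sup>2\<close> over a link of length \<open>h\<close>, that is
  \<open>link_form (w * h)\<close> times \<open>w\<close>, but in a form that makes sense for \<open>w = 0\<close>.
\<close>

definition link_bilin :: "real \<Rightarrow> real \<Rightarrow> real \<Rightarrow> real \<Rightarrow> real \<Rightarrow> real \<Rightarrow> real" where
  "link_bilin w h a b a' b' =
     ((cosw w h * a - b) * a' + (cosw w h * b - a) * b') / sinw w h"

lemma continuous_link_bilin:
  assumes "0 < h" "K * h < pi"
  shows "continuous_on {0..K} (\<lambda>w. link_bilin w h a b a' b')"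
proof -
  have "continuous_on {0..K} (\<lambda>w. sinw w h)"
    using continuous_on_subset[OF continuous_sinw_freq] by blast
  moreover have "sinw w h \<noteq> 0" if "w \<in> {0..K}" for w
  proof -
    have "w * h \<le> K * h" using that assms(1) by simp
    then have "w * h < pi" using assms(2) by (rule le_less_trans)
    then show ?thesis using sinw_pos[of w h] assms that by auto
  qed
  ultimately show ?thesis unfolding link_bilin_def cosw_def by (intro continuous_intros) auto
qed

lemma link_bilin_0_nonneg: "0 < h \<Longrightarrow> 0 \<le> link_bilin 0 h a b a b"
proof -
  assume "0 < h"
  have "link_bilin 0 h a b a b = (a - b)\<^sup>2 / h"
    by (simp add: link_bilin_def cosw_def sinw_def power2_eq_square algebra_simps)
  then show ?thesis using \<open>0 < h\<close> by simp
qed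

lemma link_bilin_eq_link_form:
  assumes "0 < w"
  shows "link_bilin w h a b a b = w * link_form (w * h) a b"
proof -
  have "link_form (w * h) a b = (cos (w * h) * (a\<^sup>2 + b\<^sup>2) - 2 * a * b) / sin (w * h)"
    by (simp add: link_form_def cot_def diff_divide_distrib)
  moreover have "link_bilin w h a b a b = w * ((cos (w * h) * a - b) * a + (cos (w * h) * b - a) * b) / sin (w * h)"
    using assms by (simp add: link_bilin_def cosw_def sinw_def)
  moreover have "(cos (w * h) * a - b) * a + (cos (w * h) * b - a) * b = cos (w * h) * (a\<^sup>2 + b\<^sup>2) - 2 * a * b"
    by (simp add: power2_eq_square algebra_simps)
  ultimately show ?thesis by simp
qed

lemma sin_less_self:
  fixes x :: real
  assumes "0 < x" "x < pi"
  shows "sin x < x"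
proof -
  have "0 - sin 0 < x - sin x"
  proof (rule DERIV_pos_imp_increasing_open[OF assms(1)])
    fix y assume y: "0 < y" "y < x"
    have "((\<lambda>y. y - sin y) has_real_derivative 1 - cos y) (at y)"
      by (auto intro!: derivative_eq_intros)
    moreover have "cos y < 1" using cos_monotone_0_pi[of 0 y] y assms by simp
    ultimately show "\<exists>d. ((\<lambda>y. y - sin y) has_real_derivative d) (at y) \<and> d > 0"
      by (intro exI[of _ "1 - cos y"]) simp
  qed (intro continuous_intros)
  then show ?thesis by simp
qed

text \<open>
  The two coefficients are \<open>w cot (w h / 2)\<close> and \<open>w tan (w h / 2)\<close>. The sign of the first derivative
  comes down to \<open>sin x < x\<close>. The mean value theorem is applied with the derivative at positive frequencies
  only, so that \<open>w = 0\<close> needs no more than continuity.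
\<close>

lemma link_coeff_strict:
  assumes h: "0 < h" and st: "0 \<le> s" "s < t" "t * h < pi"
  shows "(1 + cosw t h) / sinw t h < (1 + cosw s h) / sinw s h"
    and "(1 - cosw s h) / sinw s h < (1 - cosw t h) / sinw t h"
proof -
  have sp: "sin (x * h) > 0" "x * h < pi" "0 < x" if "s < x" "x \<le> t" for x
  proof -
    have "x * h \<le> t * h" using that h by simp
    then show "x * h < pi" using st by simp
    then show "sin (x * h) > 0" "0 < x" using that st h by (auto intro: sin_gt_zero)
  qed
  have nz: "sinw x h \<noteq> 0" if "x \<in> {s..t}" for x
  proof -
    have "x * h \<le> t * h" using that h by simp
    then have "x * h < pi" using st(3) by (rule le_less_trans)
    then show ?thesis using sinw_pos[of x h] st h that by auto
  qed
  have cont: "continuous_on {s..t} (\<lambda>w. sinw w h)"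
    using continuous_on_subset[OF continuous_sinw_freq] by blast
  have cont1: "continuous_on {s..t} (\<lambda>w. (1 + cosw w h) / sinw w h)"
    "continuous_on {s..t} (\<lambda>w. (1 - cosw w h) / sinw w h)"
    using cont nz unfolding cosw_def by (intro continuous_intros; auto)+
  have sinlt: "sin (x * h) < x * h" if "s < x" "x < t" for x
    using sp[of x] that h by (intro sin_less_self) auto
  show "(1 + cosw t h) / sinw t h < (1 + cosw s h) / sinw s h"
  proof (rule DERIV_neg_imp_decreasing_open[OF st(2) _ cont1(1)])
    fix x assume x: "s < x" "x < t"
    define sn where "sn = sin (x * h)"
    define cs where "cs = cos (x * h)"
    have p: "sn > 0" "x > 0" "x * h < pi" using sp[of x] x by (auto simp: sn_def)
    have sq: "sn\<^sup>2 = 1 - cs\<^sup>2" by (simp add: sn_def cs_def sin_squared_eq)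
    have "((\<lambda>w. w * (1 + cos (w * h)) / sin (w * h)) has_real_derivative
        ((1 + cs - x * (h * sn)) * sn - x * (1 + cs) * (h * cs)) / sn\<^sup>2) (at x)"
      using p unfolding sn_def cs_def by (auto intro!: derivative_eq_intros simp: power2_eq_square algebra_simps)
    also have "(1 + cs - x * (h * sn)) * sn - x * (1 + cs) * (h * cs) =
        (1 + cs) * sn - x * h * (sn\<^sup>2 + cs * (1 + cs))" by (simp add: power2_eq_square algebra_simps)
    also have "\<dots> = (1 + cs) * (sn - x * h)" unfolding sq by (simp add: power2_eq_square algebra_simps)
    finally have D: "((\<lambda>w. w * (1 + cos (w * h)) / sin (w * h)) has_real_derivative
        (1 + cs) * (sn - x * h) / sn\<^sup>2) (at x)" .
    have "((\<lambda>w. (1 + cosw w h) / sinw w h) has_real_derivative (1 + cs) * (sn - x * h) / sn\<^sup>2) (at x)"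
      by (rule has_field_derivative_transform_within_open[OF D, of "{0<..}"])
        (use p in \<open>auto simp: cosw_def sinw_def\<close>)
    moreover have "(1 + cs) * (sn - x * h) / sn\<^sup>2 < 0"
    proof -
      have "cs > - 1" unfolding cs_def using cos_monotone_0_pi[of "x * h" pi] p h by simp
      then show ?thesis using sinlt[OF x] p
        by (intro divide_neg_pos mult_pos_neg) (auto simp: sn_def)
    qed
    ultimately show "\<exists>y. ((\<lambda>w. (1 + cosw w h) / sinw w h) has_real_derivative y) (at x) \<and> y < 0" by blast
  qed
  show "(1 - cosw s h) / sinw s h < (1 - cosw t h) / sinw t h"
  proof (rule DERIV_pos_imp_increasing_open[OF st(2) _ cont1(2)])
    fix x assume x: "s < x" "x < t"
    define sn where "sn = sin (x * h)"
    define cs where "cs = cos (x * h)"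
    have p: "sn > 0" "x > 0" "x * h < pi" using sp[of x] x by (auto simp: sn_def)
    have sq: "sn\<^sup>2 = 1 - cs\<^sup>2" by (simp add: sn_def cs_def sin_squared_eq)
    have "((\<lambda>w. w * (1 - cos (w * h)) / sin (w * h)) has_real_derivative
        ((1 - cs + x * (h * sn)) * sn - x * (1 - cs) * (h * cs)) / sn\<^sup>2) (at x)"
      using p unfolding sn_def cs_def by (auto intro!: derivative_eq_intros simp: power2_eq_square algebra_simps)
    also have "(1 - cs + x * (h * sn)) * sn - x * (1 - cs) * (h * cs) =
        (1 - cs) * sn + x * h * (sn\<^sup>2 - cs * (1 - cs))" by (simp add: power2_eq_square algebra_simps)
    also have "\<dots> = (1 - cs) * (sn + x * h)" unfolding sq by (simp add: power2_eq_square algebra_simps)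
    finally have D: "((\<lambda>w. w * (1 - cos (w * h)) / sin (w * h)) has_real_derivative
        (1 - cs) * (sn + x * h) / sn\<^sup>2) (at x)" .
    have "((\<lambda>w. (1 - cosw w h) / sinw w h) has_real_derivative (1 - cs) * (sn + x * h) / sn\<^sup>2) (at x)"
      by (rule has_field_derivative_transform_within_open[OF D, of "{0<..}"])
        (use p in \<open>auto simp: cosw_def sinw_def\<close>)
    moreover have "(1 - cs) * (sn + x * h) / sn\<^sup>2 > 0"
    proof -
      have "cs < 1" unfolding cs_def using cos_monotone_0_pi[of 0 "x * h"] p h by simp
      moreover have "0 < sn + x * h" using p h by (intro add_pos_pos) auto
      ultimately show ?thesis using p by (intro divide_pos_pos mult_pos_pos) auto
    qed
    ultimately show "\<exists>y. ((\<lambda>w. (1 - cosw w h) / sinw w h) has_real_derivative y) (at x) \<and> y > 0" by blast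
  qed
qed

text \<open>
  The form is diagonal in \<open>a - b\<close> and \<open>a + b\<close>, which separates its dependence on \<open>w\<close> into two
  monotone coefficients.
\<close>

lemma link_bilin_diag:
  "link_bilin w h a b a b = (a - b)\<^sup>2 / 2 * ((1 + cosw w h) / sinw w h) - (a + b)\<^sup>2 / 2 * ((1 - cosw w h) / sinw w h)"
proof -
  have "(a - b)\<^sup>2 / 2 * (1 + c) - (a + b)\<^sup>2 / 2 * (1 - c) = (c * a - b) * a + (c * b - a) * b" for c
    by (simp add: power2_eq_square field_simps)
  then show ?thesis
    unfolding link_bilin_def times_divide_eq_right diff_divide_distrib[symmetric] by simp
qed

lemma link_bilin_strict:
  assumes "0 < h" "0 \<le> s" "s < t" "t * h < pi"
  shows "link_bilin t h a b a b \<le> link_bilin s h a b a b"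
    and "a \<noteq> 0 \<or> b \<noteq> 0 \<Longrightarrow> link_bilin t h a b a b < link_bilin s h a b a b"
proof -
  note * = link_coeff_strict[OF assms]
  show "link_bilin t h a b a b \<le> link_bilin s h a b a b"
    unfolding link_bilin_diag using *
    by (intro diff_mono mult_left_mono) auto
  assume "a \<noteq> 0 \<or> b \<noteq> 0"
  then consider "a - b \<noteq> 0" | "a + b \<noteq> 0" by linarith
  then show "link_bilin t h a b a b < link_bilin s h a b a b"
  proof cases
    case 1
    then have "(a - b)\<^sup>2 / 2 * ((1 + cosw t h) / sinw t h) < (a - b)\<^sup>2 / 2 * ((1 + cosw s h) / sinw s h)"
      using * by (intro mult_strict_left_mono) auto
    moreover have "(a + b)\<^sup>2 / 2 * ((1 - cosw s h) / sinw s h) \<le> (a + b)\<^sup>2 / 2 * ((1 - cosw t h) / sinw t h)"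
      using * by (intro mult_left_mono) auto
    ultimately show ?thesis unfolding link_bilin_diag by linarith
  next
    case 2
    then have "(a + b)\<^sup>2 / 2 * ((1 - cosw s h) / sinw s h) < (a + b)\<^sup>2 / 2 * ((1 - cosw t h) / sinw t h)"
      using * by (intro mult_strict_left_mono) auto
    moreover have "(a - b)\<^sup>2 / 2 * ((1 + cosw t h) / sinw t h) \<le> (a - b)\<^sup>2 / 2 * ((1 + cosw s h) / sinw s h)"
      using * by (intro mult_left_mono) auto
    ultimately show ?thesis unfolding link_bilin_diag by linarith
  qed
qed

section \<open>Subdivision of a quantum graph\<close>

context quantum_graph begin

lemma arc_crossing_cut:
  assumes S: "S \<subseteq> verts G" "S \<noteq> {}" "S \<noteq> verts G"
  shows "\<exists>e\<in>arcs G. (tail G e \<in> S) \<noteq> (head G e \<in> S)"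
proof (rule ccontr)
  assume "\<not> ?thesis"
  then have same: "(tail G e \<in> S) = (head G e \<in> S)" if "e \<in> arcs G" for e using that by blast
  obtain u v where uv: "u \<in> S" "v \<in> verts G" "v \<notin> S" using S by blast
  have "(u, v) \<in> rtrancl_on (verts G) ((arcs_ends G)\<^sup>s)"
    using connected uv S(1) unfolding connected_conv by blast
  then have "v \<in> S"
  proof (induction rule: rtrancl_on_induct)
    case base
    then show ?case using uv by simp
  next
    case (step a b)
    from step(2) obtain e where "e \<in> arcs G" "(a, b) = (tail G e, head G e) \<or> (a, b) = (head G e, tail G e)"
      unfolding symcl_def arcs_ends_def arc_to_ends_def by auto
    then show ?case using same[of e] step by auto
  qed
  with uv show False by simp
qed

lemma deg_pos:
  assumes v: "v \<in> verts G"
  shows "0 < deg G v"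
proof -
  have "\<exists>e\<in>arcs G. tail G e = v \<or> head G e = v"
  proof (cases "verts G = {v}")
    case True
    then show ?thesis using arcs_nonempty tail_in_verts by fastforce
  next
    case False
    then show ?thesis using arc_crossing_cut[of "{v}"] v by auto
  qed
  then obtain e where "e \<in> out_arcs G v \<or> e \<in> in_arcs G v" by auto
  then show ?thesis
    unfolding deg_def out_degree_def in_degree_def
    by (auto simp: card_gt_0_iff)
qed

end

text \<open>
  With \<open>K\<close> times the length of a link below \<open>\<pi>\<close>, the first Dirichlet eigenvalue of a link exceeds
  \<open>K\<^sup>2\<close>, so that the form of a link is defined for all frequencies up to \<open>K\<close>.
\<close>

locale subdivided_quantum_graph = quantum_graph G l D
  for G :: "('v, 'e) pre_digraph" (structure) and l :: "'e \<Rightarrow> real" and D :: "'v set" +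
  fixes m :: nat and K :: real
  assumes m_pos: "0 < m" and K_pos: "0 < K"
    and fine: "e \<in> arcs G \<Longrightarrow> K * (l e / m) < pi"
begin

definition mesh :: "'e \<Rightarrow> real" where
  "mesh e = l e / real m"

text \<open>
  Edges that meet share their end points, so these are named after the vertices.
\<close>

definition pt :: "'e \<Rightarrow> nat \<Rightarrow> 'v + 'e \<times> nat" where
  "pt e i = (if i = 0 then Inl (tail G e) else if i = m then Inl (head G e) else Inr (e, i))"

definition nodes :: "('v + 'e \<times> nat) set" where
  "nodes = Inl ` verts G \<union> Inr ` (arcs G \<times> {1..<m})"

definition links :: "('e \<times> nat) set" where
  "links = arcs G \<times> {..<m}"

definition link_start :: "'e \<times> nat \<Rightarrow> 'v + 'e \<times> nat" where
  "link_start = (\<lambda>(e, i). pt e i)"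

definition link_end :: "'e \<times> nat \<Rightarrow> 'v + 'e \<times> nat" where
  "link_end = (\<lambda>(e, i). pt e (Suc i))"

text \<open>
  Vertices of higher degree carry no angle: their natural condition adds nothing to the form. A
  Neumann vertex has the angle \<open>\<pi>/2\<close>, which adds nothing either but has to be paid for as a potential.
\<close>

definition front :: "'v + 'e \<times> nat \<Rightarrow> real list" where
  "front p = (case p of Inl v \<Rightarrow> if v \<in> D then [pi] else if deg G v = 1 then [pi / 2] else [] | Inr _ \<Rightarrow> [])"

definition grid_space :: "('v + 'e \<times> nat \<Rightarrow> real) set" where
  "grid_space = admissible nodes front"

definition grid_form :: "real \<Rightarrow> ('v + 'e \<times> nat \<Rightarrow> real) \<Rightarrow> ('v + 'e \<times> nat \<Rightarrow> real) \<Rightarrow> real" where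
  "grid_form w x y = (\<Sum>(e, i)\<in>links. link_bilin w (mesh e) (x (pt e i)) (x (pt e (Suc i))) (y (pt e i)) (y (pt e (Suc i))))"

lemma mesh_pos: "e \<in> arcs G \<Longrightarrow> 0 < mesh e"
  using length_pos m_pos by (simp add: mesh_def)

lemma mesh_fine: "e \<in> arcs G \<Longrightarrow> K * mesh e < pi"
  using fine by (simp add: mesh_def)

lemma mesh_length: "real m * mesh e = l e"
  using m_pos by (simp add: mesh_def)

lemma pt_simps [simp]: "pt e 0 = Inl (tail G e)" "pt e m = Inl (head G e)"
  using m_pos by (auto simp: pt_def)

lemma finite_nodes: "finite nodes" and finite_links: "finite links"
  by (auto simp: nodes_def links_def)

lemma pt_in_nodes: "e \<in> arcs G \<Longrightarrow> i \<le> m \<Longrightarrow> pt e i \<in> nodes"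
  by (auto simp: pt_def nodes_def)

lemma link_ends: "g \<in> links \<Longrightarrow> link_start g \<in> nodes \<and> link_end g \<in> nodes"
  by (auto simp: links_def link_start_def link_end_def intro!: pt_in_nodes)

lemma Dirichlet_vertex: "v \<in> D \<Longrightarrow> v \<in> verts G \<and> deg G v = 1"
  using Dirichlet by auto

lemma mem_grid_space: "x \<in> grid_space \<longleftrightarrow> x \<in> supported nodes \<and> (\<forall>v\<in>D. x (Inl v) = 0)"
proof -
  have "pi \<in> set (front p) \<longleftrightarrow> (\<exists>v\<in>D. p = Inl v)" for p
    by (auto simp: front_def split: sum.splits)
  then show ?thesis unfolding grid_space_def admissible_def nodes_def
    using Dirichlet_vertex by auto
qed

lemma linked_grid: "linked link_start link_end nodes links"
  unfolding linked_def
proof (intro conjI allI impI)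
  show "nodes \<noteq> {}" using connected by (auto simp: nodes_def connected_conv)
next
  fix S assume S: "S \<subseteq> nodes" "S \<noteq> {}" "S \<noteq> nodes"
  show "\<exists>g\<in>links. (link_start g \<in> S) \<noteq> (link_end g \<in> S)"
  proof (rule ccontr)
    assume neg: "\<not> ?thesis"
    have step: "(pt e i \<in> S) = (pt e (Suc i) \<in> S)" if "e \<in> arcs G" "i < m" for e i
      using neg that by (force simp: links_def link_start_def link_end_def)
    have all: "(pt e i \<in> S) = (Inl (tail G e) \<in> S)" if "e \<in> arcs G" "i \<le> m" for e i
      using that(2)
    proof (induction i)
      case (Suc i)
      then show ?case using step[OF that(1), of i] by simp
    qed simp
    define T where "T = {v \<in> verts G. Inl v \<in> S}"
    have "(tail G e \<in> T) = (head G e \<in> T)" if "e \<in> arcs G" for e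
      using all[OF that, of m] that by (simp add: T_def)
    then have T: "T = {} \<or> T = verts G"
      using arc_crossing_cut[of T] by (auto simp: T_def)
    have in_S: "p \<in> S \<longleftrightarrow> T \<noteq> {}" if p: "p \<in> nodes" for p
    proof -
      consider v where "v \<in> verts G" "p = Inl v" | e i where "e \<in> arcs G" "i \<in> {1..<m}" "p = Inr (e, i)"
        using p by (auto simp: nodes_def)
      then show ?thesis
      proof cases
        case 1
        then show ?thesis using T by (auto simp: T_def)
      next
        case 2
        then have "p \<in> S \<longleftrightarrow> tail G e \<in> T"
          using all[of e i] by (simp add: T_def pt_def)
        then show ?thesis using T 2 by auto
      qed
    qed
    then have "S = {} \<or> S = nodes" using S(1) by blast
    then show False using S by blast
  qed
qed

lemma incidences_interior:
  assumes "e \<in> arcs G" "i \<in> {1..<m}"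
  shows "incidences link_start link_end links (Inr (e, i)) = 2"
proof -
  have "{g \<in> links. link_start g = Inr (e, i)} = {(e, i)}"
    using assms by (auto simp: links_def link_start_def pt_def split: if_splits)
  moreover have "{g \<in> links. link_end g = Inr (e, i)} = {(e, i - 1)}"
    using assms by (auto simp: links_def link_end_def pt_def split: if_splits)
  ultimately show ?thesis by (simp add: incidences_def)
qed

lemma starts_at_vertex: "{g \<in> links. link_start g = Inl v} = (\<lambda>e. (e, 0)) ` out_arcs G v"
  using m_pos by (auto simp: links_def link_start_def pt_def split: if_splits)

lemma ends_at_vertex: "{g \<in> links. link_end g = Inl v} = (\<lambda>e. (e, m - 1)) ` in_arcs G v"
  using m_pos by (auto simp: links_def link_end_def pt_def split: if_splits)

lemma incidences_vertex: "incidences link_start link_end links (Inl v) = deg G v"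
  unfolding incidences_def starts_at_vertex ends_at_vertex deg_def out_degree_def in_degree_def
  by (simp add: card_image inj_on_def)

lemma card_nodes: "real (card nodes) = real (card (verts G)) + real (card (arcs G)) * (real m - 1)"
proof -
  have "card nodes = card (Inl ` verts G :: ('v + 'e \<times> nat) set) + card (Inr ` (arcs G \<times> {1..<m}) :: ('v + 'e \<times> nat) set)"
    unfolding nodes_def by (intro card_Un_disjoint) auto
  then show ?thesis using m_pos by (simp add: card_image card_cartesian_product of_nat_diff)
qed

lemma card_links: "card links = card (arcs G) * m"
  by (simp add: links_def card_cartesian_product)

lemma sum_links: "(\<Sum>g\<in>links. f g) = (\<Sum>e\<in>arcs G. \<Sum>i<m. f (e, i))"
  unfolding links_def by (simp add: sum.cartesian_product)

lemma sum_front: "(\<Sum>p\<in>nodes. sum_list (front p)) = pi * card D + pi / 2 * card (Neumann_vertices G D)"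
proof -
  have "(\<Sum>p\<in>nodes. sum_list (front p)) = (\<Sum>p\<in>Inl ` verts G. sum_list (front p))"
    unfolding nodes_def by (intro sum.mono_neutral_right) (auto simp: front_def)
  also have "\<dots> = (\<Sum>v\<in>verts G. sum_list (front (Inl v)))"
    by (simp add: sum.reindex)
  also have "\<dots> = (\<Sum>v\<in>verts G. (if v \<in> D then pi else 0) + (if v \<in> Neumann_vertices G D then pi / 2 else 0))"
    by (intro sum.cong) (auto simp: front_def Neumann_vertices_def)
  also have "\<dots> = pi * card (verts G \<inter> D) + pi / 2 * card (verts G \<inter> Neumann_vertices G D)"
    by (simp add: sum.distrib sum.If_cases Int_def)
  also have "verts G \<inter> D = D" using Dirichlet by auto
  also have "verts G \<inter> Neumann_vertices G D = Neumann_vertices G D" by (auto simp: Neumann_vertices_def)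
  finally show ?thesis .
qed

text \<open>
  The subdivision changes neither the Betti number nor the ends of the graph, so that the count for
  networks is the count for the quantum graph.
\<close>

lemma test_space:
  assumes nc: "\<not> cycle_graph G" and k: "k \<ge> 1"
    and big: "pi * (real k - 2 + real_of_int (betti G) + real (card D)
            + (real (card (Neumann_vertices G D)) + real_of_int (betti G)) / 2) < K * total_length G l"
  obtains W where "subspace W" "W \<subseteq> grid_space" "\<And>x. x \<in> W \<Longrightarrow> grid_form K x x \<le> 0" "k \<le> dim W"
proof -
  define \<theta> where "\<theta> = (\<lambda>(e, i::nat). K * mesh e)"
  have "\<exists>n. index_ge link_start link_end \<theta> nodes links front n \<and>
    (\<Sum>g\<in>links. \<theta> g) - (\<Sum>p\<in>nodes. sum_list (front p)) + pi
      - 3 / 2 * pi * (real (card links) - real (card nodes) + 1) \<le> real n * pi"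
  proof (rule network_index[OF finite_nodes finite_links linked_grid link_ends])
    show "0 < \<theta> g \<and> \<theta> g < pi" if "g \<in> links" for g
      using that K_pos mesh_pos mesh_fine by (auto simp: \<theta>_def links_def)
    show "valid_angles (front p)" for p
    proof -
      have "set (front p) \<subseteq> {pi, pi / 2}" by (auto simp: front_def split: sum.splits)
      then show ?thesis unfolding valid_angles_def using pi_gt_zero by fastforce
    qed
    show "2 \<le> incidences link_start link_end links p + length (front p)" if p: "p \<in> nodes" for p
    proof -
      consider v where "v \<in> verts G" "p = Inl v" | e i where "e \<in> arcs G" "i \<in> {1..<m}" "p = Inr (e, i)"
        using p by (auto simp: nodes_def)
      then show ?thesis
      proof cases
        case 1
        then show ?thesis using deg_pos[of v] Dirichlet_vertex[of v]
          by (auto simp: incidences_vertex front_def)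
      next
        case 2
        then show ?thesis using incidences_interior by simp
      qed
    qed
    obtain v where "v \<in> verts G" "deg G v \<noteq> 2"
      using nc connected by (auto simp: cycle_graph_def)
    then show "\<exists>p\<in>nodes. front p \<noteq> [] \<or> incidences link_start link_end links p \<noteq> 2"
      by (intro bexI[of _ "Inl v"]) (auto simp: incidences_vertex nodes_def)
  qed
  then obtain n where n: "index_ge link_start link_end \<theta> nodes links front n"
    "(\<Sum>g\<in>links. \<theta> g) - (\<Sum>p\<in>nodes. sum_list (front p)) + pi
      - 3 / 2 * pi * (real (card links) - real (card nodes) + 1) \<le> real n * pi" by blast
  have sum\<theta>: "(\<Sum>g\<in>links. \<theta> g) = K * total_length G l"
  proof -
    have "(\<Sum>g\<in>links. \<theta> g) = (\<Sum>e\<in>arcs G. K * (real m * mesh e))"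
      unfolding sum_links by (simp add: \<theta>_def mult_ac)
    then show ?thesis by (simp add: mesh_length total_length_def sum_distrib_left)
  qed
  have betti: "real (card links) - real (card nodes) + 1 = real_of_int (betti G)"
    by (simp add: card_links card_nodes betti_def algebra_simps)
  have "(real k - 1) * pi < real n * pi"
    using n(2) big unfolding sum\<theta> betti sum_front by (simp add: field_simps)
  then have "k \<le> n" by simp
  obtain W where W: "subspace W" "W \<subseteq> admissible nodes front"
    "\<And>x. x \<in> W \<Longrightarrow> network_form link_start link_end \<theta> nodes links front x \<le> 0" "n \<le> dim W"
    using n(1) by (auto simp: index_ge_def)
  have "grid_form K x x \<le> 0" if x: "x \<in> W" for x
  proof -
    have "cot_sum (front p) = 0" for p
      by (auto simp: front_def cot_sum_def cot_def split: sum.splits)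
    then have "network_form link_start link_end \<theta> nodes links front x =
        (\<Sum>g\<in>links. link_form (\<theta> g) (x (link_start g)) (x (link_end g)))"
      by (simp add: network_form_def)
    moreover have "grid_form K x x = K * (\<Sum>g\<in>links. link_form (\<theta> g) (x (link_start g)) (x (link_end g)))"
      unfolding grid_form_def sum_distrib_left
      by (intro sum.cong) (auto simp: \<theta>_def link_start_def link_end_def link_bilin_eq_link_form[OF K_pos])
    ultimately show ?thesis using W(3)[OF x] K_pos by (simp add: mult_nonneg_nonpos)
  qed
  with W \<open>k \<le> n\<close> show ?thesis by (intro that[of W]) (auto simp: grid_space_def)
qed

end

section \<open>Eigenfunctions and vertex conditions\<close>

text \<open>
  The right-hand side, as a function of \<open>z\<close>, has the derivative \<open>0\<close>.
\<close>

lemma oscillator_solution: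
  assumes u: "\<And>x. x \<in> {0..L} \<Longrightarrow> (u has_real_derivative u' x) (at x within {0..L})"
    and u': "\<And>x. x \<in> {0..L} \<Longrightarrow> (u' has_real_derivative - w\<^sup>2 * u x) (at x within {0..L})"
    and yz: "y \<in> {0..L}" "z \<in> {0..L}"
  shows "u y = cosw w (y - z) * u z + sinw w (y - z) * u' z"
proof -
  \<comment> \<open>The value at \<open>y\<close> predicted from the data at \<open>z\<close>.\<close>
  define f where "f z = cosw w (y - z) * u z + sinw w (y - z) * u' z" for z
  have "(f has_real_derivative 0) (at x within {0..L})" if x: "x \<in> {0..L}" for x
    unfolding f_def
    by (rule derivative_eq_intros u[OF x] u'[OF x] refl)+ (simp add: algebra_simps)
  then obtain c where c: "\<And>x. x \<in> {0..L} \<Longrightarrow> f x = c"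
    using has_field_derivative_zero_constant[of "{0..L}" f] by auto
  have "f y = f z" using c yz by simp
  then show ?thesis by (simp add: f_def)
qed

lemma edge_scale_eq_scaleR: "edge_scale = scaleR"
  by (simp add: edge_scale_def fun_eq_iff)

lemma edge_fun_dim: "edge_fun.dim S = dim S"
  unfolding edge_scale_eq_scaleR dim_raw_def ..

context quantum_graph begin

lemma eigenspaceE:
  assumes "u \<in> eigenspace G l D \<nu>"
  obtains u' where
    "\<forall>e\<in>arcs G. \<forall>x\<in>{0..l e}. (u e has_real_derivative u' e x) (at x within {0..l e})"
    "\<forall>e\<in>arcs G. \<forall>x\<in>{0..l e}. (u' e has_real_derivative - \<nu> * u e x) (at x within {0..l e})"
    "\<forall>v\<in>verts G - D. natural_condition G l v u u'"
    "\<forall>v\<in>D. Dirichlet_condition G l v u"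
    "\<forall>e x. \<not> (e \<in> arcs G \<and> x \<in> {0..l e}) \<longrightarrow> u e x = 0"
  using assms unfolding eigenspace_def by blast

text \<open>
  The boundary terms of an integration by parts against a function that is continuous at the
  vertices and vanishes at the Dirichlet vertices.
\<close>

lemma vertex_flux:
  assumes nat: "\<forall>v\<in>verts G - D. natural_condition G l v u u'" and f: "\<And>v. v \<in> D \<Longrightarrow> f v = (0::real)"
  shows "(\<Sum>e\<in>arcs G. f (head G e) * u' e (l e) - f (tail G e) * u' e 0) = 0"
proof -
  have "(\<Sum>e\<in>arcs G. f (head G e) * u' e (l e)) = (\<Sum>v\<in>verts G. \<Sum>e\<in>{e \<in> arcs G. head G e = v}. f (head G e) * u' e (l e))"
    by (rule sum.group[symmetric]) auto
  moreover have "\<dots> = (\<Sum>v\<in>verts G. f v * (\<Sum>e\<in>in_arcs G v. u' e (l e)))"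
    unfolding sum_distrib_left by (intro sum.cong) (auto simp: in_arcs_def)
  moreover have "(\<Sum>e\<in>arcs G. f (tail G e) * u' e 0) = (\<Sum>v\<in>verts G. \<Sum>e\<in>{e \<in> arcs G. tail G e = v}. f (tail G e) * u' e 0)"
    by (rule sum.group[symmetric]) auto
  moreover have "\<dots> = (\<Sum>v\<in>verts G. f v * (\<Sum>e\<in>out_arcs G v. u' e 0))"
    unfolding sum_distrib_left by (intro sum.cong) (auto simp: out_arcs_def)
  ultimately have "(\<Sum>e\<in>arcs G. f (head G e) * u' e (l e) - f (tail G e) * u' e 0) =
      (\<Sum>v\<in>verts G. f v * (\<Sum>e\<in>in_arcs G v. u' e (l e)) - f v * (\<Sum>e\<in>out_arcs G v. u' e 0))"
    by (simp only: sum_subtractf)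
  also have "\<dots> = 0"
  proof (intro sum.neutral ballI)
    fix v assume v: "v \<in> verts G"
    show "f v * (\<Sum>e\<in>in_arcs G v. u' e (l e)) - f v * (\<Sum>e\<in>out_arcs G v. u' e 0) = 0"
    proof (cases "v \<in> D")
      case False
      then have "(\<Sum>e\<in>out_arcs G v. u' e 0) = (\<Sum>e\<in>in_arcs G v. u' e (l e))"
        using nat v by (auto simp: natural_condition_def sum_negf)
      then show ?thesis by simp
    qed (use f in simp)
  qed
  finally show ?thesis .
qed

lemma vertex_values:
  assumes "\<forall>v\<in>verts G - D. natural_condition G l v u u'" "\<forall>v\<in>D. Dirichlet_condition G l v u"
  obtains c where "\<And>v. v \<in> D \<Longrightarrow> c v = 0" "\<And>e. e \<in> arcs G \<Longrightarrow> u e 0 = c (tail G e)"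
    "\<And>e. e \<in> arcs G \<Longrightarrow> u e (l e) = c (head G e)"
proof -
  have "\<forall>v\<in>verts G. \<exists>c. (v \<in> D \<longrightarrow> c = 0) \<and> (\<forall>e\<in>out_arcs G v. u e 0 = c) \<and> (\<forall>e\<in>in_arcs G v. u e (l e) = c)"
  proof
    fix v assume v: "v \<in> verts G"
    show "\<exists>c. (v \<in> D \<longrightarrow> c = 0) \<and> (\<forall>e\<in>out_arcs G v. u e 0 = c) \<and> (\<forall>e\<in>in_arcs G v. u e (l e) = c)"
    proof (cases "v \<in> D")
      case True
      then show ?thesis using assms(2) by (auto simp: Dirichlet_condition_def)
    next
      case False
      then show ?thesis using assms(1) v unfolding natural_condition_def by blast
    qed
  qed
  from bchoice[OF this] obtain c where
    c: "\<forall>v\<in>verts G. (v \<in> D \<longrightarrow> c v = 0) \<and> (\<forall>e\<in>out_arcs G v. u e 0 = c v) \<and> (\<forall>e\<in>in_arcs G v. u e (l e) = c v)"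
    by blast
  show ?thesis
  proof (rule that[of c])
    show "c v = 0" if "v \<in> D" for v using that c Dirichlet by auto
    show "u e 0 = c (tail G e)" "u e (l e) = c (head G e)" if "e \<in> arcs G" for e
      using c that tail_in_verts[OF that] head_in_verts[OF that] by auto
  qed
qed

text \<open>
  On every edge \<open>u u'\<close> has the derivative \<open>u'\<^sup>2 - \<nu> u\<^sup>2 \<ge> 0\<close>, and the increments over all
  edges add up to \<open>0\<close> by the vertex conditions.
  So every eigenvalue is the square of a frequency, and those up to \<open>K\<^sup>2\<close> are all seen by the grid forms.
\<close>

lemma no_negative_eigenvalue:
  assumes \<nu>: "\<nu> < 0" and u: "u \<in> eigenspace G l D \<nu>"
  shows "u = 0"
proof -
  obtain u' where u':
    "\<forall>e\<in>arcs G. \<forall>x\<in>{0..l e}. (u e has_real_derivative u' e x) (at x within {0..l e})"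
    "\<forall>e\<in>arcs G. \<forall>x\<in>{0..l e}. (u' e has_real_derivative - \<nu> * u e x) (at x within {0..l e})"
    "\<forall>v\<in>verts G - D. natural_condition G l v u u'"
    "\<forall>v\<in>D. Dirichlet_condition G l v u"
    "\<forall>e x. \<not> (e \<in> arcs G \<and> x \<in> {0..l e}) \<longrightarrow> u e x = 0"
    by (rule eigenspaceE[OF u])
  obtain c where c: "\<And>v. v \<in> D \<Longrightarrow> c v = 0" "\<And>e. e \<in> arcs G \<Longrightarrow> u e 0 = c (tail G e)"
    "\<And>e. e \<in> arcs G \<Longrightarrow> u e (l e) = c (head G e)"
    by (rule vertex_values[OF u'(3,4)]) blast
  define F where "F e x = u e x * u' e x" for e x
  have DF: "(F e has_real_derivative (u' e x)\<^sup>2 - \<nu> * (u e x)\<^sup>2) (at x within {0..l e})"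
    if "e \<in> arcs G" "x \<in> {0..l e}" for e x
  proof -
    have "((\<lambda>x. u e x * u' e x) has_real_derivative u' e x * u' e x + (- \<nu> * u e x) * u e x) (at x within {0..l e})"
      using DERIV_mult[OF u'(1)[rule_format, OF that] u'(2)[rule_format, OF that]] by simp
    then show ?thesis unfolding F_def by (simp add: power2_eq_square mult.assoc)
  qed
  have nn: "0 \<le> (u' e x)\<^sup>2 - \<nu> * (u e x)\<^sup>2" for e x
  proof -
    have "\<nu> * (u e x)\<^sup>2 \<le> 0" using \<nu> by (intro mult_nonpos_nonneg) auto
    then show ?thesis using zero_le_power2[of "u' e x"] by linarith
  qed
  have mono: "F e x \<le> F e y" if e: "e \<in> arcs G" and xy: "0 \<le> x" "x \<le> y" "y \<le> l e" for e x y
  proof (rule DERIV_nonneg_imp_increasing_open[OF xy(2)])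
    fix z assume z: "x < z" "z < y"
    then have "(F e has_real_derivative (u' e z)\<^sup>2 - \<nu> * (u e z)\<^sup>2) (at z)"
      using DF[OF e, of z] xy at_within_Icc_at[of 0 z "l e"] by simp
    then show "\<exists>d. (F e has_real_derivative d) (at z) \<and> 0 \<le> d" using nn by blast
  next
    have "continuous_on {0..l e} (F e)"
      using DF[OF e] by (rule DERIV_continuous_on)
    then show "continuous_on {x..y} (F e)" by (rule continuous_on_subset) (use xy in auto)
  qed
  have "(\<Sum>e\<in>arcs G. F e (l e) - F e 0) = 0"
    using vertex_flux[where f = c, OF u'(3) c(1)] c(2,3) by (simp add: F_def)
  moreover have "0 \<le> F e (l e) - F e 0" if "e \<in> arcs G" for e
    using mono[OF that, of 0 "l e"] length_pos[OF that] by simp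
  ultimately have eq: "F e (l e) = F e 0" if "e \<in> arcs G" for e
    using that by (simp add: sum_nonneg_eq_0_iff)
  have "u e x = 0" if e: "e \<in> arcs G" and x: "x \<in> {0..l e}" for e x
  proof -
    have const: "F e y = F e 0" if "y \<in> {0..l e}" for y
      using mono[OF e, of 0 y] mono[OF e, of y "l e"] eq[OF e] that by auto
    have "((\<lambda>_. F e 0) has_real_derivative (u' e x)\<^sup>2 - \<nu> * (u e x)\<^sup>2) (at x within {0..l e})"
      using has_derivative_transform[OF x const[symmetric] DF[OF e x, unfolded has_field_derivative_def]]
      unfolding has_field_derivative_def .
    then have D: "((\<lambda>_. F e 0) has_vector_derivative (u' e x)\<^sup>2 - \<nu> * (u e x)\<^sup>2) (at x within cbox 0 (l e))"
      by (simp add: has_real_derivative_iff_has_vector_derivative)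
    have "(u' e x)\<^sup>2 - \<nu> * (u e x)\<^sup>2 = 0"
      by (rule vector_derivative_unique_within_closed_interval[OF _ _ D has_vector_derivative_const])
        (use x length_pos[OF e] in auto)
    then have "- \<nu> * (u e x)\<^sup>2 \<le> 0" using zero_le_power2[of "u' e x"] by linarith
    moreover have "0 < - \<nu> * (u e x)\<^sup>2" if "u e x \<noteq> 0" using that \<nu> by (intro mult_pos_pos) auto
    ultimately show "u e x = 0" by force
  qed
  then show "u = 0" using u'(5) by (auto simp: fun_eq_iff)
qed

text \<open>
  On each edge an eigenfunction is a combination of the two fundamental solutions. Finiteness matters,
  as the dimension of an infinite-dimensional space is \<open>0\<close> by convention.
\<close>

lemma fin_dim_eigenspace: "fin_dim (eigenspace G l D (w\<^sup>2))"
proof -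
  define c where "c e = (\<lambda>e' y. if e' = e \<and> y \<in> {0..l e} then cosw w y else 0)" for e
  define s where "s e = (\<lambda>e' y. if e' = e \<and> y \<in> {0..l e} then sinw w y else 0)" for e
  have "u \<in> span (c ` arcs G \<union> s ` arcs G)" if u: "u \<in> eigenspace G l D (w\<^sup>2)" for u
  proof -
    obtain u' where u':
      "\<forall>e\<in>arcs G. \<forall>x\<in>{0..l e}. (u e has_real_derivative u' e x) (at x within {0..l e})"
      "\<forall>e\<in>arcs G. \<forall>x\<in>{0..l e}. (u' e has_real_derivative - w\<^sup>2 * u e x) (at x within {0..l e})"
      "\<forall>v\<in>verts G - D. natural_condition G l v u u'"
      "\<forall>v\<in>D. Dirichlet_condition G l v u"
      "\<forall>e x. \<not> (e \<in> arcs G \<and> x \<in> {0..l e}) \<longrightarrow> u e x = 0"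
      by (rule eigenspaceE[OF u])
    have sol: "u e y = cosw w y * u e 0 + sinw w y * u' e 0" if "e \<in> arcs G" "y \<in> {0..l e}" for e y
      using oscillator_solution[of "l e" "u e" "u' e" w y 0] u'(1,2) that length_pos[OF that(1)] by simp
    have "u = (\<Sum>e\<in>arcs G. u e 0 *\<^sub>R c e + u' e 0 *\<^sub>R s e)"
    proof (intro ext)
      fix e y
      have "(\<Sum>e'\<in>arcs G. u e' 0 *\<^sub>R c e' + u' e' 0 *\<^sub>R s e') e y =
          (\<Sum>e'\<in>arcs G. if e' = e then (u e 0 * c e e y + u' e 0 * s e e y) else 0)"
        unfolding sum_fun_apply by (intro sum.cong) (auto simp: c_def s_def)
      also have "\<dots> = u e y"
      proof (cases "e \<in> arcs G \<and> y \<in> {0..l e}")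
        case True
        then show ?thesis using sol[of e y] by (simp add: c_def s_def mult.commute)
      next
        case False
        then show ?thesis using u'(5) by (auto simp: c_def s_def)
      qed
      finally show "u e y = (\<Sum>e\<in>arcs G. u e 0 *\<^sub>R c e + u' e 0 *\<^sub>R s e) e y" by simp
    qed
    also have "\<dots> \<in> span (c ` arcs G \<union> s ` arcs G)"
    proof (rule span_sum)
      fix e assume "e \<in> arcs G"
      then have "c e \<in> span (c ` arcs G \<union> s ` arcs G)" "s e \<in> span (c ` arcs G \<union> s ` arcs G)"
        by (auto intro!: span_base)
      then show "u e 0 *\<^sub>R c e + u' e 0 *\<^sub>R s e \<in> span (c ` arcs G \<union> s ` arcs G)"
        by (intro span_add span_scale)
    qed
    finally show ?thesis .
  qed
  then show ?thesis unfolding fin_dim_def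
    by (intro exI[of _ "c ` arcs G \<union> s ` arcs G"]) auto
qed

end

section \<open>The kernel of the grid form\<close>

context subdivided_quantum_graph begin

text \<open>
  The derivatives at the start and at the end of a link of the solution of \<open>u'' = - w\<^sup>2 u\<close> with the
  given end values.
\<close>

definition start_slope :: "real \<Rightarrow> ('v + 'e \<times> nat \<Rightarrow> real) \<Rightarrow> 'e \<Rightarrow> nat \<Rightarrow> real" where
  "start_slope w x e i = (x (pt e (Suc i)) - cosw w (mesh e) * x (pt e i)) / sinw w (mesh e)"

definition end_slope :: "real \<Rightarrow> ('v + 'e \<times> nat \<Rightarrow> real) \<Rightarrow> 'e \<Rightarrow> nat \<Rightarrow> real" where
  "end_slope w x e i = (cosw w (mesh e) * x (pt e (Suc i)) - x (pt e i)) / sinw w (mesh e)"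

lemma grid_form_slopes:
  "grid_form w x y = (\<Sum>(e, i)\<in>links. end_slope w x e i * y (pt e (Suc i)) - start_slope w x e i * y (pt e i))"
  unfolding grid_form_def
proof (intro sum.cong refl, clarify)
  fix e i
  have "((c * a - b) * a' + (c * b - a) * b') / S = (c * b - a) / S * b' - (b - c * a) / S * a'" for a b a' b' c S :: real
    by (simp add: diff_divide_distrib add_divide_distrib algebra_simps)
  then show "link_bilin w (mesh e) (x (pt e i)) (x (pt e (Suc i))) (y (pt e i)) (y (pt e (Suc i))) =
      end_slope w x e i * y (pt e (Suc i)) - start_slope w x e i * y (pt e i)"
    unfolding link_bilin_def end_slope_def start_slope_def by simp
qed

lemma bilinear_grid_form: "bilinear (grid_form w)"
  unfolding bilinear_def grid_form_def link_bilin_def case_prod_unfold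
proof (intro conjI allI)
  show "linear (\<lambda>y. \<Sum>p\<in>links. ((cosw w (mesh (fst p)) * x (pt (fst p) (snd p)) - x (pt (fst p) (Suc (snd p)))) * y (pt (fst p) (snd p)) +
      (cosw w (mesh (fst p)) * x (pt (fst p) (Suc (snd p))) - x (pt (fst p) (snd p))) * y (pt (fst p) (Suc (snd p)))) / sinw w (mesh (fst p)))" for x
    by (rule linear_compose_sum, intro ballI linearI)
      (simp_all add: algebra_simps add_divide_distrib diff_divide_distrib)
  show "linear (\<lambda>x. \<Sum>p\<in>links. ((cosw w (mesh (fst p)) * x (pt (fst p) (snd p)) - x (pt (fst p) (Suc (snd p)))) * y (pt (fst p) (snd p)) +
      (cosw w (mesh (fst p)) * x (pt (fst p) (Suc (snd p))) - x (pt (fst p) (snd p))) * y (pt (fst p) (Suc (snd p)))) / sinw w (mesh (fst p)))" for y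
    by (rule linear_compose_sum, intro ballI linearI)
      (simp_all add: algebra_simps add_divide_distrib diff_divide_distrib)
qed

lemma grid_form_commute: "grid_form w x y = grid_form w y x"
  unfolding grid_form_def link_bilin_def
  by (intro sum.cong) (auto simp: algebra_simps)

lemma continuous_grid_form: "continuous_on {0..K} (\<lambda>w. grid_form w x y)"
  unfolding grid_form_def case_prod_unfold
  by (intro continuous_on_sum continuous_link_bilin mesh_pos mesh_fine) (auto simp: links_def)

lemma grid_form_0_nonneg: "0 \<le> grid_form 0 x x"
  unfolding grid_form_def case_prod_unfold
  by (intro sum_nonneg link_bilin_0_nonneg mesh_pos) (auto simp: links_def)

lemma node_on_link:
  assumes "p \<in> nodes"
  obtains e i where "e \<in> arcs G" "i < m" "p = pt e i \<or> p = pt e (Suc i)"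
proof -
  consider v where "v \<in> verts G" "p = Inl v" | e i where "e \<in> arcs G" "i \<in> {1..<m}" "p = Inr (e, i)"
    using assms by (auto simp: nodes_def)
  then show ?thesis
  proof cases
    case 1
    have "out_arcs G v \<noteq> {} \<or> in_arcs G v \<noteq> {}"
      using deg_pos[OF 1(1)] by (auto simp: deg_def out_degree_def in_degree_def)
    then have "\<exists>e\<in>arcs G. tail G e = v \<or> head G e = v" by auto
    then consider e where "e \<in> arcs G" "tail G e = v" | e where "e \<in> arcs G" "head G e = v" by blast
    then show ?thesis
    proof cases
      case (1 e)
      then show ?thesis using that[of e 0] m_pos \<open>p = Inl v\<close> by simp
    next
      case (2 e)
      then show ?thesis using that[of e "m - 1"] m_pos \<open>p = Inl v\<close> by simp
    qed
  next
    case 2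
    then show ?thesis using that[of e i] by (auto simp: pt_def)
  qed
qed

lemma grid_form_strict:
  assumes x: "x \<in> grid_space" "x \<noteq> 0" and st: "0 \<le> s" "s < t" "t \<le> K"
  shows "grid_form t x x < grid_form s x x"
proof -
  have tm: "t * mesh e < pi" if "e \<in> arcs G" for e
  proof -
    have "t * mesh e \<le> K * mesh e" using st mesh_pos[OF that] by simp
    then show ?thesis using mesh_fine[OF that] by linarith
  qed
  obtain p where p: "x p \<noteq> 0" using x(2) by (auto simp: fun_eq_iff)
  then have "p \<in> nodes" using x(1) by (auto simp: mem_grid_space supported_def)
  then obtain e i where ei: "e \<in> arcs G" "i < m" "p = pt e i \<or> p = pt e (Suc i)" by (rule node_on_link)
  show ?thesis unfolding grid_form_def case_prod_unfold
  proof (rule sum_strict_mono_ex1[OF finite_links])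
    show "\<forall>g\<in>links. link_bilin t (mesh (fst g)) (x (pt (fst g) (snd g))) (x (pt (fst g) (Suc (snd g)))) (x (pt (fst g) (snd g))) (x (pt (fst g) (Suc (snd g))))
       \<le> link_bilin s (mesh (fst g)) (x (pt (fst g) (snd g))) (x (pt (fst g) (Suc (snd g)))) (x (pt (fst g) (snd g))) (x (pt (fst g) (Suc (snd g))))"
      using link_bilin_strict(1)[OF mesh_pos st(1,2) tm] by (auto simp: links_def)
    show "\<exists>g\<in>links. link_bilin t (mesh (fst g)) (x (pt (fst g) (snd g))) (x (pt (fst g) (Suc (snd g)))) (x (pt (fst g) (snd g))) (x (pt (fst g) (Suc (snd g))))
       < link_bilin s (mesh (fst g)) (x (pt (fst g) (snd g))) (x (pt (fst g) (Suc (snd g)))) (x (pt (fst g) (snd g))) (x (pt (fst g) (Suc (snd g))))"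
      using link_bilin_strict(2)[OF mesh_pos[OF ei(1)] st(1,2) tm[OF ei(1)]] ei p
      by (intro bexI[of _ "(e, i)"]) (auto simp: links_def)
  qed
qed

lemma sinw_mesh_pos:
  assumes "0 \<le> w" "w \<le> K" "e \<in> arcs G"
  shows "0 < sinw w (mesh e)"
proof -
  have "w * mesh e \<le> K * mesh e" using assms mesh_pos[OF assms(3)] by simp
  then have "w * mesh e < pi" using mesh_fine[OF assms(3)] by linarith
  then show ?thesis using sinw_pos assms(1) mesh_pos[OF assms(3)] by blast
qed

text \<open>
  Test the kernel condition with the indicator function of the node \<open>p\<close>.
\<close>

lemma kernel_stationary:
  assumes x: "x \<in> form_kernel (grid_form w) grid_space" and p: "p \<in> nodes" "p \<notin> Inl ` D"
  shows "(\<Sum>(e, i)\<in>{g \<in> links. link_end g = p}. end_slope w x e i) =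
    (\<Sum>(e, i)\<in>{g \<in> links. link_start g = p}. start_slope w x e i)"
proof -
  define d where "d = (\<lambda>q. if q = p then 1 else 0 :: real)"
  have "d \<in> grid_space" using p by (auto simp: mem_grid_space supported_def d_def)
  then have "0 = grid_form w x d" using x by (simp add: form_kernel_def)
  also have "\<dots> = (\<Sum>(e, i)\<in>links. (if link_end (e, i) = p then end_slope w x e i else 0) -
      (if link_start (e, i) = p then start_slope w x e i else 0))"
    unfolding grid_form_slopes by (intro sum.cong) (auto simp: d_def link_start_def link_end_def)
  also have "\<dots> = (\<Sum>(e, i)\<in>{g \<in> links. link_end g = p}. end_slope w x e i) -
    (\<Sum>(e, i)\<in>{g \<in> links. link_start g = p}. start_slope w x e i)"
    unfolding case_prod_unfold sum_subtractf sum.inter_filter[OF finite_links] by simp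
  finally show ?thesis by simp
qed

lemma kernel_smooth:
  assumes x: "x \<in> form_kernel (grid_form w) grid_space" and e: "e \<in> arcs G" and i: "Suc i < m"
  shows "start_slope w x e (Suc i) = end_slope w x e i"
proof -
  have "Inr (e, Suc i) \<in> nodes" using e i by (auto simp: nodes_def)
  from kernel_stationary[OF x this] have
    "(\<Sum>(e, i)\<in>{g \<in> links. link_end g = Inr (e, Suc i)}. end_slope w x e i) =
     (\<Sum>(e, i)\<in>{g \<in> links. link_start g = Inr (e, Suc i)}. start_slope w x e i)" by auto
  moreover have "{g \<in> links. link_start g = Inr (e, Suc i)} = {(e, Suc i)}"
    using e i by (auto simp: links_def link_start_def pt_def split: if_splits)
  moreover have "{g \<in> links. link_end g = Inr (e, Suc i)} = {(e, i)}"
    using e i by (auto simp: links_def link_end_def pt_def split: if_splits)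
  ultimately show ?thesis by simp
qed

lemma kernel_vertex:
  assumes x: "x \<in> form_kernel (grid_form w) grid_space" and v: "v \<in> verts G" "v \<notin> D"
  shows "(\<Sum>e\<in>in_arcs G v. end_slope w x e (m - 1)) = (\<Sum>e\<in>out_arcs G v. start_slope w x e 0)"
proof -
  have "Inl v \<in> nodes" "Inl v \<notin> Inl ` D" using v by (auto simp: nodes_def)
  from kernel_stationary[OF x this] show ?thesis
    unfolding starts_at_vertex ends_at_vertex by (simp add: sum.reindex inj_on_def)
qed

text \<open>
  The solution on the whole edge that starts on the first link. It turns out to have the prescribed
  values at all nodes of the edge if \<open>x\<close> is in the kernel.
\<close>

definition wave :: "real \<Rightarrow> ('v + 'e \<times> nat \<Rightarrow> real) \<Rightarrow> 'e \<Rightarrow> real \<Rightarrow> real" where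
  "wave w x e y = cosw w y * x (pt e 0) + sinw w y * start_slope w x e 0"

definition wave_deriv :: "real \<Rightarrow> ('v + 'e \<times> nat \<Rightarrow> real) \<Rightarrow> 'e \<Rightarrow> real \<Rightarrow> real" where
  "wave_deriv w x e y = cosw w y * start_slope w x e 0 - w\<^sup>2 * sinw w y * x (pt e 0)"

lemma wave_add:
  "wave w x e (y + h) = cosw w h * wave w x e y + sinw w h * wave_deriv w x e y"
  "wave_deriv w x e (y + h) = cosw w h * wave_deriv w x e y - w\<^sup>2 * sinw w h * wave w x e y"
  by (simp_all add: wave_def wave_deriv_def cosw_add sinw_add algebra_simps)

lemma wave_step:
  assumes S: "sinw w (mesh e) \<noteq> 0"
    and at: "wave w x e y = x (pt e i)" "wave_deriv w x e y = start_slope w x e i"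
  shows "wave w x e (y + mesh e) = x (pt e (Suc i))" "wave_deriv w x e (y + mesh e) = end_slope w x e i"
proof -
  define c where "c = cosw w (mesh e)"
  define s where "s = sinw w (mesh e)"
  have cs: "c\<^sup>2 + w\<^sup>2 * s\<^sup>2 = 1" unfolding c_def s_def by (rule cosw_sinw_square)
  have s: "s \<noteq> 0" using S by (simp add: s_def)
  show "wave w x e (y + mesh e) = x (pt e (Suc i))"
    unfolding wave_add at start_slope_def using S by simp
  have "wave_deriv w x e (y + mesh e) = (c * x (pt e (Suc i)) - (c\<^sup>2 + w\<^sup>2 * s\<^sup>2) * x (pt e i)) / s"
    unfolding wave_add at start_slope_def c_def[symmetric] s_def[symmetric] using s
    by (simp add: field_simps power2_eq_square)
  then show "wave_deriv w x e (y + mesh e) = end_slope w x e i"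
    unfolding cs by (simp add: end_slope_def c_def s_def)
qed

lemma wave_nodes:
  assumes w: "0 \<le> w" "w \<le> K" and x: "x \<in> form_kernel (grid_form w) grid_space" and e: "e \<in> arcs G"
    and i: "i < m"
  shows "wave w x e (real i * mesh e) = x (pt e i)" "wave_deriv w x e (real i * mesh e) = start_slope w x e i"
proof -
  have S: "sinw w (mesh e) \<noteq> 0" using sinw_mesh_pos[OF w e] by simp
  have "wave w x e (real i * mesh e) = x (pt e i) \<and> wave_deriv w x e (real i * mesh e) = start_slope w x e i"
    using i
  proof (induction i)
    case 0
    then show ?case by (simp add: wave_def wave_deriv_def)
  next
    case (Suc i)
    then have "wave w x e (real i * mesh e) = x (pt e i)" "wave_deriv w x e (real i * mesh e) = start_slope w x e i"
      by auto
    from wave_step[OF S this] kernel_smooth[OF x e Suc.prems] show ?case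
      by (simp add: algebra_simps)
  qed
  then show "wave w x e (real i * mesh e) = x (pt e i)" "wave_deriv w x e (real i * mesh e) = start_slope w x e i"
    by auto
qed

lemma wave_end:
  assumes w: "0 \<le> w" "w \<le> K" and x: "x \<in> form_kernel (grid_form w) grid_space" and e: "e \<in> arcs G"
  shows "wave w x e (l e) = x (Inl (head G e))" "wave_deriv w x e (l e) = end_slope w x e (m - 1)"
proof -
  have S: "sinw w (mesh e) \<noteq> 0" using sinw_mesh_pos[OF w e] by simp
  have i: "m - 1 < m" "Suc (m - 1) = m" using m_pos by auto
  have "real (m - 1) * mesh e + mesh e = l e"
    using mesh_length[of e] m_pos by (simp add: of_nat_diff algebra_simps)
  with wave_step[OF S wave_nodes[OF w x e i(1)]] i(2)
  show "wave w x e (l e) = x (Inl (head G e))" "wave_deriv w x e (l e) = end_slope w x e (m - 1)"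
    by auto
qed

definition extension :: "real \<Rightarrow> ('v + 'e \<times> nat \<Rightarrow> real) \<Rightarrow> 'e \<Rightarrow> real \<Rightarrow> real" where
  "extension w x = (\<lambda>e y. if e \<in> arcs G \<and> y \<in> {0..l e} then wave w x e y else 0)"

lemma extension_eigenfunction:
  assumes w: "0 \<le> w" "w \<le> K" and x: "x \<in> form_kernel (grid_form w) grid_space"
  shows "extension w x \<in> eigenspace G l D (w\<^sup>2)"
  unfolding eigenspace_def
proof (intro CollectI conjI allI impI exI[of _ "wave_deriv w x"] ballI)
  fix e y assume "\<not> (e \<in> arcs G \<and> y \<in> {0..l e})"
  then show "extension w x e y = 0" by (auto simp: extension_def)
next
  fix e y assume e: "e \<in> arcs G" and y: "y \<in> {0..l e}"
  have ext: "extension w x e z = wave w x e z" if "z \<in> {0..l e}" for z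
    using e that by (simp add: extension_def)
  have "(wave w x e has_real_derivative wave_deriv w x e y) (at y within {0..l e})"
    unfolding wave_def wave_deriv_def by (auto intro!: derivative_eq_intros)
  then show "(extension w x e has_real_derivative wave_deriv w x e y) (at y within {0..l e})"
    unfolding has_field_derivative_def by (rule has_derivative_transform[OF y, rotated]) (rule ext)
  have "(wave_deriv w x e has_real_derivative - w\<^sup>2 * wave w x e y) (at y within {0..l e})"
    unfolding wave_def wave_deriv_def
    by (auto intro!: derivative_eq_intros simp: algebra_simps)
  then show "(wave_deriv w x e has_real_derivative - w\<^sup>2 * extension w x e y) (at y within {0..l e})"
    using ext[OF y] by simp
next
  have V: "x \<in> grid_space" using x by (simp add: form_kernel_def)
  have start: "extension w x e 0 = x (Inl (tail G e))" if "e \<in> arcs G" for e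
    using that length_pos[OF that] by (simp add: extension_def wave_def)
  have stop: "extension w x e (l e) = x (Inl (head G e))" if "e \<in> arcs G" for e
    using that length_pos[OF that] wave_end(1)[OF w x that] by (simp add: extension_def)
  fix v
  {
    assume v: "v \<in> verts G - D"
    have "(\<Sum>e\<in>out_arcs G v. wave_deriv w x e 0) = (\<Sum>e\<in>out_arcs G v. start_slope w x e 0)"
      by (simp add: wave_deriv_def)
    moreover have "(\<Sum>e\<in>in_arcs G v. - wave_deriv w x e (l e)) = - (\<Sum>e\<in>in_arcs G v. end_slope w x e (m - 1))"
      unfolding sum_negf[symmetric] by (intro sum.cong) (auto simp: wave_end(2)[OF w x])
    ultimately show "natural_condition G l v (extension w x) (wave_deriv w x)"
      unfolding natural_condition_def using start stop kernel_vertex[OF x] v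
      by (intro conjI exI[of _ "x (Inl v)"]) auto
  }
  assume v: "v \<in> D"
  then show "Dirichlet_condition G l v (extension w x)"
    using start stop V by (auto simp: Dirichlet_condition_def mem_grid_space)
qed

lemma linear_extension: "linear (extension w)"
  by (rule linearI)
    (auto simp: extension_def wave_def start_slope_def fun_eq_iff algebra_simps add_divide_distrib diff_divide_distrib)

lemma extension_injective:
  assumes w: "0 \<le> w" "w \<le> K"
    and x: "x \<in> form_kernel (grid_form w) grid_space" and y: "y \<in> form_kernel (grid_form w) grid_space"
    and eq: "extension w x = extension w y"
  shows "x = y"
proof
  fix p
  show "x p = y p"
  proof (cases "p \<in> nodes")
    case False
    then show ?thesis using x y by (auto simp: form_kernel_def mem_grid_space supported_def)
  next
    case True
    have val: "extension w z e (real i * mesh e) = z (pt e i)"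
      if "z \<in> form_kernel (grid_form w) grid_space" "e \<in> arcs G" "i \<le> m" for z e i
    proof -
      have "real i * mesh e \<le> real m * mesh e" using that mesh_pos[OF that(2)] by simp
      then have "real i * mesh e \<in> {0..l e}" using mesh_pos[OF that(2)] mesh_length[of e] by simp
      then have "extension w z e (real i * mesh e) = wave w z e (real i * mesh e)"
        using that by (simp add: extension_def)
      then show ?thesis
        using wave_nodes(1)[OF w that(1,2), of i] wave_end(1)[OF w that(1,2)] mesh_length[of e] that(3)
        by (cases "i = m") auto
    qed
    obtain e i where "e \<in> arcs G" "i < m" "p = pt e i \<or> p = pt e (Suc i)"
      using True by (rule node_on_link)
    then obtain j where "e \<in> arcs G" "j \<le> m" "p = pt e j" by (metis Suc_leI less_imp_le)
    then show ?thesis using val[OF x, of e j] val[OF y, of e j] eq by simp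
  qed
qed

lemma dim_kernel_le:
  assumes w: "0 \<le> w" "w \<le> K"
  shows "dim (form_kernel (grid_form w) grid_space) \<le> dim (eigenspace G l D (w\<^sup>2))"
proof -
  define Z where "Z = form_kernel (grid_form w) grid_space"
  have "Z \<subseteq> grid_space" by (auto simp: Z_def form_kernel_def)
  then have "fin_dim Z"
    using fin_dim_admissible[OF finite_nodes] fin_dim_mono unfolding grid_space_def by blast
  then obtain B where B: "finite B" "B \<subseteq> Z" "independent B" "Z \<subseteq> span B" "card B = dim Z"
    by (rule fin_dim_basis)
  have Zsub: "subspace Z"
  proof -
    have "subspace grid_space"
      unfolding subspace_def by (auto simp: mem_grid_space supported_def)
    then show ?thesis using bilinear_grid_form[of w] unfolding Z_def form_kernel_def subspace_def
      by (auto simp: bilinear_lzero bilinear_ladd bilinear_lmul)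
  qed
  have sB: "span B \<subseteq> Z" using B(2) Zsub by (rule span_minimal)
  have inj: "inj_on (extension w) (span B)"
    using sB extension_injective[OF w] by (intro inj_onI) (auto simp: Z_def)
  have "independent (extension w ` B)"
    using linear_extension B(3) inj by (rule linear_independent_injective_image)
  moreover have "extension w ` B \<subseteq> eigenspace G l D (w\<^sup>2)"
    using B(2) extension_eigenfunction[OF w] by (auto simp: Z_def)
  ultimately have "card (extension w ` B) \<le> dim (eigenspace G l D (w\<^sup>2))"
    using independent_fin_dim(2)[OF fin_dim_eigenspace] by blast
  moreover have "card (extension w ` B) = card B"
    using inj span_superset[of B] by (intro card_image) (blast intro: inj_on_subset)
  ultimately show ?thesis using B(5) by (simp add: Z_def)
qed

text \<open>
  The slopes of the node values of \<open>u\<close> are the derivatives of \<open>u\<close>, so the grid form telescopes along each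
  edge and only the flux at the vertices remains.
\<close>

lemma kernel_of_eigenfunction:
  assumes w: "0 \<le> w" "w \<le> K" and u: "u \<in> eigenspace G l D (w\<^sup>2)" "u \<noteq> 0"
  obtains x where "x \<in> form_kernel (grid_form w) grid_space" "x \<noteq> 0"
proof -
  obtain u' where u':
    "\<forall>e\<in>arcs G. \<forall>x\<in>{0..l e}. (u e has_real_derivative u' e x) (at x within {0..l e})"
    "\<forall>e\<in>arcs G. \<forall>x\<in>{0..l e}. (u' e has_real_derivative - w\<^sup>2 * u e x) (at x within {0..l e})"
    "\<forall>v\<in>verts G - D. natural_condition G l v u u'"
    "\<forall>v\<in>D. Dirichlet_condition G l v u"
    "\<forall>e x. \<not> (e \<in> arcs G \<and> x \<in> {0..l e}) \<longrightarrow> u e x = 0"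
    by (rule eigenspaceE[OF u(1)])
  obtain c where c: "\<And>v. v \<in> D \<Longrightarrow> c v = 0" "\<And>e. e \<in> arcs G \<Longrightarrow> u e 0 = c (tail G e)"
    "\<And>e. e \<in> arcs G \<Longrightarrow> u e (l e) = c (head G e)"
    by (rule vertex_values[OF u'(3,4)]) blast
  have sol: "u e y = cosw w (y - z) * u e z + sinw w (y - z) * u' e z"
    if "e \<in> arcs G" "y \<in> {0..l e}" "z \<in> {0..l e}" for e y z
    using oscillator_solution[of "l e" "u e" "u' e" w y z] u'(1,2) that by simp
  define x where "x p = (if p \<in> nodes then (case p of Inl v \<Rightarrow> c v | Inr (e, i) \<Rightarrow> u e (real i * mesh e)) else 0)" for p
  have xpt: "x (pt e i) = u e (real i * mesh e)" if "e \<in> arcs G" "i \<le> m" for e i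
    using that pt_in_nodes[OF that] c(2,3)[OF that(1)] mesh_length[of e]
    by (auto simp: x_def pt_def)
  have dom: "real i * mesh e \<in> {0..l e}" if "e \<in> arcs G" "i \<le> m" for e i
  proof -
    have "real i * mesh e \<le> real m * mesh e" using that mesh_pos[OF that(1)] by simp
    then show ?thesis using mesh_pos[OF that(1)] mesh_length[of e] by simp
  qed
  have "x (Inl v) = 0" if "v \<in> D" for v using c(1)[OF that] by (simp add: x_def)
  then have V: "x \<in> grid_space" by (auto simp: mem_grid_space supported_def x_def)
  have slopes: "start_slope w x e i = u' e (real i * mesh e)" "end_slope w x e i = u' e (real (Suc i) * mesh e)"
    if e: "e \<in> arcs G" and i: "i < m" for e i
  proof -
    have S: "sinw w (mesh e) \<noteq> 0" using sinw_mesh_pos[OF w e] by simp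
    have d: "real (Suc i) * mesh e - real i * mesh e = mesh e" "real i * mesh e - real (Suc i) * mesh e = - mesh e"
      by (simp_all add: algebra_simps)
    have "u e (real (Suc i) * mesh e) = cosw w (mesh e) * u e (real i * mesh e) + sinw w (mesh e) * u' e (real i * mesh e)"
      using sol[OF e dom[OF e, of "Suc i"] dom[OF e, of i]] i unfolding d by simp
    then show "start_slope w x e i = u' e (real i * mesh e)"
      unfolding start_slope_def using xpt[OF e, of i] xpt[OF e, of "Suc i"] i S by simp
    have "u e (real i * mesh e) = cosw w (mesh e) * u e (real (Suc i) * mesh e) - sinw w (mesh e) * u' e (real (Suc i) * mesh e)"
      using sol[OF e dom[OF e, of i] dom[OF e, of "Suc i"]] i unfolding d by (simp add: cosw_minus sinw_minus)
    then show "end_slope w x e i = u' e (real (Suc i) * mesh e)"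
      unfolding end_slope_def using xpt[OF e, of i] xpt[OF e, of "Suc i"] i S by simp
  qed
  have "grid_form w x y = 0" if y: "y \<in> grid_space" for y
  proof -
    define f where "f e i = u' e (real i * mesh e) * y (pt e i)" for e i
    have "grid_form w x y = (\<Sum>e\<in>arcs G. \<Sum>i<m. end_slope w x e i * y (pt e (Suc i)) - start_slope w x e i * y (pt e i))"
      unfolding grid_form_slopes by (simp add: sum_links)
    also have "\<dots> = (\<Sum>e\<in>arcs G. \<Sum>i<m. f e (Suc i) - f e i)"
      unfolding f_def by (intro sum.cong refl) (simp only: slopes lessThan_iff)
    also have "\<dots> = (\<Sum>e\<in>arcs G. f e m - f e 0)"
      by (simp add: sum_lessThan_telescope)
    also have "\<dots> = (\<Sum>e\<in>arcs G. y (Inl (head G e)) * u' e (l e) - y (Inl (tail G e)) * u' e 0)"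
      by (simp add: f_def mesh_length mult.commute)
    also have "\<dots> = 0"
      using y by (intro vertex_flux[where f = "\<lambda>v. y (Inl v)", OF u'(3)]) (auto simp: mem_grid_space)
    finally show ?thesis .
  qed
  then have ker: "x \<in> form_kernel (grid_form w) grid_space" using V by (simp add: form_kernel_def)
  have "x \<noteq> 0"
  proof
    assume x0: "x = 0"
    have "u e y = 0" for e y
    proof (cases "e \<in> arcs G \<and> y \<in> {0..l e}")
      case True
      then have e: "e \<in> arcs G" and y: "y \<in> {0..l e}" by auto
      have "u e 0 = 0" using xpt[OF e, of 0] x0 by simp
      moreover have "u' e 0 = 0" using slopes(1)[OF e m_pos] x0 by (simp add: start_slope_def)
      ultimately show ?thesis using sol[OF e y, of 0] length_pos[OF e] by simp
    next
      case False
      then show ?thesis using u'(5) by blast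
    qed
    then have "u = 0" by (simp add: fun_eq_iff)
    then show False using u(2) by simp
  qed
  then show ?thesis using that ker by blast
qed

end

section \<open>The eigenvalue bound\<close>

text \<open>
  Squaring is a bijection from the frequencies with a nontrivial kernel onto the eigenvalues up to
  \<open>K\<^sup>2\<close>, and the kernel embeds into the eigenspace.
\<close>

lemma (in subdivided_quantum_graph) eigenvalue_count_ge:
  assumes nc: "\<not> cycle_graph G" and k: "k \<ge> 1"
    and big: "pi * (real k - 2 + real_of_int (betti G) + real (card D)
            + (real (card (Neumann_vertices G D)) + real_of_int (betti G)) / 2) < K * total_length G l"
  shows "finite {\<nu>. is_eigenvalue G l D \<nu> \<and> \<nu> \<le> K\<^sup>2}" "k \<le> eigenvalue_count G l D (K\<^sup>2)"
proof -
  obtain W where W: "subspace W" "W \<subseteq> grid_space" "\<And>x. x \<in> W \<Longrightarrow> grid_form K x x \<le> 0" "k \<le> dim W"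
    by (rule test_space[OF nc k big]) blast
  define M where "M = {w \<in> {0..K}. form_kernel (grid_form w) grid_space \<noteq> {0}}"
  have V: "subspace grid_space" "fin_dim grid_space"
    using fin_dim_admissible[OF finite_nodes]
    by (auto simp: subspace_def mem_grid_space supported_def) (simp add: grid_space_def)
  note flow = spectral_flow[where B = grid_form, OF V less_imp_le[OF K_pos] bilinear_grid_form
      grid_form_commute continuous_grid_form grid_form_strict grid_form_0_nonneg W(1-3)]
  have fin: "finite M" unfolding M_def by (rule flow(1))
  have dimW: "dim W \<le> (\<Sum>w\<in>M. dim (form_kernel (grid_form w) grid_space))"
    unfolding M_def by (rule flow(2))
  have zero: "0 \<in> form_kernel (grid_form w) grid_space" for w
    using subspace_0[OF V(1)] bilinear_lzero[OF bilinear_grid_form] by (simp add: form_kernel_def)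
  have ev: "{\<nu>. is_eigenvalue G l D \<nu> \<and> \<nu> \<le> K\<^sup>2} = (\<lambda>w. w\<^sup>2) ` M"
  proof (intro equalityI subsetI)
    fix \<nu> assume "\<nu> \<in> {\<nu>. is_eigenvalue G l D \<nu> \<and> \<nu> \<le> K\<^sup>2}"
    then obtain u where u: "u \<in> eigenspace G l D \<nu>" "u \<noteq> 0" and le: "\<nu> \<le> K\<^sup>2"
      by (auto simp: is_eigenvalue_def)
    have "0 \<le> \<nu>" using no_negative_eigenvalue[OF _ u(1)] u(2) by force
    then have w: "0 \<le> sqrt \<nu>" "sqrt \<nu> \<le> K" "(sqrt \<nu>)\<^sup>2 = \<nu>"
      using le K_pos by (auto intro: real_le_lsqrt)
    have u': "u \<in> eigenspace G l D ((sqrt \<nu>)\<^sup>2)" using u(1) w(3) by simp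
    obtain x where "x \<in> form_kernel (grid_form (sqrt \<nu>)) grid_space" "x \<noteq> 0"
      by (rule kernel_of_eigenfunction[OF w(1,2) u' u(2)])
    then have "sqrt \<nu> \<in> M" using w by (auto simp: M_def)
    then show "\<nu> \<in> (\<lambda>w. w\<^sup>2) ` M" using w(3) by force
  next
    fix \<nu> assume "\<nu> \<in> (\<lambda>w. w\<^sup>2) ` M"
    then obtain w where \<nu>: "\<nu> = w\<^sup>2" and w: "w \<in> M" by blast
    then have w01: "0 \<le> w" "w \<le> K" by (auto simp: M_def)
    obtain x where x: "x \<in> form_kernel (grid_form w) grid_space" "x \<noteq> 0"
      using w zero[of w] by (auto simp: M_def)
    have "extension w x \<noteq> 0"
      using extension_injective[OF w01 x(1) zero] x(2) linear_0[OF linear_extension] by metis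
    then have "is_eigenvalue G l D \<nu>"
      using extension_eigenfunction[OF w01 x(1)] unfolding is_eigenvalue_def \<nu> by blast
    moreover have "\<nu> \<le> K\<^sup>2" using w01 \<nu> by (simp add: power_mono)
    ultimately show "\<nu> \<in> {\<nu>. is_eigenvalue G l D \<nu> \<and> \<nu> \<le> K\<^sup>2}" by simp
  qed
  show "finite {\<nu>. is_eigenvalue G l D \<nu> \<and> \<nu> \<le> K\<^sup>2}" unfolding ev using fin by simp
  have inj: "inj_on (\<lambda>w::real. w\<^sup>2) M"
    by (rule inj_onI) (auto simp: M_def power2_eq_iff_nonneg)
  have "k \<le> (\<Sum>w\<in>M. dim (form_kernel (grid_form w) grid_space))" using W(4) dimW by simp
  also have "\<dots> \<le> (\<Sum>w\<in>M. multiplicity G l D (w\<^sup>2))"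
    unfolding multiplicity_def edge_fun_dim by (intro sum_mono dim_kernel_le) (auto simp: M_def)
  also have "\<dots> = eigenvalue_count G l D (K\<^sup>2)"
    unfolding eigenvalue_count_def ev by (simp add: sum.reindex[OF inj])
  finally show "k \<le> eigenvalue_count G l D (K\<^sup>2)" .
qed

text \<open>
  The largest eigenvalue up to \<open>t\<close> already has the count that \<open>t\<close> has.
\<close>

lemma eigenvalue_le:
  assumes fin: "finite {\<nu>. is_eigenvalue G l D \<nu> \<and> \<nu> \<le> t}" and k: "k \<ge> 1" "k \<le> eigenvalue_count G l D t"
  shows "eigenvalue G l D k \<le> ereal t"
proof -
  define S where "S = {\<nu>. is_eigenvalue G l D \<nu> \<and> \<nu> \<le> t}"
  have "S \<noteq> {}"
  proof
    assume "S = {}"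
    then have "eigenvalue_count G l D t = 0" unfolding eigenvalue_count_def S_def by (simp only: sum.empty)
    then show False using k by simp
  qed
  then have M: "Max S \<in> S" using fin by (intro Max_in) (auto simp: S_def)
  then have "{\<nu>. is_eigenvalue G l D \<nu> \<and> \<nu> \<le> Max S} = S"
    using fin Max_ge[of S] by (auto simp: S_def)
  then have "eigenvalue_count G l D (Max S) = eigenvalue_count G l D t"
    unfolding eigenvalue_count_def S_def by (simp only:)
  then have "eigenvalue G l D k \<le> ereal (Max S)"
    unfolding eigenvalue_def using M k by (intro Inf_lower) (auto simp: S_def)
  also have "\<dots> \<le> ereal t" using M by (simp add: S_def)
  finally show ?thesis .
qed

theorem theorem4p9:
  fixes G :: "('v, 'e) pre_digraph" and l :: "'e \<Rightarrow> real" and D :: "'v set" and k :: nat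
  assumes "quantum_graph G l D"
    and "\<not> cycle_graph G"
    and "k \<ge> 1"
  shows "eigenvalue G l D k \<le>
    ereal ((real k - 2 + real_of_int (betti G) + real (card D)
            + (real (card (Neumann_vertices G D)) + real_of_int (betti G)) / 2)\<^sup>2
           * (pi\<^sup>2 / (total_length G l)\<^sup>2))"
proof -
  interpret quantum_graph G l D by fact
  define c where "c = real k - 2 + real_of_int (betti G) + real (card D)
            + (real (card (Neumann_vertices G D)) + real_of_int (betti G)) / 2"
  define L where "L = total_length G l"
  have le_L: "l e \<le> L" if "e \<in> arcs G" for e
    unfolding L_def total_length_def using that length_pos by (intro member_le_sum) (auto intro: less_imp_le)
  obtain e0 where "e0 \<in> arcs G" using arcs_nonempty by blast
  then have L: "0 < L" using le_L length_pos by force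
  \<comment> \<open>The dimension count has to exceed \<open>k - 1\<close> strictly, so only larger frequencies are covered at first. The absolute value keeps \<open>K\<close> positive.\<close>
  have bound: "eigenvalue G l D k \<le> ereal (K\<^sup>2)" if K: "\<bar>c\<bar> * pi / L < K" for K
  proof -
    have "0 \<le> \<bar>c\<bar> * pi / L" using L by simp
    then have K0: "0 < K" using K by linarith
    define m where "m = nat \<lceil>K * L / pi\<rceil> + 1"
    have m: "K * L / pi < real m" unfolding m_def by linarith
    interpret subdivided_quantum_graph G l D m K
    proof
      show "0 < m" by (simp add: m_def)
      show "0 < K" by (rule K0)
      fix e assume e: "e \<in> arcs G"
      have "K * l e \<le> K * L" using le_L[OF e] K0 by simp
      also have "K * L < real m * pi" using m by (simp add: field_simps)
      finally show "K * (l e / real m) < pi" using m_def by (simp add: field_simps)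
    qed
    have "pi * c \<le> \<bar>c\<bar> * pi" by (simp add: abs_le_iff mult.commute)
    also have "\<dots> < K * L" using K L by (simp add: field_simps)
    finally have "pi * c < K * total_length G l" by (simp add: L_def)
    then show ?thesis
      using eigenvalue_count_ge[OF assms(2,3)] assms(3) unfolding c_def by (intro eigenvalue_le) auto
  qed
  define K0 where "K0 = \<bar>c\<bar> * pi / L"
  have "((\<lambda>K. ereal (K\<^sup>2)) \<longlongrightarrow> ereal (K0\<^sup>2)) (at_right K0)"
    by (intro tendsto_intros)
  moreover have "\<forall>\<^sub>F K in at_right K0. eigenvalue G l D k \<le> ereal (K\<^sup>2)"
    using eventually_at_right_less by eventually_elim (rule bound, simp add: K0_def)
  ultimately have "eigenvalue G l D k \<le> ereal (K0\<^sup>2)"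
    by (rule tendsto_lowerbound) simp
  also have "K0\<^sup>2 = c\<^sup>2 * (pi\<^sup>2 / L\<^sup>2)"
    by (simp add: K0_def power_divide power_mult_distrib)
  finally show ?thesis by (simp add: c_def L_def)
qed

end
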